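(* Let $B$ be a bounded neighborhood of $\psi=0$ in $X$. (1) Uniformly on $B$, for $i=1,2$, $\lambda^{i,\pm}_n(\psi)=\lambda^{i,\pm}_n(0)+\ell^{\infty,1}_n$ and $\dot\lambda^i_n(\psi)=\dot\lambda^i_n(0)+\ell^{\infty,1}_n$, i.e. $$\sup_{\psi\in B}\sup_{n\in\mathbb{Z}}(1+n^2)^{1/2}|\lambda^{i,\pm}_n(\psi)-\lambda^{i,\pm}_n(0)|<\infty,\qquad \sup_{\psi\in B}\sup_{n\in\mathbb{Z}}(1+n^2)^{1/2}|\dot\lambda^{i}_n(\psi)-\dot\lambda^{i}_n(0)|<\infty,$$ where $\lambda^{i,\pm}_n(0)=\dot\lambda^i_n(0)=\operatorname{sgn}(n)\sqrt{(-1)^{i-1}|n|\pi/2}$. (2) There exists a neighborhood $W\subseteq B$ of the zero potential such that for all $\psi\in W$ and every $n\in\mathbb{Z}$: (a) $\sigma_P(\psi)\cap D^i_n=\{\lambda^{i,-}_n(\psi),\lambda^{i,+}_n(\psi)\}$, $i=1,2$; (b) $\Delta(\lambda^{i,\pm}_n(\psi),\psi)=2(-1)^n$, $i=1,2$; (c) $\{\lambda\in\mathbb{C}:\dot\Delta(\lambda,\psi)=0\}\cap D^i_n=\{\dot\lambda^i_n(\psi)\}$, $i=1,2$. (3) Let $W\subseteq B$ be an open neighborhood of the zero potential such that part (c) of (2) is fulfilled. Then the critical points $\dot\lambda^i_n$, considered as functions of $\psi$, are analytic on $W$ for all $n\in\mathbb{Z}\setminus\{0\}$, $i=1,2$. Furthermore,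 for every $\psi\in W$ and every sequence $(\psi_k)_{k\in\mathbb{N}}$ in $W$ with $\psi_k\to\psi$ as $k\to\infty$, $$\lim_{k\to\infty}\Big(\sup_{n\in\mathbb{Z}\setminus\{0\}}(1+n^2)^{1/2}\big|\dot\lambda^i_n(\psi_k)-\dot\lambda^i_n(\psi)\big|\Big)=0,\qquad i=1,2.$$
   Context: $X=H^1(\mathbb{T},\mathbb{C})^4$, $\mathbb{T}=\mathbb{R}/\mathbb{Z}$, with its Hilbert norm; $\psi=(\psi^1,\dots,\psi^4)\in X$. Let $\sigma_3=\mathrm{diag}(1,-1)$ and $V=\begin{pmatrix}-i\psi^1\psi^2 & 2\lambda\psi^1+i\psi^3\\ 2\lambda\psi^2-i\psi^4 & i\psi^1\psi^2\end{pmatrix}$. $M(t,\lambda,\psi)$ is the unique matrix solution of $\partial_tM=(-2i\lambda^2\sigma_3+V)M$, $M(0)=I$; $\Delta(\lambda,\psi)=\operatorname{tr}M(1,\lambda,\psi)$, $\dot\Delta=\partial_\lambda\Delta$. The periodic eigenvalues of $\psi$ are the roots (with multiplicity) of $\chi_P(\cdot,\psi)=\Delta^2(\cdot,\psi)-4$; $\sigma_P(\psi)$ is the set of these roots. The critical points are the roots of $\dot\Delta(\cdot,\psi)$. Discs: for $m\in\mathbb{Z}\setminus\{0\}$ let $U_m=\{\lambda\in\mathbb{C}:|2\lambda^2-m\pi|<\pi/4\}$. For $n\ge1$: $D^1_n=U_n\cap\{\operatorname{Re}\lambda>0\}$, $D^1_{-n}=U_n\cap\{\operatorname{Re}\lambda<0\}$,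 $D^2_n=U_{-n}\cap\{\operatorname{Im}\lambda>0\}$, $D^2_{-n}=U_{-n}\cap\{\operatorname{Im}\lambda<0\}$. By convention $D^1_0=D^2_0=D_0=B_0=\{|\lambda|<\sqrt{\pi/8}\}$, and for $N\ge1$, $B_N=\{|\lambda|<\sqrt{(N+1/4)\pi/2}\}$. Convention: $\sqrt{-x}=i\sqrt{x}$ for $x\geq0$; $\operatorname{sgn}(0)=0$. Lexicographic order: $z_1\preceq z_2$ iff $\operatorname{Re}z_1<\operatorname{Re}z_2$, or $\operatorname{Re}z_1=\operatorname{Re}z_2$ and $\operatorname{Im}z_1\le\operatorname{Im}z_2$. Labeling of periodic eigenvalues: for each $\psi$ let $N\ge0$ be the minimal integer such that for all $|n|>N$, $i=1,2$, the disc $D^i_n$ contains exactly two periodic eigenvalues counted with multiplicity, denoted $\lambda^{i,-}_n\preceq\lambda^{i,+}_n$, and $B_N$ contains precisely $4(2N+1)$ counted with multiplicity (there are no others). Those in $B_N$ are listed with multiplicity and labeled so that $\lambda^{1,-}_{-N}\preceq\lambda^{1,+}_{-N}\preceq\cdots\preceq\lambda^{1,-}_{-1}\preceq\lambda^{1,+}_{-1}\preceq\lambda^{2,-}_{-N}\preceq\lambda^{2,+}_{-N}\preceq\cdots\preceq\lambda^{2,-}_{-1}\preceq\lambda^{2,+}_{-1}\preceq\lambda^{1,-}_0\preceq\lambda^{1,+}_0\preceq\lambda^{2,-}_0\preceq\lambda^{2,+}_0\preceq\lambda^{2,-}_1\preceq\lambda^{2,+}_1\preceq\cdots\preceq\lambda^{2,-}_N\preceq\lambda^{2,+}_N\preceq\lambda^{1,-}_1\preceq\lambda^{1,+}_1\preceq\cdots\preceq\lambda^{1,-}_N\preceq\lambda^{1,+}_N$;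 if $N=0$ only $\lambda^{1,-}_0\preceq\lambda^{1,+}_0$ and $\lambda^{2,-}_0\preceq\lambda^{2,+}_0$ are required. Labeling of critical points: for each $\psi$ let $N\ge0$ be the minimal integer such that for all $|n|>N$, $i=1,2$, the disc $D^i_n$ contains exactly one root of $\dot\Delta(\cdot,\psi)$, which is simple and denoted $\dot\lambda^i_n$, and $B_N$ contains the remaining $4N+3$ roots counted with multiplicity. Those in $B_N$ are listed with multiplicity in the order $\dot\lambda^1_{-N}\preceq\cdots\preceq\dot\lambda^1_{-1}\preceq\dot\lambda^2_{-N}\preceq\cdots\preceq\dot\lambda^2_{-1}\preceq(\text{three roots})\preceq\dot\lambda^2_1\preceq\cdots\preceq\dot\lambda^2_N\preceq\dot\lambda^1_1\preceq\cdots\preceq\dot\lambda^1_N$, where the three middle roots are $\dot\lambda^1_0\preceq\dot\lambda^2_0$ and one additional root close to the origin that is left unlabeled and ignored.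
   Formalization: At n=0, where D^1_0=D^2_0, parts (2)(a),(c) (and (c) as hypothesis of (3)) are joint in i: D_0 holds all four eigenvalues of index 0, and the two critical points of index 0 plus the unlabeled one; the literal version fails for small constant potentials. *)

theory Defs
  imports "HOL-Complex_Analysis.Complex_Analysis" "HOL-Library.Numeral_Type"
begin

text \<open>
  An element of the Sobolev space is represented by its continuous representative, a 1-periodic
  function which on \<open>[0,1]\<close> is the indefinite integral of a square integrable function \<open>g\<close>,
  its weak derivative.
\<close>

definition h1_deriv_of :: "(real \<Rightarrow> complex) \<Rightarrow> (real \<Rightarrow> complex) \<Rightarrow> bool" where
  "h1_deriv_of f g \<longleftrightarrow>
     g \<in> borel_measurable borel \<and>
     set_integrable lborel {0..1} (\<lambda>t. (cmod (g t))\<^sup>2) \<and>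
     (\<forall>t\<in>{0..1}. f t = f 0 + (LBINT s:{0..t}. g s))"

lemma h1_deriv_ofD:
  assumes "h1_deriv_of f g" "t \<in> {0..1}"
  shows "f t = f 0 + (LBINT s:{0..t}. g s)"
  using assms unfolding h1_deriv_of_def by blast

lemma h1_deriv_of_integrable:
  assumes "h1_deriv_of f g"
  shows "set_integrable lborel {0..1} g"
proof -
  have m[measurable]: "g \<in> borel_measurable borel" and
    i: "set_integrable lborel {0..1} (\<lambda>t. (cmod (g t))\<^sup>2)"
    using assms by (auto simp: h1_deriv_of_def)
  have "set_integrable lborel {0..1} (\<lambda>t. 1 + (cmod (g t))\<^sup>2)"
    using i by (intro set_integral_add) (auto simp: set_integrable_def)
  then show ?thesis
  proof (rule set_integrable_bound)
    show "set_borel_measurable lborel {0..1} g"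
      unfolding set_borel_measurable_def by measurable
    have "cmod z \<le> 1 + (cmod z)\<^sup>2" for z
    proof -
      have "0 \<le> (cmod z - 1)\<^sup>2" by simp
      then have "2 * cmod z \<le> 1 + (cmod z)\<^sup>2" by (simp add: power2_diff)
      then show ?thesis using norm_ge_zero[of z] by linarith
    qed
    then show "AE x in lborel. x \<in> {0..1} \<longrightarrow> norm (g x) \<le> norm (1 + (cmod (g x))\<^sup>2)"
      by (auto simp: abs_of_nonneg)
  qed
qed

lemma set_integrable_L2_prod:
  fixes f g :: "real \<Rightarrow> complex"
  assumes [measurable]: "f \<in> borel_measurable borel" "g \<in> borel_measurable borel"
    and "set_integrable lborel {0..1} (\<lambda>t. (cmod (f t))\<^sup>2)"
    and "set_integrable lborel {0..1} (\<lambda>t. (cmod (g t))\<^sup>2)"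
  shows "set_integrable lborel {0..1} (\<lambda>t. f t \<bullet> g t)"
proof (rule set_integrable_bound)
  show "set_integrable lborel {0..1} (\<lambda>t. (cmod (f t))\<^sup>2 + (cmod (g t))\<^sup>2)"
    using assms by (intro set_integral_add) auto
  show "set_borel_measurable lborel {0..1} (\<lambda>t. f t \<bullet> g t)"
    unfolding set_borel_measurable_def by measurable
  have "\<bar>w \<bullet> z\<bar> \<le> (cmod w)\<^sup>2 + (cmod z)\<^sup>2" for w z
  proof -
    have "0 \<le> (cmod w - cmod z)\<^sup>2" by simp
    then have "2 * (cmod w * cmod z) \<le> (cmod w)\<^sup>2 + (cmod z)\<^sup>2" by (simp add: power2_diff)
    moreover have "\<bar>w \<bullet> z\<bar> \<le> cmod w * cmod z" by (rule Cauchy_Schwarz_ineq2)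
    moreover have "0 \<le> cmod w * cmod z" by simp
    ultimately show ?thesis by linarith
  qed
  then show "AE x in lborel. x \<in> {0..1} \<longrightarrow>
      norm (f x \<bullet> g x) \<le> norm ((cmod (f x))\<^sup>2 + (cmod (g x))\<^sup>2)"
    by (auto simp: abs_of_nonneg)
qed

lemma h1_deriv_of_add:
  assumes "h1_deriv_of f1 g1" "h1_deriv_of f2 g2"
  shows "h1_deriv_of (\<lambda>t. f1 t + f2 t) (\<lambda>t. g1 t + g2 t)"
  unfolding h1_deriv_of_def
proof (intro conjI ballI)
  have [measurable]: "g1 \<in> borel_measurable borel" "g2 \<in> borel_measurable borel"
    and i: "set_integrable lborel {0..1} (\<lambda>t. (cmod (g1 t))\<^sup>2)"
      "set_integrable lborel {0..1} (\<lambda>t. (cmod (g2 t))\<^sup>2)"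
    using assms by (auto simp: h1_deriv_of_def)
  show "(\<lambda>t. g1 t + g2 t) \<in> borel_measurable borel" by measurable
  have "set_integrable lborel {0..1}
      (\<lambda>t. (cmod (g1 t))\<^sup>2 + (cmod (g2 t))\<^sup>2 + 2 * (g1 t \<bullet> g2 t))"
    using i by (intro set_integral_add set_integrable_mult_right set_integrable_L2_prod) auto
  then show "set_integrable lborel {0..1} (\<lambda>t. (cmod (g1 t + g2 t))\<^sup>2)"
    by (simp add: power2_norm_eq_inner inner_add_left inner_add_right inner_commute algebra_simps)
  fix t :: real assume t: "t \<in> {0..1}"
  have "set_integrable lborel {0..t} g1" "set_integrable lborel {0..t} g2"
    using assms[THEN h1_deriv_of_integrable] t by (auto elim!: set_integrable_subset)
  then have "(LBINT s:{0..t}. g1 s + g2 s) = (LBINT s:{0..t}. g1 s) + (LBINT s:{0..t}. g2 s)"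
    by (rule set_integral_add)
  then show "f1 t + f2 t = f1 0 + f2 0 + (LBINT s:{0..t}. g1 s + g2 s)"
    using h1_deriv_ofD[OF assms(1) t] h1_deriv_ofD[OF assms(2) t] by simp
qed

lemma h1_deriv_of_mult:
  assumes "h1_deriv_of f g"
  shows "h1_deriv_of (\<lambda>t. c * f t) (\<lambda>t. c * g t)"
  unfolding h1_deriv_of_def
proof (intro conjI ballI)
  have [measurable]: "g \<in> borel_measurable borel"
    and i: "set_integrable lborel {0..1} (\<lambda>t. (cmod (g t))\<^sup>2)"
    using assms by (auto simp: h1_deriv_of_def)
  show "(\<lambda>t. c * g t) \<in> borel_measurable borel" by measurable
  show "set_integrable lborel {0..1} (\<lambda>t. (cmod (c * g t))\<^sup>2)"
    using i by (simp add: norm_mult power_mult_distrib)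
  fix t :: real assume t: "t \<in> {0..1}"
  show "c * f t = c * f 0 + (LBINT s:{0..t}. c * g s)"
    using h1_deriv_ofD[OF assms t] by (simp add: distrib_left)
qed

lemma h1_deriv_of_zero: "h1_deriv_of (\<lambda>_. 0) (\<lambda>_. 0)"
  by (simp add: h1_deriv_of_def set_integrable_def)

lemma h1_deriv_of_zero_imp_AE:
  assumes g: "h1_deriv_of (\<lambda>_. 0) g"
  shows "AE t in lborel. t \<in> {0..1} \<longrightarrow> g t = 0"
proof -
  define G where "G = (\<lambda>t. indicator {0..1::real} t *\<^sub>R g t)"
  have G: "integrable lborel G"
    using h1_deriv_of_integrable[OF g] by (simp add: set_integrable_def G_def)
  have GI: "integrable lborel (\<lambda>t. indicator A t *\<^sub>R G t)" if "A \<in> sets borel" for A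
    using G that by (intro integrable_mult_indicator) auto
  have tot: "(LBINT t:{..a}. G t) = 0" for a
  proof -
    have "(LBINT s:{0..t}. g s) = 0" if "t \<in> {0..1}" for t
      using g that by (auto simp: h1_deriv_of_def)
    moreover have "(LBINT t:{..a}. G t) = (LBINT t:{..a} \<inter> {0..1}. g t)"
      unfolding set_lebesgue_integral_def G_def
      by (intro Bochner_Integration.integral_cong) (auto simp: indicator_def)
    moreover have "{..a} \<inter> {0..1} = (if a < 0 then {} else {0..min a 1})"
      by auto
    moreover have "min a 1 \<in> {0..1}" if "\<not> a < 0" using that by auto
    ultimately show ?thesis by (cases "a < 0") (auto simp: set_lebesgue_integral_def[of lborel "{}"])
  qed
  have UNIV0: "(LBINT t:UNIV. G t) = 0"
  proof -
    have "(LBINT t:UNIV. G t) = (LBINT t:{..1}. G t)"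
      unfolding set_lebesgue_integral_def G_def
      by (intro Bochner_Integration.integral_cong) (auto simp: indicator_def)
    then show ?thesis using tot by simp
  qed
  have "(LBINT t:A. G t) = 0" if "A \<in> sets borel" for A
  proof -
    have "A \<in> sigma_sets UNIV (range (\<lambda>a::real. {..a}))"
      using that by (simp add: borel_eq_atMost)
    have IS: "Int_stable (range (\<lambda>a::real. {..a}))"
      by (auto simp: Int_stable_def)
    have sub: "range (\<lambda>a::real. {..a}) \<subseteq> Pow UNIV" by simp
    have bor: "sigma_sets UNIV (range (\<lambda>a::real. {..a})) = sets borel"
      by (simp add: borel_eq_atMost)
    show ?thesis
      using IS sub \<open>A \<in> sigma_sets UNIV _\<close>
    proof (induction rule: sigma_sets_induct_disjoint)
      case (basic A) then show ?case using tot by auto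
    next
      case empty show ?case by (simp add: set_lebesgue_integral_def)
    next
      case (compl A)
      then have [measurable]: "A \<in> sets borel" using bor by simp
      have "(LBINT t:A \<union> (UNIV - A). G t) = (LBINT t:A. G t) + (LBINT t:UNIV - A. G t)"
        by (rule set_integral_Un) (use GI in \<open>auto simp: set_integrable_def\<close>)
      then show ?case using compl UNIV0 by simp
    next
      case (union A)
      then have A: "A i \<in> sets borel" for i using bor by auto
      have "(LBINT t:(\<Union>i. A i). G t) = (\<Sum>i. LBINT t:A i. G t)"
        using A union GI[of "\<Union>i. A i"]
        by (intro lebesgue_integral_countable_add)
          (auto simp: set_integrable_def disjoint_family_on_def)
      then show ?case using union by simp
    qed
  qed
  then have "AE t in lborel. G t = 0"
    using G by (intro sigma_finite_measure.density_zero[OF sigma_finite_lborel]) auto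
  then show ?thesis by eventually_elim (auto simp: G_def)
qed

lemma h1_deriv_of_unique:
  assumes "h1_deriv_of f g1" "h1_deriv_of f g2"
  shows "AE t in lborel. t \<in> {0..1} \<longrightarrow> g1 t = g2 t"
proof -
  have "h1_deriv_of (\<lambda>t. f t + (-1) * f t) (\<lambda>t. g1 t + (-1) * g2 t)"
    by (intro h1_deriv_of_add h1_deriv_of_mult assms)
  then have "h1_deriv_of (\<lambda>_. 0) (\<lambda>t. g1 t + (-1) * g2 t)" by simp
  from h1_deriv_of_zero_imp_AE[OF this] show ?thesis by simp
qed

lemma h1_deriv_of_continuous_on:
  assumes "h1_deriv_of f g"
  shows "continuous_on {0..1} f"
proof -
  note gi = h1_deriv_of_integrable[OF assms]
  have "g integrable_on {0..1}"
    using gi by (rule set_borel_integral_eq_integral)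
  then have "continuous_on {0..1} (\<lambda>t. f 0 + integral {0..t} g)"
    by (intro continuous_intros indefinite_integral_continuous_1)
  moreover have "f 0 + integral {0..t} g = f t" if t: "t \<in> {0..1}" for t
  proof -
    have "set_integrable lborel {0..t} g"
      using gi t by (auto elim!: set_integrable_subset)
    then have "(LBINT s:{0..t}. g s) = integral {0..t} g"
      by (rule set_borel_integral_eq_integral)
    then show ?thesis using h1_deriv_ofD[OF assms t] by simp
  qed
  ultimately show ?thesis by (subst continuous_on_cong[OF refl, symmetric]) auto
qed

typedef h1 = "{f :: real \<Rightarrow> complex. (\<forall>t. f (t + 1) = f t) \<and> (\<exists>g. h1_deriv_of f g)}"
  morphisms h1_apply Abs_h1
  using h1_deriv_of_zero by (intro exI[of _ "\<lambda>_. 0"]) auto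

setup_lifting type_definition_h1

text \<open>By \<open>h1_deriv_of_unique\<close> the choice is immaterial up to null sets.\<close>

definition h1_deriv :: "h1 \<Rightarrow> real \<Rightarrow> complex" where
  "h1_deriv f = (SOME g. h1_deriv_of (h1_apply f) g)"

lemma h1_deriv: "h1_deriv_of (h1_apply f) (h1_deriv f)"
  unfolding h1_deriv_def using h1_apply[of f] by (intro someI_ex[of "h1_deriv_of (h1_apply f)"]) auto

lemma h1_deriv_AE_eq:
  assumes "h1_deriv_of (h1_apply f) g"
  shows "AE t in lborel. t \<in> {0..1} \<longrightarrow> h1_deriv f t = g t"
  using h1_deriv_of_unique[OF h1_deriv assms] .

lift_definition scaleC_h1 :: "complex \<Rightarrow> h1 \<Rightarrow> h1" is "\<lambda>c f t. c * f t"
  using h1_deriv_of_mult by fastforce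

instantiation h1 :: real_vector
begin
lift_definition zero_h1 :: h1 is "\<lambda>_. 0"
  using h1_deriv_of_zero by auto
lift_definition plus_h1 :: "h1 \<Rightarrow> h1 \<Rightarrow> h1" is "\<lambda>f g t. f t + g t"
  using h1_deriv_of_add by fastforce
definition uminus_h1 :: "h1 \<Rightarrow> h1" where "- f = scaleC_h1 (-1) f"
definition minus_h1 :: "h1 \<Rightarrow> h1 \<Rightarrow> h1" where "f - g = f + (- g)" for f g :: h1
definition scaleR_h1 :: "real \<Rightarrow> h1 \<Rightarrow> h1" where "r *\<^sub>R f = scaleC_h1 (of_real r) f"
instance
  by intro_classes
    (unfold minus_h1_def uminus_h1_def scaleR_h1_def, (transfer, auto simp: algebra_simps)+)
end

text \<open>
  On \<^typ>\<open>complex\<close> the product \<open>z \<bullet> w\<close> is \<open>Re (z * cnj w)\<close>, so this is the real part of the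
  Hermitian product of \<open>H\<^sup>1\<close>; it induces the norm \<open>\<parallel>f\<parallel>\<^sup>2 = \<integral>\<bar>f\<bar>\<^sup>2 + \<integral>\<bar>f'\<bar>\<^sup>2\<close> over one period.
\<close>

instantiation h1 :: real_inner
begin
definition inner_h1 :: "h1 \<Rightarrow> h1 \<Rightarrow> real" where
  "f \<bullet> g = (LBINT t:{0..1}. h1_apply f t \<bullet> h1_apply g t) +
           (LBINT t:{0..1}. h1_deriv f t \<bullet> h1_deriv g t)" for f g :: h1
definition norm_h1 :: "h1 \<Rightarrow> real" where "norm f = sqrt (f \<bullet> f)" for f :: h1
definition sgn_h1 :: "h1 \<Rightarrow> h1" where "sgn f = inverse (norm f) *\<^sub>R f" for f :: h1
definition dist_h1 :: "h1 \<Rightarrow> h1 \<Rightarrow> real" where "dist f g = norm (f - g)" for f g :: h1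
definition uniformity_h1 :: "(h1 \<times> h1) filter" where
  "uniformity_h1 = (INF e\<in>{0<..}. principal {(x, y). dist x y < e})"
definition open_h1 :: "h1 set \<Rightarrow> bool" where
  "open_h1 U \<longleftrightarrow> (\<forall>x\<in>U. \<forall>\<^sub>F (x', y) in uniformity. x' = x \<longrightarrow> y \<in> U)"
instance
proof
  have int0: "set_integrable lborel {0..1} (\<lambda>t. h1_apply f t \<bullet> h1_apply g t)" for f g
    by (intro borel_integrable_atLeastAtMost' continuous_on_inner
        h1_deriv_of_continuous_on[OF h1_deriv])
  have meas[measurable]: "h1_deriv f \<in> borel_measurable borel" for f
    using h1_deriv[of f] by (simp add: h1_deriv_of_def)
  have int1: "set_integrable lborel {0..1} (\<lambda>t. h1_deriv f t \<bullet> h1_deriv g t)" for f g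
    using h1_deriv[of f] h1_deriv[of g] by (intro set_integrable_L2_prod) (auto simp: h1_deriv_of_def)
  show "dist x y = norm (x - y)" for x y :: h1 by (rule dist_h1_def)
  show "sgn x = inverse (norm x) *\<^sub>R x" for x :: h1 by (rule sgn_h1_def)
  show "uniformity = (INF e\<in>{0<..}. principal {(x, y :: h1). dist x y < e})"
    by (rule uniformity_h1_def)
  show "open U \<longleftrightarrow> (\<forall>x\<in>U. \<forall>\<^sub>F (x', y) in uniformity. x' = x \<longrightarrow> y \<in> U)" for U :: "h1 set"
    by (rule open_h1_def)
  show "norm x = sqrt (x \<bullet> x)" for x :: h1 by (rule norm_h1_def)
  show "x \<bullet> y = y \<bullet> x" for x y :: h1
    by (simp add: inner_h1_def inner_commute)
  show "(x + y) \<bullet> z = x \<bullet> z + y \<bullet> z" for x y z :: h1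
  proof -
    have "h1_apply (x + y) = (\<lambda>t. h1_apply x t + h1_apply y t)" by transfer auto
    then have ae: "AE t in lborel. t \<in> {0..1} \<longrightarrow>
        h1_deriv (x + y) t = h1_deriv x t + h1_deriv y t"
      using h1_deriv_AE_eq[of "x + y"] h1_deriv_of_add[OF h1_deriv h1_deriv, of x y] by simp
    have "(LBINT t:{0..1}. h1_deriv (x + y) t \<bullet> h1_deriv z t) =
        (LBINT t:{0..1}. h1_deriv x t \<bullet> h1_deriv z t + h1_deriv y t \<bullet> h1_deriv z t)"
      unfolding set_lebesgue_integral_def
      by (intro integral_cong_AE) (use ae in \<open>auto elim!: eventually_mono simp: inner_add_left indicator_def\<close>)
    also have "\<dots> = (LBINT t:{0..1}. h1_deriv x t \<bullet> h1_deriv z t) +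
        (LBINT t:{0..1}. h1_deriv y t \<bullet> h1_deriv z t)"
      by (intro set_integral_add int1)
    finally show ?thesis
      using set_integral_add(2)[OF int0[of x z] int0[of y z]]
      by (simp add: inner_h1_def plus_h1.rep_eq inner_add_left)
  qed
  show "(r *\<^sub>R x) \<bullet> y = r * (x \<bullet> y)" for r and x y :: h1
  proof -
    have "h1_apply (r *\<^sub>R x) = (\<lambda>t. of_real r * h1_apply x t)"
      by (simp add: scaleR_h1_def scaleC_h1.rep_eq)
    then have ae: "AE t in lborel. t \<in> {0..1} \<longrightarrow> h1_deriv (r *\<^sub>R x) t = of_real r * h1_deriv x t"
      using h1_deriv_AE_eq[of "r *\<^sub>R x"] h1_deriv_of_mult[OF h1_deriv, of "of_real r" x] by simp
    have "(LBINT t:{0..1}. h1_deriv (r *\<^sub>R x) t \<bullet> h1_deriv y t) =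
        (LBINT t:{0..1}. r * (h1_deriv x t \<bullet> h1_deriv y t))"
      unfolding set_lebesgue_integral_def
      by (intro integral_cong_AE)
        (use ae in \<open>auto elim!: eventually_mono simp: indicator_def scaleR_conv_of_real[symmetric]\<close>)
    then show ?thesis
      by (simp add: inner_h1_def scaleR_h1_def scaleC_h1.rep_eq distrib_left
          flip: scaleR_conv_of_real)
  qed
  show nonneg: "0 \<le> x \<bullet> x" for x :: h1
    unfolding inner_h1_def set_lebesgue_integral_def
    by (intro add_nonneg_nonneg Bochner_Integration.integral_nonneg) (auto simp: indicator_def)
  show "x \<bullet> x = 0 \<longleftrightarrow> x = 0" for x :: h1
  proof
    have "0 \<bullet> y = 0" for y :: h1
    proof -
      have "h1_apply 0 = (\<lambda>_. 0)" by transfer auto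
      then have ae: "AE t in lborel. t \<in> {0..1} \<longrightarrow> h1_deriv 0 t = 0"
        using h1_deriv_AE_eq[of 0] h1_deriv_of_zero by simp
      have "(LBINT t:{0..1}. h1_deriv 0 t \<bullet> h1_deriv y t) = (LBINT t:{0..1::real}. 0)"
        unfolding set_lebesgue_integral_def
        by (intro integral_cong_AE) (use ae in \<open>auto elim!: eventually_mono simp: indicator_def\<close>)
      then show ?thesis by (simp add: inner_h1_def zero_h1.rep_eq)
    qed
    then show "x \<bullet> x = 0" if "x = 0" using that by simp
  next
    assume xx: "x \<bullet> x = 0"
    have "0 \<le> (LBINT t:{0..1}. h1_apply x t \<bullet> h1_apply x t)"
      "0 \<le> (LBINT t:{0..1}. h1_deriv x t \<bullet> h1_deriv x t)"
      unfolding set_lebesgue_integral_def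
      by (auto intro!: Bochner_Integration.integral_nonneg simp: indicator_def)
    with xx have i0: "(LBINT t:{0..1}. h1_apply x t \<bullet> h1_apply x t) = 0"
      and i1: "(LBINT t:{0..1}. h1_deriv x t \<bullet> h1_deriv x t) = 0"
      by (auto simp: inner_h1_def)
    have "AE t in lborel. indicator {0..1} t *\<^sub>R (h1_deriv x t \<bullet> h1_deriv x t) = 0"
      using i1 int1[of x x] unfolding set_lebesgue_integral_def set_integrable_def
      by (subst (asm) integral_nonneg_eq_0_iff_AE) auto
    then have ae: "AE t in lborel. t \<in> {0..1} \<longrightarrow> h1_deriv x t = 0"
      by eventually_elim auto
    have const: "h1_apply x t = h1_apply x 0" if t: "t \<in> {0..1}" for t
    proof -
      have "(LBINT s:{0..t}. h1_deriv x s) = (LBINT s:{0..t}. 0)"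
        unfolding set_lebesgue_integral_def
        by (intro integral_cong_AE) (use ae t in \<open>auto elim!: eventually_mono simp: indicator_def\<close>)
      then show ?thesis using h1_deriv_ofD[OF h1_deriv t] by simp
    qed
    have "(LBINT t:{0..1}. h1_apply x t \<bullet> h1_apply x t) =
        (LBINT t:{0..1::real}. h1_apply x 0 \<bullet> h1_apply x 0)"
      unfolding set_lebesgue_integral_def
    proof (rule Bochner_Integration.integral_cong[OF refl])
      fix t :: real
      show "indicat_real {0..1} t *\<^sub>R (h1_apply x t \<bullet> h1_apply x t) =
          indicat_real {0..1} t *\<^sub>R (h1_apply x 0 \<bullet> h1_apply x 0)"
      proof (cases "t \<in> {0..1}")
        case True
        then show ?thesis by (simp only: const[OF True])
      qed simp
    qed
    also have "\<dots> = h1_apply x 0 \<bullet> h1_apply x 0"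
      by (simp add: set_lebesgue_integral_def)
    finally have x0: "h1_apply x 0 = 0" using i0 by simp
    have per: "h1_apply x (t + 1) = h1_apply x t" for t using h1_apply[of x] by auto
    have per': "h1_apply x (t + of_int n) = h1_apply x t" for t n
    proof (induction n rule: int_induct[where k = 0])
      case (step1 i) then show ?case using per[of "t + of_int i"] by (simp add: add.assoc)
    next
      case (step2 i) then show ?case using per[of "t + of_int (i - 1)"] by (simp add: add.assoc)
    qed simp
    have "h1_apply x t = 0" for t
    proof -
      have "h1_apply x t = h1_apply x (frac t + of_int \<lfloor>t\<rfloor>)" by (simp add: frac_def)
      also have "\<dots> = h1_apply x (frac t)" by (rule per')
      also have "\<dots> = 0" using const[of "frac t"] x0 frac_ge_0[of t] frac_lt_1[of t] by simp
      finally show ?thesis .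
    qed
    then show "x = 0" by transfer auto
  qed
qed
end

text \<open>
  The norm of \<open>h1 ^ 4\<close> is the Euclidean combination of the norms of the four components,
  i.e. the Hilbert norm of the product.
\<close>

type_synonym pot = "h1 ^ 4"

definition scaleC_pot :: "complex \<Rightarrow> pot \<Rightarrow> pot" where
  "scaleC_pot c \<psi> = (\<chi> k. scaleC_h1 c (\<psi> $ k))"

text \<open>
  Analyticity on an open subset of the complex Banach space of potentials: Frechet
  differentiability with a complex linear derivative.
\<close>

definition analytic_on_pot :: "(pot \<Rightarrow> complex) \<Rightarrow> pot set \<Rightarrow> bool" where
  "analytic_on_pot f W \<longleftrightarrow> open W \<and>
     (\<forall>\<psi>\<in>W. \<exists>L. (f has_derivative L) (at \<psi>) \<and> (\<forall>c h. L (scaleC_pot c h) = c * L h))"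


definition sigma3 :: "complex ^ 2 ^ 2" where
  "sigma3 = vector [vector [1, 0], vector [0, -1]]"

definition V :: "real \<Rightarrow> complex \<Rightarrow> pot \<Rightarrow> complex ^ 2 ^ 2" where
  "V t z \<psi> = (let p1 = h1_apply (\<psi> $ 1) t; p2 = h1_apply (\<psi> $ 2) t;
                  p3 = h1_apply (\<psi> $ 3) t; p4 = h1_apply (\<psi> $ 4) t
     in vector [vector [- \<i> * p1 * p2, 2 * z * p1 + \<i> * p3],
                vector [2 * z * p2 - \<i> * p4, \<i> * p1 * p2]])"

definition fundamental_solution :: "complex \<Rightarrow> pot \<Rightarrow> real \<Rightarrow> complex ^ 2 ^ 2" where
  "fundamental_solution z \<psi> = (THE M. M 0 = mat 1 \<and>
     (\<forall>t. (M has_vector_derivative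
             ((mat (- 2 * \<i> * z\<^sup>2) ** sigma3 + V t z \<psi>) ** M t)) (at t)))"

definition discr :: "pot \<Rightarrow> complex \<Rightarrow> complex" where
  "discr \<psi> z = trace (fundamental_solution z \<psi> 1)"

definition chi_P :: "pot \<Rightarrow> complex \<Rightarrow> complex" where
  "chi_P \<psi> z = (discr \<psi> z)\<^sup>2 - 4"

definition sigma_P :: "pot \<Rightarrow> complex set" where
  "sigma_P \<psi> = {z. chi_P \<psi> z = 0}"

definition crit_pts :: "pot \<Rightarrow> complex set" where
  "crit_pts \<psi> = {z. deriv (discr \<psi>) z = 0}"


definition U :: "int \<Rightarrow> complex set" where
  "U m = {z. cmod (2 * z\<^sup>2 - of_int m * of_real pi) < pi / 4}"

text \<open>The superscript \<open>i\<close> ranges over \<open>{1, 2}\<close>.\<close>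

definition D :: "nat \<Rightarrow> int \<Rightarrow> complex set" where
  "D i n =
    (if n = 0 then ball 0 (sqrt (pi / 8))
     else if i = 1 then
       (if n > 0 then U n \<inter> {z. Re z > 0} else U (- n) \<inter> {z. Re z < 0})
     else
       (if n > 0 then U (- n) \<inter> {z. Im z > 0} else U n \<inter> {z. Im z < 0}))"

definition BB :: "nat \<Rightarrow> complex set" where
  "BB N = ball 0 (sqrt ((real N + 1 / 4) * pi / 2))"


definition lex_le :: "complex \<Rightarrow> complex \<Rightarrow> bool" where
  "lex_le z w \<longleftrightarrow> Re z < Re w \<or> (Re z = Re w \<and> Im z \<le> Im w)"

definition root_mult :: "(complex \<Rightarrow> complex) \<Rightarrow> complex \<Rightarrow> nat" where
  "root_mult f z = (if f z = 0 then nat (zorder f z) else 0)"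

text \<open>
  Number of roots in \<open>S\<close> with multiplicity. It is \<open>0\<close> if there are infinitely many; below it
  is only compared with positive numbers.
\<close>

definition root_count :: "(complex \<Rightarrow> complex) \<Rightarrow> complex set \<Rightarrow> nat" where
  "root_count f S = (\<Sum>z\<in>{z\<in>S. f z = 0}. root_mult f z)"

definition lists_roots :: "complex list \<Rightarrow> (complex \<Rightarrow> complex) \<Rightarrow> complex set \<Rightarrow> bool" where
  "lists_roots zs f S \<longleftrightarrow> (\<forall>z. count_list zs z = (if z \<in> S then root_mult f z else 0))"

text \<open>
  \<open>localized f k m N\<close>: every disc with index \<open>\<bar>n\<bar> > N\<close> contains exactly \<open>k\<close> roots of \<open>f\<close>,
  the central disc contains exactly \<open>m\<close>, and there are no others.
\<close>

definition localized :: "(complex \<Rightarrow> complex) \<Rightarrow> nat \<Rightarrow> nat \<Rightarrow> nat \<Rightarrow> bool" where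
  "localized f k m N \<longleftrightarrow>
     (\<forall>i\<in>{1, 2}. \<forall>n. \<bar>n\<bar> > int N \<longrightarrow> root_count f (D i n) = k) \<and>
     root_count f (BB N) = m \<and>
     (\<forall>z. f z = 0 \<longrightarrow> z \<in> BB N \<or> (\<exists>i\<in>{1, 2}. \<exists>n. \<bar>n\<bar> > int N \<and> z \<in> D i n))"

definition left_labels :: "nat \<Rightarrow> (nat \<times> int) list" where
  "left_labels N = map (Pair 1) [- int N..-1] @ map (Pair 2) [- int N..-1]"

definition right_labels :: "nat \<Rightarrow> (nat \<times> int) list" where
  "right_labels N = map (Pair 2) [1..int N] @ map (Pair 1) [1..int N]"

definition periodic_list ::
  "(nat \<Rightarrow> int \<Rightarrow> complex) \<Rightarrow> (nat \<Rightarrow> int \<Rightarrow> complex) \<Rightarrow> nat \<Rightarrow> complex list" where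
  "periodic_list lm lp N = concat (map (\<lambda>(i, n). [lm i n, lp i n])
     (left_labels N @ [(1, 0), (2, 0)] @ right_labels N))"

text \<open>
  The labeling is a relation, not a function of \<open>\<psi>\<close>: for \<open>N = 0\<close> the prescribed order does not
  determine how the four roots in the central disc are split into two pairs.
  The arguments \<open>lm\<close> and \<open>lp\<close> stand for \<open>\<lambda>\<^sup>i\<^sup>,\<^sup>-\<^sub>n\<close> and \<open>\<lambda>\<^sup>i\<^sup>,\<^sup>+\<^sub>n\<close>.
\<close>

definition periodic_labeling ::
  "pot \<Rightarrow> (nat \<Rightarrow> int \<Rightarrow> complex) \<Rightarrow> (nat \<Rightarrow> int \<Rightarrow> complex) \<Rightarrow> bool" where
  "periodic_labeling \<psi> lm lp \<longleftrightarrow>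
     (\<exists>N. localized (chi_P \<psi>) 2 (4 * (2 * N + 1)) N \<and>
       (\<forall>N'<N. \<not> localized (chi_P \<psi>) 2 (4 * (2 * N' + 1)) N') \<and>
       (\<forall>i\<in>{1, 2}. \<forall>n. \<bar>n\<bar> > int N \<longrightarrow>
          lists_roots [lm i n, lp i n] (chi_P \<psi>) (D i n) \<and> lex_le (lm i n) (lp i n)) \<and>
       lists_roots (periodic_list lm lp N) (chi_P \<psi>) (BB N) \<and>
       (if N = 0 then lex_le (lm 1 0) (lp 1 0) \<and> lex_le (lm 2 0) (lp 2 0)
        else sorted_wrt lex_le (periodic_list lm lp N)))"

text \<open>
  The list \<open>mid\<close> consists of the three middle roots in increasing order; \<open>z\<close> is the unlabeled
  one, which may occupy any of the three positions.
\<close>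

definition critical_labeling :: "pot \<Rightarrow> (nat \<Rightarrow> int \<Rightarrow> complex) \<Rightarrow> bool" where
  "critical_labeling \<psi> c \<longleftrightarrow>
     (let f = deriv (discr \<psi>) in
      \<exists>N. localized f 1 (4 * N + 3) N \<and>
       (\<forall>N'<N. \<not> localized f 1 (4 * N' + 3) N') \<and>
       (\<forall>i\<in>{1, 2}. \<forall>n. \<bar>n\<bar> > int N \<longrightarrow> lists_roots [c i n] f (D i n)) \<and>
       (\<exists>z mid. mset mid = {#c 1 0, c 2 0, z#} \<and> lex_le (c 1 0) (c 2 0) \<and>
          (let zs = map (\<lambda>(i, n). c i n) (left_labels N) @ mid @
                    map (\<lambda>(i, n). c i n) (right_labels N)
           in lists_roots zs f (BB N) \<and> sorted_wrt lex_le zs)))"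


text \<open>
  Since \<open>D 1 0 = D 2 0\<close> is one and the same disc, the localization at \<open>n = 0\<close> is joint for both
  values of \<open>i\<close>: this disc holds the four eigenvalues with index \<open>0\<close>, and the two critical
  points with index \<open>0\<close> together with the unlabeled one.
\<close>

definition periodic_in_discs ::
  "pot \<Rightarrow> (nat \<Rightarrow> int \<Rightarrow> complex) \<Rightarrow> (nat \<Rightarrow> int \<Rightarrow> complex) \<Rightarrow> bool" where
  "periodic_in_discs \<psi> lm lp \<longleftrightarrow>
     (\<forall>i\<in>{1, 2}. \<forall>n. n \<noteq> 0 \<longrightarrow> sigma_P \<psi> \<inter> D i n = {lm i n, lp i n}) \<and>
     (\<forall>i\<in>{1, 2}. sigma_P \<psi> \<inter> D i 0 = {lm 1 0, lp 1 0, lm 2 0, lp 2 0})"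

definition critical_in_discs :: "pot \<Rightarrow> (nat \<Rightarrow> int \<Rightarrow> complex) \<Rightarrow> bool" where
  "critical_in_discs \<psi> c \<longleftrightarrow>
     (\<forall>i\<in>{1, 2}. \<forall>n. n \<noteq> 0 \<longrightarrow> crit_pts \<psi> \<inter> D i n = {c i n}) \<and>
     (\<forall>i\<in>{1, 2}. \<exists>z. crit_pts \<psi> \<inter> D i 0 = {c 1 0, c 2 0, z})"

text \<open>The \<open>\<ell>\<^sup>\<infinity>\<^sup>,\<^sup>1\<close> norm of a sequence indexed by \<open>S\<close>, possibly infinite.\<close>

definition linf1 :: "int set \<Rightarrow> (int \<Rightarrow> complex) \<Rightarrow> ereal" where
  "linf1 S a = (SUP n\<in>S. ereal (sqrt (1 + (real_of_int n)\<^sup>2) * cmod (a n)))"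

text \<open>
  \<^const>\<open>csqrt\<close> maps \<open>-x\<close> to \<open>\<i> * sqrt x\<close> for real \<open>x \<ge> 0\<close>.
\<close>

definition free_root :: "nat \<Rightarrow> int \<Rightarrow> complex" where
  "free_root i n =
     of_int (sgn n) * csqrt (of_real ((-1) ^ (i - 1) * real_of_int \<bar>n\<bar> * pi / 2))"

end

theory Submission
  imports Defs
begin

text \<open>
  Gauging away the off-diagonal part of \<open>V\<close> and integrating by parts once, which is possible
  because the potentials lie in \<open>H\<^sup>1\<close>, shows that \<open>M(1)\<close> differs from its free value by
  \<open>O(1/\<lambda>)\<close> relative to \<open>exp \<bar>Im (2 \<lambda>\<^sup>2)\<bar>\<close>, uniformly for bounded \<open>\<psi>\<close>.  By Schwarz's lemma in
  \<open>\<psi>\<close> the error of \<open>\<Delta>\<close> even carries a factor \<open>\<parallel>\<psi>\<parallel>\<close>.  Rouche's theorem then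
  localizes the zeros of \<open>\<Delta>\<^sup>2 - 4\<close> and of the derivative of \<open>\<Delta>\<close>, with \<open>N\<close> uniform on
  bounded sets and \<open>N = 0\<close> near \<open>\<psi> = 0\<close>.

  A perturbation of a double zero by \<open>\<epsilon>\<close> moves it by \<open>sqrt \<epsilon>\<close> in general.  For the periodic
  eigenvalues this is harmless because \<open>det M = 1\<close> gives
  \<open>\<Delta>\<^sup>2 - 4 = (m\<^sub>1\<^sub>1 - m\<^sub>2\<^sub>2)\<^sup>2 + 4 m\<^sub>1\<^sub>2 m\<^sub>2\<^sub>1\<close>, where the perturbation of \<open>m\<^sub>1\<^sub>1 - m\<^sub>2\<^sub>2\<close> is
  \<open>O(1/\<lambda>)\<close> and that of \<open>m\<^sub>1\<^sub>2 m\<^sub>2\<^sub>1\<close> is \<open>O(1/\<lambda>\<^sup>2)\<close>.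

  The argument principle makes the critical points holomorphic along complex lines in \<open>\<psi>\<close>; being
  locally bounded they are analytic.  Their deviation from the free roots is \<open>O(1/n)\<close> on all of
  \<open>W\<close>, so Schwarz's lemma bounds their local Lipschitz constants by a multiple of \<open>1/n\<close> as well,
  which gives the weighted uniform convergence.
\<close>

unbundle no Formal_Power_Series.fps_syntax

section \<open>Holomorphic dependence on parameters\<close>

text \<open>Two circumstances shape the argument. The potentials form an infinite dimensional space
  whose type carries only a real scalar multiplication, so holomorphy in \<psi> is tested on the
  complex lines \<open>z \<mapsto> \<psi> + scaleC_pot z h\<close>. There Schwarz's lemma turns a
  plain bound on a ball into Lipschitz and Taylor bounds; this device yields the factor
  \<open>norm \<psi>\<close> in the asymptotics, the continuity of
  \<open>deriv (discr \<psi>)\<close> in \<psi>, the Frechet derivative and the decaying Lipschitz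
  constants of the critical points. Secondly, the minimal N of a labeling depends on \<psi>. The
  deviation estimates therefore concern an arbitrary zero in a disc \<open>D i n\<close>, and the
  finitely many indices up to a uniform N go into the constant. For the same reason part (3) holds
  on every W with the disc property. The rate 1/n is a product of two factors
  \<open>1 / cmod z\<close>, with \<open>cmod z\<close> of order \<open>sqrt n\<close>: one is the
  size of \<open>sin (2 * z\<^sup>2)\<close> at a zero, the other comes from solving
  \<open>2 * z\<^sup>2 = w\<close> for z. For critical points the first factor is already visible in
  the free derivative, whose sine is multiplied by z.\<close>

lemma continuous_on_deriv_param:
  fixes f :: "complex \<Rightarrow> 'b::topological_space \<Rightarrow> complex"
  assumes "open S" and cont: "continuous_on (S \<times> T) (\<lambda>(z, t). f z t)"
    and hol: "\<And>t. t \<in> T \<Longrightarrow> (\<lambda>z. f z t) holomorphic_on S"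
  shows "continuous_on (S \<times> T) (\<lambda>(z, t). deriv (\<lambda>z. f z t) z)"
  unfolding continuous_on_def
proof (intro ballI, clarify)
  fix z0 t0 assume z0: "z0 \<in> S" and t0: "t0 \<in> T"
  obtain r where r: "r > 0" "cball z0 (2 * r) \<subseteq> S"
    using \<open>open S\<close> z0 by (metis open_contains_cball field_sum_of_halves half_gt_zero mult_2)
  have "continuous_on (T \<times> cball z0 (2 * r)) (\<lambda>p. (\<lambda>(z, t). f z t) (snd p, fst p))"
    by (rule continuous_on_compose2[OF cont]) (use r(2) in \<open>auto intro!: continuous_intros\<close>)
  then have c2: "continuous_on (T \<times> cball z0 (2 * r)) (\<lambda>p. f (snd p) (fst p))"
    by simp
  have cd: "continuous_on S (deriv (\<lambda>z. f z t0))"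
    using hol[OF t0] \<open>open S\<close> by (intro holomorphic_on_imp_continuous_on holomorphic_deriv)
  show "((\<lambda>(z, t). deriv (\<lambda>z. f z t) z) \<longlongrightarrow> deriv (\<lambda>z. f z t0) z0) (at (z0, t0) within S \<times> T)"
    unfolding tendsto_iff
  proof (intro allI impI)
    fix e :: real assume e: "e > 0"
    \<comment> \<open>Cauchy's inequality on circles of radius \<open>r\<close> divides this bound
      by \<open>r\<close>, so the derivatives differ by at most \<open>e / 4\<close>; the remaining
      \<open>e / 2\<close> pays for moving from \<open>z0\<close> to \<open>z\<close>.\<close>
    obtain X where X: "t0 \<in> X" "open X"
      "\<forall>t\<in>X \<inter> T. \<forall>z\<in>cball z0 (2 * r). dist (f z t) (f z t0) \<le> r * (e / 4)"
      using continuous_on_prod_compactE[OF c2 compact_cball t0, of "r * (e/4)"] e r by auto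
    have "(deriv (\<lambda>z. f z t0) \<longlongrightarrow> deriv (\<lambda>z. f z t0) z0) (nhds z0)"
      using cd z0 \<open>open S\<close>
      by (simp add: continuous_on_eq_continuous_at isCont_def tendsto_at_iff_tendsto_nhds)
    then have "\<forall>\<^sub>F z in nhds z0. dist (deriv (\<lambda>z. f z t0) z) (deriv (\<lambda>z. f z t0) z0) < e / 2"
      using e unfolding tendsto_iff by (metis half_gt_zero)
    then obtain Z where Z: "open Z" "z0 \<in> Z" "\<And>z. z \<in> Z \<Longrightarrow> dist (deriv (\<lambda>z. f z t0) z) (deriv (\<lambda>z. f z t0) z0) < e / 2"
      unfolding eventually_nhds by auto
    have "dist (deriv (\<lambda>z. f z t) z) (deriv (\<lambda>z. f z t0) z0) < e"
      if "z \<in> Z" "z \<in> ball z0 r" "t \<in> X" "t \<in> T" for z t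
    proof -
      have sub: "cball z r \<subseteq> cball z0 (2 * r)"
        using that(2) by (intro cball_subset_cball_iff[THEN iffD2]) (auto simp: dist_commute)
      have subS: "cball z r \<subseteq> S" using sub r by auto
      have zS: "z \<in> S" using subS r by (auto simp: subset_iff)
      have d: "deriv (\<lambda>z. f z t - f z t0) z = deriv (\<lambda>z. f z t) z - deriv (\<lambda>z. f z t0) z"
        using hol[OF \<open>t \<in> T\<close>] hol[OF t0] zS \<open>open S\<close>
        by (intro deriv_diff) (auto simp: holomorphic_on_imp_differentiable_at)
      have "norm ((deriv ^^ 1) (\<lambda>z. f z t - f z t0) z) \<le> fact 1 * (r * (e / 4)) / r ^ 1"
      proof (rule Cauchy_inequality)
        show "(\<lambda>z. f z t - f z t0) holomorphic_on ball z r"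
          using hol[OF \<open>t \<in> T\<close>] hol[OF t0] subS
          by (intro holomorphic_on_diff; meson ball_subset_cball holomorphic_on_subset order_trans)
        show "continuous_on (cball z r) (\<lambda>z. f z t - f z t0)"
          using hol[OF \<open>t \<in> T\<close>] hol[OF t0] subS
          by (intro holomorphic_on_imp_continuous_on holomorphic_on_diff; meson holomorphic_on_subset)
        show "0 < r" by fact
        show "cmod (f x t - f x t0) \<le> r * (e / 4)" if "cmod (z - x) = r" for x
        proof -
          have "x \<in> cball z r" using that by (simp add: dist_norm)
          then have "x \<in> cball z0 (2 * r)" using sub by blast
          then have "dist (f x t) (f x t0) \<le> r * (e / 4)" using X \<open>t \<in> X\<close> \<open>t \<in> T\<close> by blast
          then show ?thesis by (simp add: dist_norm)
        qed
      qed
      then have "norm (deriv (\<lambda>z. f z t) z - deriv (\<lambda>z. f z t0) z) \<le> e / 4"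
        using r by (simp add: d)
      then have "dist (deriv (\<lambda>z. f z t) z) (deriv (\<lambda>z. f z t0) z) \<le> e / 4"
        by (simp add: dist_norm)
      with Z(3)[OF \<open>z \<in> Z\<close>] e show ?thesis
        using dist_triangle[of "deriv (\<lambda>z. f z t) z" "deriv (\<lambda>z. f z t0) z0" "deriv (\<lambda>z. f z t0) z"] by linarith
    qed
    moreover have "open ((Z \<inter> ball z0 r) \<times> X)" using Z X by (auto intro!: open_Times)
    moreover have "(z0, t0) \<in> (Z \<inter> ball z0 r) \<times> X" using Z X r by auto
    ultimately show "\<forall>\<^sub>F x in at (z0, t0) within S \<times> T.
          dist (case x of (z, t) \<Rightarrow> deriv (\<lambda>z. f z t) z) (deriv (\<lambda>z. f z t0) z0) < e"
      unfolding eventually_at_topological by (intro exI[of _ "(Z \<inter> ball z0 r) \<times> X"]) auto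
  qed
qed

text \<open>Differentiation under the integral sign is carried out on balls, where the parameter set
  is convex; holomorphy is local, so this is enough.\<close>

lemma holomorphic_on_integral_param:
  fixes f :: "complex \<Rightarrow> 'b::euclidean_space \<Rightarrow> complex"
  assumes "open S" and cont: "continuous_on (S \<times> cbox a b) (\<lambda>(z, t). f z t)"
    and hol: "\<And>t. t \<in> cbox a b \<Longrightarrow> (\<lambda>z. f z t) holomorphic_on S"
  shows "(\<lambda>z. integral (cbox a b) (f z)) holomorphic_on S"
proof -
  have "(\<lambda>z. integral (cbox a b) (f z)) holomorphic_on ball z0 r" if "ball z0 r \<subseteq> S" for z0 r
  proof (rule leibniz_rule_holomorphic)
    show "((\<lambda>x. f x t) has_field_derivative deriv (\<lambda>z. f z t) x) (at x within ball z0 r)"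
      if "x \<in> ball z0 r" "t \<in> cbox a b" for x t
      using hol[OF that(2)] that(1) \<open>ball z0 r \<subseteq> S\<close> \<open>open S\<close>
      by (meson has_field_derivative_at_within holomorphic_derivI subsetD)
    show "f x integrable_on cbox a b" if "x \<in> ball z0 r" for x
    proof (rule integrable_continuous)
      have "continuous_on (cbox a b) (\<lambda>t. (\<lambda>(z, t). f z t) (x, t))"
        using that \<open>ball z0 r \<subseteq> S\<close>
        by (intro continuous_on_compose2[OF cont] continuous_intros) auto
      then show "continuous_on (cbox a b) (f x)" by simp
    qed
    show "continuous_on (ball z0 r \<times> cbox a b) (\<lambda>(x, t). deriv (\<lambda>z. f z t) x)"
      by (rule continuous_on_subset[OF continuous_on_deriv_param[OF assms(1,2)]])
        (use hol that in auto)
  qed auto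
  then show ?thesis
    unfolding analytic_on_open[OF assms(1), symmetric] analytic_on_def
    using assms(1) open_contains_ball by blast
qed

text \<open>Cauchy's formula with the circle parametrized: the velocity of the circle cancels one
  factor of the squared denominator and the constant \<open>2 * pi * \<i>\<close>. The derivative
  becomes an average of values of \<open>f\<close>, so parameters can pass through it.\<close>

lemma deriv_eq_circle_integral:
  assumes "f holomorphic_on A" "open A" "cball w r \<subseteq> A" "r > 0"
  shows "deriv f w = integral (cbox 0 1) (\<lambda>x. f (w + of_real r * exp (of_real (2 * pi * x) * \<i>)) /
           (of_real r * exp (of_real (2 * pi * x) * \<i>)))"
proof -
  have "((\<lambda>u. f u / (u - w) ^ Suc 1) has_contour_integral (2 * pi * \<i>) / (fact 1) * (deriv ^^ 1) f w) (circlepath w r)"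
    using assms by (intro Cauchy_has_contour_integral_higher_derivative_circlepath)
      (use assms in \<open>meson ball_subset_cball holomorphic_on_imp_continuous_on holomorphic_on_subset order_trans\<close>,
       use assms in \<open>meson ball_subset_cball holomorphic_on_imp_continuous_on holomorphic_on_subset order_trans\<close>,
       simp add: assms)
  then have "((\<lambda>x. f (circlepath w r x) / (circlepath w r x - w) ^ 2 * vector_derivative (circlepath w r) (at x within {0..1}))
     has_integral (2 * pi * \<i>) * deriv f w) {0..1}"
    unfolding has_contour_integral_def by (simp add: numeral_2_eq_2)
  then have "((\<lambda>x. (2 * pi * \<i>) * (f (w + of_real r * exp (of_real (2 * pi * x) * \<i>)) /
           (of_real r * exp (of_real (2 * pi * x) * \<i>)))) has_integral (2 * pi * \<i>) * deriv f w) {0..1}"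
  proof (rule has_integral_eq[rotated])
    fix x :: real assume x: "x \<in> {0..1}"
    then show "f (circlepath w r x) / (circlepath w r x - w) ^ 2 * vector_derivative (circlepath w r) (at x within {0..1})
       = (2 * pi * \<i>) * (f (w + of_real r * exp (of_real (2 * pi * x) * \<i>)) /
           (of_real r * exp (of_real (2 * pi * x) * \<i>)))"
      using \<open>r > 0\<close> by (subst vector_derivative_circlepath01)
         (auto simp: circlepath field_simps power2_eq_square)
  qed
  then have "((\<lambda>x. (1 / (2 * pi * \<i>)) * ((2 * pi * \<i>) * (f (w + of_real r * exp (of_real (2 * pi * x) * \<i>)) /
           (of_real r * exp (of_real (2 * pi * x) * \<i>))))) has_integral (1 / (2 * pi * \<i>)) * ((2 * pi * \<i>) * deriv f w)) {0..1}"
    by (rule has_integral_mult_right)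
  then have "((\<lambda>x. (f (w + of_real r * exp (of_real (2 * pi * x) * \<i>)) /
           (of_real r * exp (of_real (2 * pi * x) * \<i>)))) has_integral  deriv f w) {0..1}"
    by simp
  then show ?thesis by (simp add: integral_unique)
qed

text \<open>The derivative is taken in the second variable and replaced by an average over a circle;
  the integrand is holomorphic in the first. This is how the derivative of \<open>discr\<close> in
  the spectral parameter is seen to be holomorphic in \<psi>.\<close>

lemma holomorphic_on_deriv_param:
  fixes H :: "complex \<Rightarrow> complex \<Rightarrow> complex"
  assumes "open S" "open A" and cont: "continuous_on (S \<times> A) (\<lambda>(z, w). H z w)"
    and hol1: "\<And>w. w \<in> A \<Longrightarrow> (\<lambda>z. H z w) holomorphic_on S"
    and hol2: "\<And>z. z \<in> S \<Longrightarrow> H z holomorphic_on A" and w: "w \<in> A"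
  shows "(\<lambda>z. deriv (H z) w) holomorphic_on S"
proof -
  obtain r where r: "r > 0" "cball w r \<subseteq> A"
    using \<open>open A\<close> w by (metis open_contains_cball)
  define g where "g = (\<lambda>x::real. w + of_real r * exp (of_real (2 * pi * x) * \<i>))"
  have gA: "g x \<in> A" for x
    using r by (auto simp: g_def subset_iff dist_norm norm_mult)
  have gw: "of_real r * exp (of_real (2 * pi * x) * \<i>) = g x - w" "g x \<noteq> w" for x using r by (auto simp: g_def)
  have cg: "continuous_on X g" for X unfolding g_def by (intro continuous_intros)
  have "(\<lambda>z. integral (cbox 0 1) (\<lambda>x. H z (g x) / (g x - w))) holomorphic_on S"
  proof (rule holomorphic_on_integral_param[OF \<open>open S\<close>])
    have "continuous_on (S \<times> cbox 0 1) (\<lambda>p. (\<lambda>(z, w). H z w) (fst p, g (snd p)) / (g (snd p) - w))"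
      by (intro continuous_intros continuous_on_compose2[OF cont] continuous_on_compose2[OF cg[of UNIV]])
         (auto simp: gA gw(2))
    then show "continuous_on (S \<times> cbox 0 1) (\<lambda>(z, t). H z (g t) / (g t - w))"
      by (simp add: case_prod_beta)
    show "(\<lambda>z. H z (g t) / (g t - w)) holomorphic_on S" for t
      by (intro holomorphic_intros hol1 gA) (simp add: gw(2))
  qed
  moreover have "deriv (H z) w = integral (cbox 0 1) (\<lambda>x. H z (g x) / (g x - w))" if "z \<in> S" for z
    using deriv_eq_circle_integral[OF hol2[OF that] \<open>open A\<close> r(2,1)] gw(1) by (simp add: g_def)
  ultimately show ?thesis by (subst holomorphic_cong[OF refl]) auto
qed

section \<open>Schwarz and Taylor estimates in one complex variable\<close>

lemma Schwarz_scaled: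
  assumes hol: "f holomorphic_on ball 0 r" and "f 0 = 0"
    and bd: "\<And>z. norm z < r \<Longrightarrow> norm (f z) < K" and z: "norm z < r"
  shows "norm (f z) \<le> K * norm z / r" and "norm (deriv f 0) \<le> K / r"
proof -
  have r: "r > 0" using z norm_ge_zero[of z] by linarith
  have K: "K > 0" using bd[of 0] r assms(2) by simp
  \<comment> \<open>Schwarz's lemma wants values in the open unit disc; that is why the bounds by
    \<open>K\<close> are strict here and in everything built on this.\<close>
  define g where "g = (\<lambda>u. f (of_real r * u) / of_real K)"
  have holg: "g holomorphic_on ball 0 1"
    unfolding g_def using r K
    by (intro holomorphic_intros holomorphic_on_compose_gen[OF _ hol, unfolded o_def])
       (auto simp: norm_mult mult_less_cancel_left2)
  have b: "norm (g u) < 1" if "norm u < 1" for u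
    using bd[of "of_real r * u"] that r K by (simp add: g_def norm_divide norm_mult mult_less_cancel_left2)
  have g0: "g 0 = 0" using assms(2) by (simp add: g_def)
  have "norm (z / of_real r) < 1" using z r by (simp add: norm_divide)
  from Schwarz_Lemma(1)[OF holg g0 b this]
  show "norm (f z) \<le> K * norm z / r"
    using r K by (simp add: g_def norm_divide field_simps)
  have "(f has_field_derivative deriv f 0) (at (of_real r * 0))"
    using hol r by (auto intro: holomorphic_derivI)
  then have "((\<lambda>u. f (of_real r * u)) has_field_derivative deriv f 0 * of_real r) (at 0)"
    by (rule DERIV_chain2[where f = f]) (auto intro!: derivative_eq_intros)
  then have "(g has_field_derivative deriv f 0 * of_real r / of_real K) (at 0)"
    unfolding g_def by (rule DERIV_cdivide)
  then have "deriv g 0 = deriv f 0 * of_real r / of_real K" by (rule DERIV_imp_deriv)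
  with Schwarz_Lemma(2)[OF holg g0 b, of 0] show "norm (deriv f 0) \<le> K / r"
    using r K by (simp add: norm_divide norm_mult field_simps)
qed

text \<open>Subtracting \<open>f 0\<close> doubles the bound, whence \<open>2 * K\<close>. The
  quotient of \<open>f z - f 0\<close> by \<open>z\<close> is then at most \<open>2 * K / r\<close>,
  its increments at most \<open>4 * K / r\<close>, and \<open>6\<close> turns this into the strict
  bound for a second use of Schwarz's lemma.\<close>

lemma Taylor1_bound:
  assumes hol: "f holomorphic_on ball 0 r"
    and bd: "\<And>z. norm z < r \<Longrightarrow> norm (f z) < K" and z: "norm z < r"
  shows "norm (f z - f 0) \<le> 2 * K * norm z / r"
    and "norm (deriv f 0) \<le> 2 * K / r"
    and "norm (f z - f 0 - deriv f 0 * z) \<le> 6 * K * (norm z)\<^sup>2 / r\<^sup>2"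
proof -
  have r: "r > 0" using z norm_ge_zero[of z] by linarith
  define g where "g = (\<lambda>u. f u - f 0)"
  have holg: "g holomorphic_on ball 0 r" unfolding g_def by (intro holomorphic_intros hol)
  have g0: "g 0 = 0" by (simp add: g_def)
  have bg: "norm (g u) < 2 * K" if "norm u < r" for u
    using bd[OF that] bd[of 0] r norm_triangle_ineq4[of "f u" "f 0"] by (simp add: g_def)
  have dg: "deriv g 0 = deriv f 0"
    unfolding g_def using hol r
    by (subst deriv_diff) (auto simp: holomorphic_on_imp_differentiable_at)
  show "norm (f z - f 0) \<le> 2 * K * norm z / r"
    using Schwarz_scaled(1)[OF holg g0 bg z] by (simp add: g_def)
  show "norm (deriv f 0) \<le> 2 * K / r"
    using Schwarz_scaled(2)[OF holg g0 bg z] by (simp add: dg)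
  obtain h where h: "h holomorphic_on ball 0 r" "\<And>z. norm z < r \<Longrightarrow> g z = z * h z" "deriv g 0 = h 0"
    using Schwarz3[OF holg g0] by blast
  have K: "K > 0" using bd[of 0] r norm_ge_zero[of "f 0"] by (simp del: norm_ge_zero)
  have h_le: "norm (h u) \<le> 2 * K / r" if "norm u < r" for u
  proof (cases "u = 0")
    case True
    then show ?thesis using Schwarz_scaled(2)[OF holg g0 bg z] h(3) by simp
  next
    case False
    then show ?thesis using Schwarz_scaled(1)[OF holg g0 bg that] h(2)[OF that] r
      by (simp add: norm_mult field_simps)
  qed
  have bh: "norm (h u - h 0) < 6 * K / r" if "norm u < r" for u
  proof -
    have "norm (h u - h 0) \<le> 2 * K / r + 2 * K / r"
      using h_le[OF that] h_le[of 0] r norm_triangle_ineq4[of "h u" "h 0"] by simp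
    also have "\<dots> < 6 * K / r" using K r by (simp add: field_simps)
    finally show ?thesis .
  qed
  have "norm (h z - h 0) \<le> 6 * K / r * norm z / r"
    using bh by (intro Schwarz_scaled(1)[OF _ _ _ z]) (auto intro!: holomorphic_intros h(1))
  then have "norm z * norm (h z - h 0) \<le> norm z * (6 * K / r * norm z / r)"
    by (rule mult_left_mono) simp
  moreover have "f z - f 0 - deriv f 0 * z = z * (h z - h 0)"
    using h(2)[OF z] h(3) dg by (simp add: g_def algebra_simps)
  ultimately show "norm (f z - f 0 - deriv f 0 * z) \<le> 6 * K * (norm z)\<^sup>2 / r\<^sup>2"
    by (simp add: norm_mult power2_eq_square mult_ac)
qed

section \<open>The Sobolev space\<close>

lemma set_integrable_continuous_Icc:
  fixes f :: "real \<Rightarrow> 'a::euclidean_space"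
  assumes "continuous_on {a..b} f"
  shows "set_integrable lborel {a..b} f"
  using borel_integrable_atLeastAtMost'[OF assms] .

text \<open>Integration by parts for a function known only as an indefinite integral. There is no
  pointwise product rule to integrate, so the identity comes from Fubini's theorem.\<close>

lemma h1_deriv_of_product_rule:
  assumes fg: "h1_deriv_of f g" and t: "t \<in> {0..1}"
    and w: "\<And>s. (w has_vector_derivative w' s) (at s)" and cw': "continuous_on UNIV w'"
  shows "f t * w t - f 0 * w 0 = (LBINT s:{0..t}. g s * w s + f s * w' s)"
    and "set_integrable lborel {0..t} (\<lambda>s. g s * w s)"
proof -
  have cw: "continuous_on A w" for A
    by (meson w continuous_at_imp_continuous_on has_vector_derivative_continuous)
  have cw'': "continuous_on A w'" for A using cw' continuous_on_subset by blast
  have [measurable]: "w \<in> borel_measurable borel" "w' \<in> borel_measurable borel"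
    using cw cw' by (auto intro: borel_measurable_continuous_onI)
  have [measurable]: "g \<in> borel_measurable borel" using fg by (simp add: h1_deriv_of_def)
  have cf: "continuous_on {0..t} f"
    using h1_deriv_of_continuous_on[OF fg] t by (auto elim: continuous_on_subset)
  have gi: "set_integrable lborel {0..s} g" if "s \<in> {0..t}" for s
    using h1_deriv_of_integrable[OF fg] that t by (auto elim!: set_integrable_subset)
  define G where "G = (\<lambda>r. indicat_real {0..t} r *\<^sub>R g r)"
  define W where "W = (\<lambda>r. indicat_real {0..t} r *\<^sub>R w' r)"
  have [measurable]: "G \<in> borel_measurable borel" "W \<in> borel_measurable borel"
    unfolding G_def W_def by measurable
  have Gi: "integrable lborel G" using gi[of t] t by (simp add: G_def set_integrable_def)
  have Wi: "integrable lborel W"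
    using set_integrable_continuous_Icc[OF cw''] by (simp add: W_def set_integrable_def)
  have K0: "integrable (lborel \<Otimes>\<^sub>M lborel) (\<lambda>p. W (fst p) * G (snd p))"
    by (rule lborel_pair.Fubini_integrable) (use Gi Wi in \<open>auto simp: norm_mult\<close>)
  \<comment> \<open>The kernel \<open>w' s * g r\<close> on the triangle where r is at most s.
    Integrating first in \<open>r\<close> gives \<open>w' s * (f s - f 0)\<close>, first in
    \<open>s\<close> gives \<open>g r * (w t - w r)\<close>.\<close>
  define K where "K = (\<lambda>s r. indicat_real {p. snd p \<le> fst p} (s, r) *\<^sub>R (W s * G r))"
  have "integrable (lborel \<Otimes>\<^sub>M lborel) (\<lambda>p. indicat_real {p. snd p \<le> fst p} p *\<^sub>R (W (fst p) * G (snd p)))"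
  proof (rule integrable_mult_indicator[OF _ K0])
    have "{p \<in> space (borel \<Otimes>\<^sub>M borel). snd p \<le> (fst p :: real)} \<in> sets (borel \<Otimes>\<^sub>M borel)" by measurable
    then show "{p. snd p \<le> (fst p :: real)} \<in> sets (lborel \<Otimes>\<^sub>M lborel)" by (simp add: space_pair_measure)
  qed
  then have K: "integrable (lborel \<Otimes>\<^sub>M lborel) (case_prod K)"
    by (simp add: K_def split_def)
  have a: "(\<integral>r. K s r \<partial>lborel) = W s * (f s - f 0)" for s
  proof (cases "s \<in> {0..t}")
    case True
    have "(\<integral>r. K s r \<partial>lborel) = (\<integral>r. W s * (indicat_real {0..s} r *\<^sub>R g r) \<partial>lborel)"
      using True by (intro Bochner_Integration.integral_cong) (auto simp: K_def G_def indicator_def)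
    also have "\<dots> = W s * (LBINT r:{0..s}. g r)"
      unfolding set_lebesgue_integral_def by (rule integral_mult_right_zero)
    also have "(LBINT r:{0..s}. g r) = f s - f 0"
      using h1_deriv_ofD[OF fg, of s] True t by simp
    finally show ?thesis .
  qed (simp add: K_def W_def)
  have b: "(\<integral>s. K s r \<partial>lborel) = G r * (w t - w r)" for r
  proof (cases "r \<in> {0..t}")
    case True
    have "(\<integral>s. K s r \<partial>lborel) = (\<integral>s. G r * (indicat_real {r..t} s *\<^sub>R w' s) \<partial>lborel)"
      using True by (intro Bochner_Integration.integral_cong) (auto simp: K_def W_def indicator_def)
    also have "\<dots> = G r * (\<integral>s. (indicat_real {r..t} s *\<^sub>R w' s) \<partial>lborel)"
      by (rule integral_mult_right_zero)
    also have "(\<integral>s. (indicat_real {r..t} s *\<^sub>R w' s) \<partial>lborel) = w t - w r"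
      using True by (intro integral_FTC_atLeastAtMost cw'') (auto intro: has_vector_derivative_at_within w)
    finally show ?thesis .
  qed (simp add: K_def G_def)
  have "(\<integral>s. W s * (f s - f 0) \<partial>lborel) = (\<integral>r. G r * (w t - w r) \<partial>lborel)"
    using lborel_pair.Fubini_integral[OF K] by (simp add: a b)
  then have eq: "(LBINT s:{0..t}. w' s * (f s - f 0)) = (LBINT r:{0..t}. g r * (w t - w r))"
    by (simp add: W_def G_def set_lebesgue_integral_def)
  have iw: "set_integrable lborel {0..t} w'" using Wi by (simp add: W_def set_integrable_def)
  have ifw: "set_integrable lborel {0..t} (\<lambda>s. w' s * f s)"
    by (intro set_integrable_continuous_Icc continuous_intros cf cw'')
  obtain C where C: "\<And>s. s \<in> {0..t} \<Longrightarrow> norm (w s) \<le> C"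
    using compact_imp_bounded[OF compact_continuous_image[OF cw compact_Icc]]
    unfolding bounded_iff by (metis imageI)
  show igw: "set_integrable lborel {0..t} (\<lambda>s. g s * w s)"
  proof (rule set_integrable_bound)
    show "set_integrable lborel {0..t} (\<lambda>s. g s * of_real C)" using gi[of t] t by simp
    show "set_borel_measurable lborel {0..t} (\<lambda>s. g s * w s)"
      unfolding set_borel_measurable_def by measurable
    have "norm (w s) \<le> norm C" if "s \<in> {0..t}" for s using C[OF that] norm_ge_zero[of "w s"] by simp
    then show "AE x in lborel. x \<in> {0..t} \<longrightarrow> cmod (g x * w x) \<le> cmod (g x * complex_of_real C)"
      by (auto simp: norm_mult intro!: mult_left_mono AE_I2)
  qed
  have FT: "(LBINT s:{0..t}. w' s) = w t - w 0"
    unfolding set_lebesgue_integral_def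
    using t by (intro integral_FTC_atLeastAtMost cw'') (auto intro: has_vector_derivative_at_within w)
  have "(LBINT s:{0..t}. w' s * f s) - (w t - w 0) * f 0 = (LBINT s:{0..t}. w' s * f s - w' s * f 0)"
    using ifw iw by (subst set_integral_diff) (auto simp: FT)
  also have "\<dots> = (LBINT r:{0..t}. g r * w t - g r * w r)"
    using eq by (simp add: algebra_simps)
  also have "\<dots> = (f t - f 0) * w t - (LBINT r:{0..t}. g r * w r)"
    using igw gi[of t] t h1_deriv_ofD[OF fg t] by (subst set_integral_diff) auto
  finally have "f t * w t - f 0 * w 0 = (LBINT r:{0..t}. g r * w r) + (LBINT s:{0..t}. w' s * f s)"
    by (simp add: algebra_simps)
  also have "\<dots> = (LBINT s:{0..t}. g s * w s + f s * w' s)"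
    using igw ifw by (subst set_integral_add) (auto simp: mult.commute)
  finally show "f t * w t - f 0 * w 0 = (LBINT s:{0..t}. g s * w s + f s * w' s)" .
qed

lemma set_integral_const_unit_interval: "(LBINT t:{0..1::real}. c) = (c::real)"
proof -
  have "(LBINT t:{0..1::real}. c) = measure lborel {0..1::real} * c"
    unfolding set_lebesgue_integral_def by simp
  then show ?thesis by (simp del: content_real)
qed

text \<open>The variance of \<phi> on the unit interval is nonnegative.\<close>

lemma set_integral_le_sqrt_power2:
  fixes \<phi> :: "real \<Rightarrow> real"
  assumes 1: "set_integrable lborel {0..1} \<phi>" and 2: "set_integrable lborel {0..1} (\<lambda>t. (\<phi> t)\<^sup>2)"
  shows "(LBINT t:{0..1}. \<phi> t) \<le> sqrt (LBINT t:{0..1}. (\<phi> t)\<^sup>2)"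
proof -
  define m where "m = (LBINT t:{0..1}. \<phi> t)"
  have c: "set_integrable lborel {0..1} (\<lambda>t::real. m\<^sup>2)"
    by (intro set_integrable_continuous_Icc continuous_intros)
  have "0 \<le> (LBINT t:{0..1}. (\<phi> t - m)\<^sup>2)"
    unfolding set_lebesgue_integral_def by (intro Bochner_Integration.integral_nonneg) auto
  also have "\<dots> = (LBINT t:{0..1}. (\<phi> t)\<^sup>2 + (m\<^sup>2 - 2 * m * \<phi> t))"
    by (simp add: power2_diff algebra_simps)
  also have "\<dots> = (LBINT t:{0..1}. (\<phi> t)\<^sup>2) + (LBINT t:{0..1}. m\<^sup>2 - 2 * m * \<phi> t)"
    using assms c by (intro set_integral_add set_integral_diff) auto
  also have "(LBINT t:{0..1}. m\<^sup>2 - 2 * m * \<phi> t) = (LBINT t:{0..1::real}. m\<^sup>2) - (LBINT t:{0..1}. 2 * m * \<phi> t)"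
    using assms c by (intro set_integral_diff) auto
  also have "\<dots> = m\<^sup>2 - 2 * m * m"
    by (simp add: set_integral_const_unit_interval m_def)
  finally have "m\<^sup>2 \<le> (LBINT t:{0..1}. (\<phi> t)\<^sup>2)" by (simp add: power2_eq_square)
  then show ?thesis unfolding m_def using real_le_rsqrt by blast
qed

lemma h1_deriv_measurable[measurable]: "h1_deriv f \<in> borel_measurable borel"
  using h1_deriv[of f] by (simp add: h1_deriv_of_def)

lemma norm_h1_power2:
  "(norm f)\<^sup>2 = (LBINT t:{0..1}. (cmod (h1_apply f t))\<^sup>2) + (LBINT t:{0..1}. (cmod (h1_deriv f t))\<^sup>2)"
  by (simp add: power2_norm_eq_inner inner_h1_def)

lemma
  shows set_integral_norm_h1_apply_le: "(LBINT t:{0..1}. cmod (h1_apply f t)) \<le> norm f"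
    and set_integral_norm_h1_deriv_le: "(LBINT t:{0..1}. cmod (h1_deriv f t)) \<le> norm f"
    and set_integrable_norm_h1_deriv: "set_integrable lborel {0..1} (\<lambda>t. cmod (h1_deriv f t))"
proof -
  have cf: "continuous_on {0..1} (h1_apply f)" by (rule h1_deriv_of_continuous_on[OF h1_deriv])
  have nn: "0 \<le> (LBINT t:{0..1}. (cmod (h1_apply f t))\<^sup>2)" "0 \<le> (LBINT t:{0..1}. (cmod (h1_deriv f t))\<^sup>2)"
    unfolding set_lebesgue_integral_def by (intro Bochner_Integration.integral_nonneg; simp)+
  have "(LBINT t:{0..1}. cmod (h1_apply f t)) \<le> sqrt (LBINT t:{0..1}. (cmod (h1_apply f t))\<^sup>2)"
    by (intro set_integral_le_sqrt_power2 set_integrable_continuous_Icc continuous_intros cf)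
  also have "\<dots> \<le> sqrt ((norm f)\<^sup>2)" using nn by (intro real_sqrt_le_mono) (simp add: norm_h1_power2)
  finally show "(LBINT t:{0..1}. cmod (h1_apply f t)) \<le> norm f" by simp
  show i: "set_integrable lborel {0..1} (\<lambda>t. cmod (h1_deriv f t))"
    using h1_deriv_of_integrable[OF h1_deriv] by (rule set_integrable_norm)
  have "(LBINT t:{0..1}. cmod (h1_deriv f t)) \<le> sqrt (LBINT t:{0..1}. (cmod (h1_deriv f t))\<^sup>2)"
    using i h1_deriv[of f] by (intro set_integral_le_sqrt_power2) (auto simp: h1_deriv_of_def)
  also have "\<dots> \<le> sqrt ((norm f)\<^sup>2)" using nn by (intro real_sqrt_le_mono) (simp add: norm_h1_power2)
  finally show "(LBINT t:{0..1}. cmod (h1_deriv f t)) \<le> norm f" by simp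
qed

lemma h1_apply_periodic: "h1_apply f (t + of_int n) = h1_apply f t"
proof -
  have per: "h1_apply f (t + 1) = h1_apply f t" for t using h1_apply[of f] by auto
  show ?thesis
  proof (induction n rule: int_induct[where k = 0])
    case (step1 i) then show ?case using per[of "t + of_int i"] by (simp add: add.assoc)
  next
    case (step2 i) then show ?case using per[of "t + of_int (i - 1)"] by (simp add: add.assoc)
  qed simp
qed

lemma h1_apply_frac: "h1_apply f t = h1_apply f (frac t)"
  using h1_apply_periodic[of f "frac t" "\<lfloor>t\<rfloor>"] by (simp add: frac_def)

text \<open>The one-dimensional Sobolev embedding: \<open>h1_apply f s\<close> differs from every
  \<open>h1_apply f r\<close> by at most the integral of the modulus of the derivative. Averaging
  over \<open>r\<close> bounds it by two integrals, each at most \<open>norm f\<close>.\<close>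

lemma norm_h1_apply_le: "cmod (h1_apply f t) \<le> 2 * norm f"
proof -
  note fg = h1_deriv[of f]
  have cf: "continuous_on {0..1} (h1_apply f)" by (rule h1_deriv_of_continuous_on[OF h1_deriv])
  define I where "I = (LBINT t:{0..1}. cmod (h1_deriv f t))"
  define s where "s = frac t"
  have s: "s \<in> {0..1}" using frac_lt_1[of t] by (simp add: s_def less_imp_le)
  have d: "cmod (h1_apply f s) \<le> cmod (h1_apply f r) + I" if "r \<in> {0..1}" for r
  proof -
    have *: "cmod (h1_apply f y - h1_apply f x) \<le> I" if "x \<in> {0..1}" "y \<in> {0..1}" "x \<le> y" for x y
    proof -
      have i: "set_integrable lborel {0..x} (h1_deriv f)" "set_integrable lborel {x<..y} (h1_deriv f)"
        using h1_deriv_of_integrable[OF fg] that by (auto elim!: set_integrable_subset)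
      have "(LBINT s:{0..x} \<union> {x<..y}. h1_deriv f s) = (LBINT s:{0..x}. h1_deriv f s) + (LBINT s:{x<..y}. h1_deriv f s)"
        by (rule set_integral_Un) (use i in auto)
      moreover have "{0..x} \<union> {x<..y} = {0..y}" using that by auto
      ultimately have "h1_apply f y - h1_apply f x = (LBINT s:{x<..y}. h1_deriv f s)"
        using h1_deriv_ofD[OF fg that(1)] h1_deriv_ofD[OF fg that(2)] by simp
      then have "cmod (h1_apply f y - h1_apply f x) \<le> (LBINT s:{x<..y}. cmod (h1_deriv f s))"
        using set_integral_norm_bound[OF i(2)] by simp
      also have "\<dots> \<le> I"
        unfolding I_def set_lebesgue_integral_def using that
        by (intro integral_mono set_integrable_norm_h1_deriv[unfolded set_integrable_def]
              set_integrable_norm[OF i(2), unfolded set_integrable_def])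
           (auto simp: indicator_def)
      finally show ?thesis .
    qed
    have "cmod (h1_apply f s - h1_apply f r) \<le> I"
      using *[OF that s] *[OF s that] by (cases "r \<le> s") (auto simp: norm_minus_commute)
    then show ?thesis using norm_triangle_sub[of "h1_apply f s" "h1_apply f r"] by simp
  qed
  have "cmod (h1_apply f s) = (LBINT r:{0..1::real}. cmod (h1_apply f s))"
    by (simp add: set_integral_const_unit_interval)
  also have "\<dots> \<le> (LBINT r:{0..1}. cmod (h1_apply f r) + I)"
    by (intro set_integral_mono d set_integrable_continuous_Icc continuous_intros cf)
  also have "\<dots> = (LBINT r:{0..1}. cmod (h1_apply f r)) + I"
    by (subst set_integral_add) (auto intro!: set_integrable_continuous_Icc continuous_intros cf simp: set_integral_const_unit_interval)
  also have "\<dots> \<le> norm f + norm f"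
    unfolding I_def by (intro add_mono set_integral_norm_h1_apply_le set_integral_norm_h1_deriv_le)
  finally show ?thesis using h1_apply_frac[of f t] by (simp add: s_def)
qed

lemma continuous_on_h1_apply: "continuous_on A (h1_apply f)"
proof -
  have c: "continuous_on {of_int n..of_int n + 1} (h1_apply f)" for n
  proof -
    have "continuous_on {of_int n..of_int n + 1} (\<lambda>t. h1_apply f (t - of_int n))"
      by (rule continuous_on_compose2[OF h1_deriv_of_continuous_on[OF h1_deriv]]) (auto intro!: continuous_intros)
    moreover have "h1_apply f (t - of_int n) = h1_apply f t" for t
      using h1_apply_periodic[of f "t - of_int n" n] by simp
    ultimately show ?thesis by simp
  qed
  have "isCont (h1_apply f) t" for t
  proof -
    \<comment> \<open>With the ceiling instead of the floor an integer \<open>t\<close> is the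
      midpoint of \<open>{of_int n<..<of_int n + 2}\<close>, so the gluing of two adjacent periods
      covers it from both sides.\<close>
    define n where "n = \<lceil>t\<rceil> - 1"
    have n: "of_int n < t" "t \<le> of_int (n + 1)" unfolding n_def by linarith+
    have "continuous_on ({of_int n..of_int n + 1} \<union> {of_int (n + 1)..of_int (n + 1) + 1}) (h1_apply f)"
      by (intro continuous_on_closed_Un c closed_atLeastAtMost)
    then have "continuous_on {of_int n<..<of_int n + 2} (h1_apply f)"
      by (rule continuous_on_subset) auto
    moreover have "t \<in> {of_int n<..<of_int n + 2}" using n by auto
    ultimately show ?thesis by (simp add: continuous_on_eq_continuous_at)
  qed
  then show ?thesis by (simp add: continuous_at_imp_continuous_on)
qed

text \<open>\<open>h1_deriv\<close> is a choice and commutes with scalars only almost everywhere,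
  which the integrals do not notice.\<close>

lemma norm_scaleC_h1: "norm (scaleC_h1 c f) = cmod c * norm f"
proof -
  have ae: "AE t in lborel. t \<in> {0..1} \<longrightarrow> h1_deriv (scaleC_h1 c f) t = c * h1_deriv f t"
    using h1_deriv_AE_eq[of "scaleC_h1 c f"] h1_deriv_of_mult[OF h1_deriv, of c f]
    by (simp add: scaleC_h1.rep_eq)
  have "(LBINT t:{0..1}. (cmod (h1_deriv (scaleC_h1 c f) t))\<^sup>2) = (LBINT t:{0..1}. (cmod c)\<^sup>2 * (cmod (h1_deriv f t))\<^sup>2)"
    unfolding set_lebesgue_integral_def
    by (intro integral_cong_AE)
       (use ae in \<open>auto elim!: eventually_mono simp: indicator_def norm_mult power_mult_distrib\<close>)
  then have "(norm (scaleC_h1 c f))\<^sup>2 = (cmod c * norm f)\<^sup>2"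
    unfolding norm_h1_power2
    by (simp add: scaleC_h1.rep_eq norm_mult power_mult_distrib distrib_left norm_h1_power2)
  then show ?thesis by (simp add: power2_eq_iff_nonneg)
qed

section \<open>The complex structure on potentials\<close>

lemma h1_apply_0 [simp]: "h1_apply 0 t = 0" by (simp add: zero_h1.rep_eq)
lemma h1_apply_add [simp]: "h1_apply (f + g) t = h1_apply f t + h1_apply g t" by (simp add: plus_h1.rep_eq)
lemma h1_apply_scaleC [simp]: "h1_apply (scaleC_h1 c f) t = c * h1_apply f t" by (simp add: scaleC_h1.rep_eq)

lemma norm_scaleC_pot: "norm (scaleC_pot c \<psi>) = cmod c * norm \<psi>"
  unfolding norm_vec_def by (simp add: scaleC_pot_def norm_scaleC_h1 L2_set_right_distrib)

lemma scaleC_h1_add_left: "scaleC_h1 (a + b) f = scaleC_h1 a f + scaleC_h1 b f"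
  by transfer (auto simp: algebra_simps)
lemma scaleC_h1_scaleC: "scaleC_h1 a (scaleC_h1 b f) = scaleC_h1 (a * b) f"
  by transfer (auto simp: algebra_simps)

lemma scaleC_pot_add_left: "scaleC_pot (a + b) h = scaleC_pot a h + scaleC_pot b h"
  by (simp add: scaleC_pot_def vec_eq_iff scaleC_h1_add_left)
lemma scaleC_pot_scaleC: "scaleC_pot a (scaleC_pot b h) = scaleC_pot (a * b) h"
  by (simp add: scaleC_pot_def vec_eq_iff scaleC_h1_scaleC)
lemma scaleC_pot_of_real: "scaleC_pot (of_real r) h = r *\<^sub>R h"
  by (simp add: scaleC_pot_def vec_eq_iff scaleR_h1_def)
lemma scaleC_pot_1 [simp]: "scaleC_pot 1 h = h"
  using scaleC_pot_of_real[of 1 h] by simp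
lemma scaleC_pot_0 [simp]: "scaleC_pot 0 h = 0"
  using scaleC_pot_of_real[of 0 h] by simp

lemma bounded_linear_scaleC_pot: "bounded_linear (\<lambda>z. scaleC_pot z h)"
proof
  show "scaleC_pot (x + y) h = scaleC_pot x h + scaleC_pot y h" for x y by (rule scaleC_pot_add_left)
  show "scaleC_pot (r *\<^sub>R x) h = r *\<^sub>R scaleC_pot x h" for r x
    by (simp add: scaleC_pot_of_real[symmetric] scaleC_pot_scaleC scaleR_conv_of_real)
  show "\<exists>K. \<forall>x. norm (scaleC_pot x h) \<le> norm x * K" by (auto simp: norm_scaleC_pot)
qed

section \<open>Holomorphic functions of the potential\<close>

text \<open>Holomorphy on complex lines is what the differential equation and the argument principle
  deliver directly. With local boundedness it implies complex Frechet differentiability.\<close>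

definition gateaux_holomorphic :: "(pot \<Rightarrow> complex) \<Rightarrow> pot set \<Rightarrow> bool" where
  "gateaux_holomorphic F S \<longleftrightarrow>
     (\<forall>\<psi> h. (\<lambda>z. F (\<psi> + scaleC_pot z h)) holomorphic_on {z. \<psi> + scaleC_pot z h \<in> S})"

lemma gateaux_holomorphic_subset:
  "gateaux_holomorphic F S \<Longrightarrow> T \<subseteq> S \<Longrightarrow> gateaux_holomorphic F T"
  unfolding gateaux_holomorphic_def by (meson Collect_mono holomorphic_on_subset subsetD)

lemma open_complex_line_preimage:
  assumes "open S"
  shows "open {z. \<psi> + scaleC_pot z h \<in> S}"
proof -
  have "continuous_on UNIV (\<lambda>z. \<psi> + scaleC_pot z h)"
    by (intro continuous_intros bounded_linear.continuous_on[OF bounded_linear_scaleC_pot])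
  from open_vimage[OF assms this] show ?thesis by (simp add: vimage_def)
qed

lemma gateaux_holomorphic_on_line:
  assumes "gateaux_holomorphic F (ball \<psi> r)" and "h \<noteq> 0"
  shows "(\<lambda>z. F (\<psi> + scaleC_pot z h)) holomorphic_on ball 0 (r / norm h)"
proof -
  have "ball 0 (r / norm h) \<subseteq> {z. \<psi> + scaleC_pot z h \<in> ball \<psi> r}"
    using assms(2) by (auto simp: dist_norm norm_scaleC_pot field_simps)
  then show ?thesis using assms(1) unfolding gateaux_holomorphic_def by (meson holomorphic_on_subset)
qed

text \<open>On the line through \<psi> in direction \<open>h\<close> the ball of radius
  \<open>r\<close> becomes a disc of radius \<open>r / norm h\<close>. The one-variable bounds,
  evaluated at \<open>z = 1\<close>, then carry the powers of \<open>norm h / r\<close>.\<close>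

lemma
  assumes F: "gateaux_holomorphic F (ball \<psi> r)" and "r > 0"
    and K: "\<And>\<phi>. \<phi> \<in> ball \<psi> r \<Longrightarrow> cmod (F \<phi>) < K"
  shows gateaux_holomorphic_Lipschitz:
      "norm h < r \<Longrightarrow> cmod (F (\<psi> + h) - F \<psi>) \<le> 2 * K * norm h / r"
    and gateaux_deriv_bound: "cmod (deriv (\<lambda>z. F (\<psi> + scaleC_pot z h)) 0) \<le> 2 * K * norm h / r"
    and gateaux_Taylor1: "norm h < r \<Longrightarrow>
      cmod (F (\<psi> + h) - F \<psi> - deriv (\<lambda>z. F (\<psi> + scaleC_pot z h)) 0) \<le> 6 * K * (norm h)\<^sup>2 / r\<^sup>2"
proof -
  have main: "(norm h < r \<longrightarrow> cmod (F (\<psi> + h) - F \<psi>) \<le> 2 * K * norm h / r) \<and>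
     cmod (deriv (\<lambda>z. F (\<psi> + scaleC_pot z h)) 0) \<le> 2 * K * norm h / r \<and>
     (norm h < r \<longrightarrow> cmod (F (\<psi> + h) - F \<psi> - deriv (\<lambda>z. F (\<psi> + scaleC_pot z h)) 0) \<le> 6 * K * (norm h)\<^sup>2 / r\<^sup>2)"
  proof (cases "h = 0")
    case True
    have "scaleC_pot z 0 = 0" for z using norm_scaleC_pot[of z 0] by simp
    then show ?thesis using True by simp
  next
    case False
    note hol = gateaux_holomorphic_on_line[OF F False]
    have bd: "cmod (F (\<psi> + scaleC_pot z h)) < K" if "norm z < r / norm h" for z
      using that False by (intro K) (auto simp: dist_norm norm_scaleC_pot field_simps)
    have 0: "norm (0::complex) < r / norm h" using False \<open>r > 0\<close> by simp
    have 1: "norm (1::complex) < r / norm h" if "norm h < r" using False that by simp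
    show ?thesis
      using Taylor1_bound(1)[OF hol bd 1] Taylor1_bound(2)[OF hol bd 0] Taylor1_bound(3)[OF hol bd 1]
      by (simp add: power_divide)
  qed
  then show "norm h < r \<Longrightarrow> cmod (F (\<psi> + h) - F \<psi>) \<le> 2 * K * norm h / r"
    "cmod (deriv (\<lambda>z. F (\<psi> + scaleC_pot z h)) 0) \<le> 2 * K * norm h / r"
    "norm h < r \<Longrightarrow>
      cmod (F (\<psi> + h) - F \<psi> - deriv (\<lambda>z. F (\<psi> + scaleC_pot z h)) 0) \<le> 6 * K * (norm h)\<^sup>2 / r\<^sup>2"
    by auto
qed

lemma gateaux_deriv_scaleC:
  assumes F: "gateaux_holomorphic F (ball \<psi> r)" and "r > 0"
  shows "deriv (\<lambda>z. F (\<psi> + scaleC_pot z (scaleC_pot c h))) 0 = c * deriv (\<lambda>z. F (\<psi> + scaleC_pot z h)) 0"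
proof -
  have "(\<lambda>z. F (\<psi> + scaleC_pot z h)) holomorphic_on {z. \<psi> + scaleC_pot z h \<in> ball \<psi> r}"
    using F by (simp add: gateaux_holomorphic_def)
  from holomorphic_derivI[OF this open_complex_line_preimage[OF open_ball], of 0]
  have "((\<lambda>z. F (\<psi> + scaleC_pot z h)) has_field_derivative deriv (\<lambda>z. F (\<psi> + scaleC_pot z h)) 0) (at (0 * c))"
    using \<open>r > 0\<close> by simp
  then have "((\<lambda>z. F (\<psi> + scaleC_pot (z * c) h)) has_field_derivative deriv (\<lambda>z. F (\<psi> + scaleC_pot z h)) 0 * c) (at 0)"
    by (rule DERIV_chain2) (auto intro!: derivative_eq_intros)
  then show ?thesis by (simp add: scaleC_pot_scaleC DERIV_imp_deriv)
qed

text \<open>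
  Additivity comes from comparing, as \<open>s\<close> tends to \<open>0\<close>, the first order expansions of \<open>F\<close> at
  \<open>\<psi>\<close> in the directions \<open>s (h + k)\<close> and \<open>s h\<close> with the one at \<open>\<psi> + s h\<close> in the direction \<open>s k\<close>.
\<close>

lemma gateaux_deriv_add:
  assumes F: "gateaux_holomorphic F (ball \<psi> r)" and r: "r > 0"
    and K: "\<And>\<phi>. \<phi> \<in> ball \<psi> r \<Longrightarrow> cmod (F \<phi>) < K"
  shows "deriv (\<lambda>z. F (\<psi> + scaleC_pot z (h + k))) 0 =
    deriv (\<lambda>z. F (\<psi> + scaleC_pot z h)) 0 + deriv (\<lambda>z. F (\<psi> + scaleC_pot z k)) 0"
proof -
  define \<delta> where "\<delta> = (\<lambda>\<psi> h. deriv (\<lambda>z. F (\<psi> + scaleC_pot z h)) 0)"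
  have Kpos: "K > 0" using K[of \<psi>] r norm_ge_zero[of "F \<psi>"] by (simp del: norm_ge_zero)
  define N where "N = norm h + norm k + 1"
  have N: "norm h \<le> N" "norm k \<le> N" "norm (h + k) \<le> N" "N > 0"
    using norm_triangle_ineq[of h k] by (auto simp: N_def add_nonneg_pos)
  \<comment> \<open>\<open>100\<close> dominates both the \<open>24\<close> from the Taylor
    remainders, taken with radius \<open>r / 2\<close>, and the \<open>40\<close> from the increment
    of the derivative below.\<close>
  define C where "C = 100 * K * N\<^sup>2 / r\<^sup>2"
  have F2: "gateaux_holomorphic F (ball \<phi> (r / 2))" and K2: "\<And>\<eta>. \<eta> \<in> ball \<phi> (r / 2) \<Longrightarrow> cmod (F \<eta>) < K"
    if "dist \<phi> \<psi> < r / 2" for \<phi>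
  proof -
    have "ball \<phi> (r / 2) \<subseteq> ball \<psi> r"
    proof
      fix x assume "x \<in> ball \<phi> (r / 2)"
      then show "x \<in> ball \<psi> r"
        using that dist_triangle[of \<psi> x \<phi>] by (simp add: dist_commute)
    qed
    then show "gateaux_holomorphic F (ball \<phi> (r / 2))" "\<And>\<eta>. \<eta> \<in> ball \<phi> (r / 2) \<Longrightarrow> cmod (F \<eta>) < K"
      using F K by (auto intro: gateaux_holomorphic_subset)
  qed
  have small: "cmod (\<delta> \<psi> (h + k) - \<delta> \<psi> h - \<delta> \<psi> k) \<le> 4 * C * s" if s: "0 < s" "s < r / (4 * N)" for s
  proof -
    have hs: "\<delta> \<phi> (s *\<^sub>R x) = s * \<delta> \<phi> x" if "dist \<phi> \<psi> < r / 2" for x \<phi>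
      using gateaux_deriv_scaleC[OF F2[OF that], of "of_real s" x] r
      by (simp add: \<delta>_def scaleC_pot_of_real)
    have sN: "s * N < r / 4" using s N by (simp add: field_simps)
    have nx: "norm (s *\<^sub>R x) \<le> s * N" if "norm x \<le> N" for x using that s by simp
    have T: "cmod (F (\<phi> + s *\<^sub>R x) - F \<phi> - s * \<delta> \<phi> x) \<le> C * s\<^sup>2"
      if "norm x \<le> N" "dist \<phi> \<psi> < r / 2" for x \<phi>
    proof -
      have n: "norm (s *\<^sub>R x) < r / 2" using nx[OF that(1)] sN r by linarith
      have "cmod (F (\<phi> + s *\<^sub>R x) - F \<phi> - \<delta> \<phi> (s *\<^sub>R x)) \<le> 6 * K * (norm (s *\<^sub>R x))\<^sup>2 / (r / 2)\<^sup>2"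
        unfolding \<delta>_def using F2[OF that(2)] K2[OF that(2)] r by (intro gateaux_Taylor1 n) auto
      also have "\<dots> \<le> 6 * K * (s * N)\<^sup>2 / (r / 2)\<^sup>2"
        using nx[OF that(1)] Kpos by (intro divide_right_mono mult_left_mono power_mono) auto
      also have "\<dots> = (24 * K * N\<^sup>2 / r\<^sup>2) * s\<^sup>2" by (simp add: power_mult_distrib field_simps)
      also have "\<dots> \<le> C * s\<^sup>2" unfolding C_def using Kpos by (intro mult_right_mono divide_right_mono) auto
      finally show ?thesis by (simp only: hs[OF that(2)])
    qed
    have dsh: "dist (\<psi> + s *\<^sub>R h) \<psi> < r / 4" using nx[OF N(1)] sN by (simp add: dist_norm)
    \<comment> \<open>The increment of \<open>F\<close> by \<open>s *\<^sub>R h\<close> is of order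
      \<open>s\<close> on a whole disc in direction \<open>k\<close>, hence so is its derivative
      there. The Lipschitz bound with radius \<open>r / 2\<close> is
      \<open>4 * K * s * N / r\<close>; the \<open>5\<close> below makes it strict.\<close>
    have d0: "cmod (\<delta> (\<psi> + s *\<^sub>R h) k - \<delta> \<psi> k) \<le> C * s"
    proof (cases "k = 0")
      case True
      have "scaleC_pot z 0 = 0" for z using norm_scaleC_pot[of z 0] by simp
      then show ?thesis using True Kpos s by (simp add: \<delta>_def C_def)
    next
      case False
      define G where "G = (\<lambda>\<phi>. F (\<phi> + s *\<^sub>R h) - F \<phi>)"
      have GF: "(\<lambda>z. F (\<psi> + s *\<^sub>R h + scaleC_pot z k)) holomorphic_on ball 0 (r / 4 / norm k)"
               "(\<lambda>z. F (\<psi> + scaleC_pot z k)) holomorphic_on ball 0 (r / 4 / norm k)"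
        using dsh r gateaux_holomorphic_on_line[OF gateaux_holomorphic_subset[OF F2(1) subset_ball] False, of _ "r / 4"]
        by simp_all
      have b: "cmod (F (\<psi> + s *\<^sub>R h + scaleC_pot z k) - F (\<psi> + scaleC_pot z k)) < 5 * K * s * N / r"
        if "norm z < r / 4 / norm k" for z
      proof -
        have d: "dist (\<psi> + scaleC_pot z k) \<psi> < r / 2" using that False r
          by (simp add: dist_norm norm_scaleC_pot field_simps)
        have "cmod (F ((\<psi> + scaleC_pot z k) + s *\<^sub>R h) - F (\<psi> + scaleC_pot z k)) \<le> 2 * K * norm (s *\<^sub>R h) / (r / 2)"
          using F2[OF d] K2[OF d] nx[OF N(1)] sN r by (intro gateaux_holomorphic_Lipschitz) auto
        also have "\<dots> \<le> 2 * K * (s * N) / (r / 2)"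
          using nx[OF N(1)] Kpos r by (intro divide_right_mono mult_left_mono) auto
        also have "\<dots> < 5 * K * s * N / r" using Kpos r s N by (simp add: field_simps)
        finally show ?thesis by (simp add: algebra_simps)
      qed
      have "cmod (deriv (\<lambda>z. F (\<psi> + s *\<^sub>R h + scaleC_pot z k) - F (\<psi> + scaleC_pot z k)) 0) \<le>
         2 * (5 * K * s * N / r) / (r / 4 / norm k)"
        using False r by (intro Taylor1_bound(2)[OF holomorphic_on_diff[OF GF] b, of "0::complex"]) auto
      also have "\<dots> = 40 * K * s * N * norm k / r\<^sup>2" using r False by (simp add: field_simps power2_eq_square)
      also have "\<dots> \<le> 40 * K * s * N * N / r\<^sup>2"
        using N Kpos s by (intro divide_right_mono mult_left_mono) auto
      also have "\<dots> \<le> C * s" using Kpos s r N by (simp add: C_def field_simps power2_eq_square)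
      finally show ?thesis
        unfolding \<delta>_def using GF r False
        by (subst (asm) deriv_diff) (auto simp: holomorphic_on_imp_differentiable_at)
    qed
    have id: "s * (\<delta> \<psi> (h + k) - \<delta> \<psi> h - \<delta> \<psi> k) =
       - (F (\<psi> + s *\<^sub>R (h + k)) - F \<psi> - s * \<delta> \<psi> (h + k))
       + (F (\<psi> + s *\<^sub>R h) - F \<psi> - s * \<delta> \<psi> h)
       + (F ((\<psi> + s *\<^sub>R h) + s *\<^sub>R k) - F (\<psi> + s *\<^sub>R h) - s * \<delta> (\<psi> + s *\<^sub>R h) k)
       + s * (\<delta> (\<psi> + s *\<^sub>R h) k - \<delta> \<psi> k)"
      by (simp add: algebra_simps)
    have "cmod (s * (\<delta> \<psi> (h + k) - \<delta> \<psi> h - \<delta> \<psi> k)) \<le> C * s\<^sup>2 + C * s\<^sup>2 + C * s\<^sup>2 + s * (C * s)"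
      unfolding id
    proof (intro order_trans[OF norm_triangle_ineq] add_mono)
      show "cmod (s * (\<delta> (\<psi> + s *\<^sub>R h) k - \<delta> \<psi> k)) \<le> s * (C * s)"
        using d0 s by (simp add: norm_mult)
    qed (use T[OF N(3)] T[OF N(1)] T[OF N(2)] dsh r in \<open>auto simp: norm_minus_commute norm_minus_cancel simp del: minus_diff_eq\<close>)
    also have "C * s\<^sup>2 + C * s\<^sup>2 + C * s\<^sup>2 + s * (C * s) = s * (4 * C * s)"
      by (simp add: power2_eq_square)
    finally have "s * cmod (\<delta> \<psi> (h + k) - \<delta> \<psi> h - \<delta> \<psi> k) \<le> s * (4 * C * s)"
      unfolding norm_mult using s by simp
    then show ?thesis using s by simp
  qed
  have "cmod (\<delta> \<psi> (h + k) - \<delta> \<psi> h - \<delta> \<psi> k) \<le> 0"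
  proof (rule tendsto_lowerbound[where F = "at_right (0::real)"])
    show "((\<lambda>s. 4 * C * s) \<longlongrightarrow> 0) (at_right 0)" by (auto intro!: tendsto_eq_intros)
    have "r / (4 * N) > 0" using r N by simp
    then show "\<forall>\<^sub>F s in at_right 0. cmod (\<delta> \<psi> (h + k) - \<delta> \<psi> h - \<delta> \<psi> k) \<le> 4 * C * s"
      unfolding eventually_at_right_field using small by (intro exI[of _ "r / (4 * N)"]) auto
  qed simp
  then show ?thesis by (simp add: \<delta>_def algebra_simps)
qed

text \<open>The directional derivative is complex homogeneous by substitution, additive by
  \<open>gateaux_deriv_add\<close> and bounded by Schwarz's lemma; the Taylor remainder is quadratic
  in \<open>norm h\<close>, so this derivative is the Frechet derivative.\<close>

lemma analytic_on_pot_if_gateaux_holomorphic: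
  assumes "open W"
    and loc: "\<And>\<psi>. \<psi> \<in> W \<Longrightarrow> \<exists>r>0. \<exists>K. gateaux_holomorphic F (ball \<psi> r) \<and> (\<forall>\<phi>\<in>ball \<psi> r. cmod (F \<phi>) < K)"
  shows "analytic_on_pot F W"
  unfolding analytic_on_pot_def
proof (intro conjI ballI \<open>open W\<close>)
  fix \<psi> assume "\<psi> \<in> W"
  then obtain r K where r: "r > 0" and F: "gateaux_holomorphic F (ball \<psi> r)"
    and K: "\<And>\<phi>. \<phi> \<in> ball \<psi> r \<Longrightarrow> cmod (F \<phi>) < K" using loc by blast
  define L where "L = (\<lambda>h. deriv (\<lambda>z. F (\<psi> + scaleC_pot z h)) 0)"
  have Lc: "L (scaleC_pot c h) = c * L h" for c h
    unfolding L_def by (rule gateaux_deriv_scaleC[OF F r])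
  have bl: "bounded_linear L"
  proof
    show "L (h + k) = L h + L k" for h k unfolding L_def by (rule gateaux_deriv_add[OF F r K])
    show "L (s *\<^sub>R h) = s *\<^sub>R L h" for s h
      using Lc[of "of_real s" h] by (simp add: scaleC_pot_of_real scaleR_conv_of_real)
    show "\<exists>C. \<forall>h. cmod (L h) \<le> norm h * C"
      using gateaux_deriv_bound[OF F r K] by (intro exI[of _ "2 * K / r"]) (simp add: L_def mult_ac)
  qed
  have "(F has_derivative L) (at \<psi>)"
    unfolding has_derivative_at
  proof (intro conjI bl)
    show "(\<lambda>h. norm (F (\<psi> + h) - F \<psi> - L h) / norm h) \<midarrow>0\<rightarrow> 0"
    proof (rule tendsto_sandwich)
      show "\<forall>\<^sub>F h in at 0. 0 \<le> norm (F (\<psi> + h) - F \<psi> - L h) / norm h" by simp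
      have "norm (F (\<psi> + h) - F \<psi> - L h) / norm h \<le> 6 * K / r\<^sup>2 * norm h" if "norm h < r" for h
      proof (cases "h = 0")
        case False
        have "norm (F (\<psi> + h) - F \<psi> - L h) \<le> 6 * K / r\<^sup>2 * norm h * norm h"
          using gateaux_Taylor1[OF F r K that] by (simp add: L_def power2_eq_square)
        then show ?thesis using False by (simp add: divide_le_eq)
      qed (use gateaux_deriv_bound[OF F r K, of 0] in \<open>simp add: L_def\<close>)
      then show "\<forall>\<^sub>F h in at 0. norm (F (\<psi> + h) - F \<psi> - L h) / norm h \<le> 6 * K / r\<^sup>2 * norm h"
        unfolding eventually_at using r by (intro exI[of _ r] conjI ballI impI) auto
      show "((\<lambda>h. 6 * K / r\<^sup>2 * norm h) \<longlongrightarrow> 0) (at 0)"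
        by (intro tendsto_mult_right_zero tendsto_norm_zero tendsto_ident_at)
    qed simp
  qed
  with Lc show "\<exists>L. (F has_derivative L) (at \<psi>) \<and> (\<forall>c h. L (scaleC_pot c h) = c * L h)" by blast
qed

section \<open>Linear systems with continuous coefficients\<close>

text \<open>Rescaling to the fixed interval treats both signs of \<open>t\<close> alike and leaves
  \<open>t\<close> and all parameters inside the integrand, where the theorems on parameter
  integrals apply.\<close>

definition antiderivative :: "(real \<Rightarrow> complex) \<Rightarrow> real \<Rightarrow> complex" where
  "antiderivative f t = of_real t * integral {0..1} (\<lambda>u. f (t * u))"

lemma antiderivative_eq_diff:
  assumes F: "\<And>s. (F has_vector_derivative f s) (at s)"
  shows "antiderivative f t = F t - F 0"
proof -
  have "((\<lambda>u. t *\<^sub>R f (t * u)) has_integral (F \<circ> (*) t) 1 - (F \<circ> (*) t) 0) {0..1}"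
  proof (rule fundamental_theorem_of_calculus)
    fix u :: real
    have "((*) t has_vector_derivative t) (at u)"
      by (auto intro!: derivative_eq_intros simp flip: has_real_derivative_iff_has_vector_derivative)
    from vector_diff_chain_at[OF this F[of "t * u"]]
    show "((F \<circ> (*) t) has_vector_derivative t *\<^sub>R f (t * u)) (at u within {0..1})"
      by (rule has_vector_derivative_at_within)
  qed simp
  from integral_unique[OF this] have "integral {0..1} (\<lambda>u. t *\<^sub>R f (t * u)) = F t - F 0" by simp
  then show ?thesis by (simp add: antiderivative_def scaleR_conv_of_real)
qed

lemma antiderivative_has_vector_derivative:
  assumes "continuous_on UNIV f"
  shows "(antiderivative f has_vector_derivative f t) (at t)"
proof -
  \<comment> \<open>Local primitives normalized at \<open>0\<close>; by the fundamental theorem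
    \<open>antiderivative f\<close> coincides with each of them on its interval.\<close>
  have "\<exists>F. (\<forall>s\<in>{-T<..<T}. (F has_vector_derivative f s) (at s)) \<and> F 0 = 0" for T
  proof -
    have "continuous_on {-T..T} f" using assms continuous_on_subset by blast
    then obtain g where g: "\<And>x. x \<in> {-T..T} \<Longrightarrow> (g has_vector_derivative f x) (at x within {-T..T})"
      using antiderivative_continuous by blast
    have "((\<lambda>x. g x - g 0) has_vector_derivative f s) (at s)" if "s \<in> {-T<..<T}" for s
    proof -
      have "(g has_vector_derivative f s) (at s within {-T<..<T})"
        by (rule has_vector_derivative_within_subset[OF g]) (use that in auto)
      then have "(g has_vector_derivative f s) (at s)"
        using that by (simp add: at_within_open[OF _ open_greaterThanLessThan])
      then show ?thesis by (auto intro!: derivative_eq_intros)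
    qed
    then show ?thesis by (intro exI[of _ "\<lambda>x. g x - g 0"]) auto
  qed
  then obtain F where F: "\<And>T s. s \<in> {-T<..<T} \<Longrightarrow> (F T has_vector_derivative f s) (at s)" "\<And>T. F T 0 = 0"
    by metis
  define T where "T = \<bar>t\<bar> + 1"
  have eq: "antiderivative f s = F T s" if s: "s \<in> {-T<..<T}" for s
  proof -
    have "((\<lambda>u. s *\<^sub>R f (s * u)) has_integral (F T \<circ> (*) s) 1 - (F T \<circ> (*) s) 0) {0..1}"
    proof (rule fundamental_theorem_of_calculus)
      fix u :: real assume u: "u \<in> {0..1}"
      have "\<bar>s * u\<bar> \<le> \<bar>s\<bar>" using u by (simp add: abs_mult mult_left_le)
      then have su: "s * u \<in> {-T<..<T}" using s by auto
      have "((*) s has_vector_derivative s) (at u)"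
        by (auto intro!: derivative_eq_intros simp flip: has_real_derivative_iff_has_vector_derivative)
      from vector_diff_chain_at[OF this F(1)[OF su]]
      show "((F T \<circ> (*) s) has_vector_derivative s *\<^sub>R f (s * u)) (at u within {0..1})"
        by (rule has_vector_derivative_at_within)
    qed simp
    from integral_unique[OF this] have "integral {0..1} (\<lambda>u. s *\<^sub>R f (s * u)) = F T s" by (simp add: F(2))
    then show ?thesis by (simp add: antiderivative_def scaleR_conv_of_real)
  qed
  have t: "t \<in> {-T<..<T}" by (auto simp: T_def)
  show ?thesis
    by (rule has_vector_derivative_transform_within_open[OF F(1)[OF t] open_greaterThanLessThan t])
       (simp add: eq)
qed

text \<open>Each integration raises the power and divides by the new exponent. Iteration produces
  the factorials that make the Dyson series converge like an exponential.\<close>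

lemma norm_antiderivative_le:
  assumes f: "continuous_on UNIV f" and bd: "\<And>s. \<bar>s\<bar> \<le> T \<Longrightarrow> cmod (f s) \<le> C * \<bar>s\<bar> ^ k" and t: "\<bar>t\<bar> \<le> T"
  shows "cmod (antiderivative f t) \<le> C * \<bar>t\<bar> ^ Suc k / Suc k"
proof -
  have c: "continuous_on {0..1} (\<lambda>u. f (t * u))"
    by (rule continuous_on_compose2[OF f]) (auto intro!: continuous_intros)
  have "((\<lambda>u. C * \<bar>t\<bar> ^ k * u ^ k) has_integral (C * \<bar>t\<bar> ^ k * 1 ^ Suc k / Suc k - C * \<bar>t\<bar> ^ k * 0 ^ Suc k / Suc k)) {0..1}"
    by (intro fundamental_theorem_of_calculus)
       (auto intro!: derivative_eq_intros simp flip: has_real_derivative_iff_has_vector_derivative simp del: of_nat_Suc power_Suc)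
  then have I: "((\<lambda>u. C * \<bar>t\<bar> ^ k * u ^ k) has_integral C * \<bar>t\<bar> ^ k / Suc k) {0..1}" by simp
  have "norm (integral {0..1} (\<lambda>u. f (t * u))) \<le> integral {0..1} (\<lambda>u. C * \<bar>t\<bar> ^ k * u ^ k)"
  proof (rule integral_norm_bound_integral)
    show "(\<lambda>u. f (t * u)) integrable_on {0..1}" using c by (rule integrable_continuous_real)
    show "(\<lambda>u. C * \<bar>t\<bar> ^ k * u ^ k) integrable_on {0..1}" using I by blast
    fix u :: real assume u: "u \<in> {0..1}"
    have "\<bar>t * u\<bar> \<le> \<bar>t\<bar>" using u by (simp add: abs_mult mult_left_le)
    then show "norm (f (t * u)) \<le> C * \<bar>t\<bar> ^ k * u ^ k"
      using bd[of "t * u"] t u by (simp add: abs_mult power_mult_distrib mult_ac)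
  qed
  then have "cmod (antiderivative f t) \<le> \<bar>t\<bar> * (C * \<bar>t\<bar> ^ k / Suc k)"
    unfolding integral_unique[OF I] antiderivative_def norm_mult norm_of_real by (rule mult_left_mono) simp
  then show ?thesis by (simp add: mult_ac)
qed

lemma continuous_on_antiderivative_param:
  fixes f :: "'p::metric_space \<Rightarrow> real \<Rightarrow> complex"
  assumes "continuous_on (UNIV \<times> S) (\<lambda>(t, z). f z t)"
  shows "continuous_on (UNIV \<times> S) (\<lambda>(t, z). antiderivative (f z) t)"
proof -
  have "continuous_on ((UNIV \<times> S) \<times> cbox 0 1) (\<lambda>q. (\<lambda>(t, z). f z t) (fst (fst q) * snd q, snd (fst q)))"
    by (rule continuous_on_compose2[OF assms]) (auto intro!: continuous_intros)
  then have "continuous_on ((UNIV \<times> S) \<times> cbox 0 1) (\<lambda>(p, u). (\<lambda>p u. f (snd p) (fst p * u)) p u)"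
    by (simp add: split_def)
  then have "continuous_on (UNIV \<times> S) (\<lambda>p. integral (cbox 0 1) (\<lambda>u. f (snd p) (fst p * u)))"
    by (rule integral_continuous_on_param)
  then have "continuous_on (UNIV \<times> S) (\<lambda>p. of_real (fst p) * integral (cbox 0 1) (\<lambda>u. f (snd p) (fst p * u)))"
    by (intro continuous_intros)
  then show ?thesis by (simp add: split_def antiderivative_def)
qed

lemma holomorphic_on_antiderivative_param:
  assumes "open S" and cont: "continuous_on (UNIV \<times> S) (\<lambda>(t, z). f z t)"
    and hol: "\<And>t. (\<lambda>z. f z t) holomorphic_on S"
  shows "(\<lambda>z. antiderivative (f z) t) holomorphic_on S"
proof -
  have "continuous_on (S \<times> cbox 0 1) (\<lambda>q. (\<lambda>(t, z). f z t) (t * snd q, fst q))"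
    by (rule continuous_on_compose2[OF cont]) (auto intro!: continuous_intros)
  then have "(\<lambda>z. integral (cbox 0 1) (\<lambda>u. f z (t * u))) holomorphic_on S"
    by (intro holomorphic_on_integral_param \<open>open S\<close> hol) (simp add: split_def)
  then show ?thesis unfolding antiderivative_def by (intro holomorphic_intros) simp
qed

text \<open>The Picard iterates, i.e. the time-ordered integrals of the Dyson series, whose sum is
  the fundamental matrix. Working with entries instead of matrices lets continuity and holomorphy be
  handled for scalar functions.\<close>

primrec dyson :: "('n::finite \<Rightarrow> 'n \<Rightarrow> real \<Rightarrow> complex) \<Rightarrow> nat \<Rightarrow> 'n \<Rightarrow> 'n \<Rightarrow> real \<Rightarrow> complex" where
  "dyson A 0 i j = (\<lambda>t. of_bool (i = j))"
| "dyson A (Suc k) i j = antiderivative (\<lambda>s. \<Sum>l\<in>UNIV. A i l s * dyson A k l j s)"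

definition linear_ode_solution :: "('n::finite \<Rightarrow> 'n \<Rightarrow> real \<Rightarrow> complex) \<Rightarrow> 'n \<Rightarrow> 'n \<Rightarrow> real \<Rightarrow> complex" where
  "linear_ode_solution A i j t = (\<Sum>k. dyson A k i j t)"

lemma continuous_on_dyson_param:
  fixes A :: "'p::metric_space \<Rightarrow> 'n::finite \<Rightarrow> 'n \<Rightarrow> real \<Rightarrow> complex"
  assumes "\<And>i j. continuous_on (UNIV \<times> S) (\<lambda>(t, z). A z i j t)"
  shows "continuous_on (UNIV \<times> S) (\<lambda>(t, z). dyson (A z) k i j t)"
proof (induction k arbitrary: i j)
  case (Suc k)
  have "continuous_on (UNIV \<times> S) (\<lambda>(t, z). \<Sum>l\<in>UNIV. A z i l t * dyson (A z) k l j t)"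
    using assms Suc.IH unfolding split_def by (intro continuous_intros)
  then show ?case unfolding dyson.simps by (rule continuous_on_antiderivative_param)
qed (simp add: split_def)

lemma holomorphic_on_dyson_param:
  fixes A :: "complex \<Rightarrow> 'n::finite \<Rightarrow> 'n \<Rightarrow> real \<Rightarrow> complex"
  assumes "open S" and cont: "\<And>i j. continuous_on (UNIV \<times> S) (\<lambda>(t, z). A z i j t)"
    and hol: "\<And>i j t. (\<lambda>z. A z i j t) holomorphic_on S"
  shows "(\<lambda>z. dyson (A z) k i j t) holomorphic_on S"
proof (induction k arbitrary: i j t)
  case (Suc k)
  have "continuous_on (UNIV \<times> S) (\<lambda>(t, z). \<Sum>l\<in>UNIV. A z i l t * dyson (A z) k l j t)"
    using cont continuous_on_dyson_param[OF cont] unfolding split_def by (intro continuous_intros)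
  moreover have "(\<lambda>z. \<Sum>l\<in>UNIV. A z i l t * dyson (A z) k l j t) holomorphic_on S" for t
    by (intro holomorphic_intros hol Suc.IH)
  ultimately show ?case
    unfolding dyson.simps by (rule holomorphic_on_antiderivative_param[OF \<open>open S\<close>])
qed simp

lemma continuous_on_dyson:
  assumes "\<And>i j. continuous_on UNIV (A i j)"
  shows "continuous_on UNIV (dyson A k i j)"
proof -
  \<comment> \<open>The parameter version over a one-point parameter space.\<close>
  have "continuous_on (UNIV \<times> {0::real}) (\<lambda>(t, z). dyson A k i j t)"
    by (rule continuous_on_dyson_param)
       (use continuous_on_compose2[OF assms continuous_on_fst[OF continuous_on_id]] in \<open>simp add: split_def\<close>)
  then have "continuous_on UNIV (\<lambda>t. (\<lambda>(t, z). dyson A k i j t) (t, 0::real))"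
    by (rule continuous_on_compose2) (auto intro!: continuous_intros)
  then show ?thesis by simp
qed

text \<open>Shared by the bound for the Dyson terms, where \<open>C\<close> is \<open>1\<close>, and
  the uniqueness proof, where \<open>C\<close> bounds the solution itself.\<close>

lemma iterated_bound_step:
  fixes w :: "'n::finite \<Rightarrow> complex" and C K :: real
  assumes "\<And>l. cmod (a l) \<le> K" "\<And>l. cmod (w l) \<le> C * (CARD('n) * K) ^ k / fact k * \<bar>s\<bar> ^ k"
  shows "cmod (\<Sum>l\<in>UNIV. a l * w l) \<le> C * (CARD('n) * K) ^ Suc k / fact k * \<bar>s\<bar> ^ k"
proof -
  have "cmod (\<Sum>l\<in>UNIV. a l * w l) \<le> (\<Sum>l\<in>(UNIV::'n set). K * (C * (CARD('n) * K) ^ k / fact k * \<bar>s\<bar> ^ k))"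
    unfolding norm_mult using order_trans[OF norm_ge_zero assms(1)]
    by (intro sum_norm_le) (auto simp only: norm_mult intro!: mult_mono assms norm_ge_zero)
  then show ?thesis by (simp add: mult_ac)
qed

lemma norm_dyson_le:
  fixes A :: "'n::finite \<Rightarrow> 'n \<Rightarrow> real \<Rightarrow> complex" and K T :: real
  assumes c: "\<And>i j. continuous_on UNIV (A i j)"
    and K: "\<And>i j s. \<bar>s\<bar> \<le> T \<Longrightarrow> cmod (A i j s) \<le> (K::real)" and "\<bar>t\<bar> \<le> T"
  shows "cmod (dyson A k i j t) \<le> (CARD('n) * K) ^ k / fact k * \<bar>t\<bar> ^ k"
  using \<open>\<bar>t\<bar> \<le> T\<close>
proof (induction k arbitrary: i j t)
  case (Suc k)
  have "cmod (dyson A (Suc k) i j t) \<le> ((1::real) * (CARD('n) * K) ^ Suc k / fact k) * \<bar>t\<bar> ^ Suc k / Suc k"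
    unfolding dyson.simps
  proof (rule norm_antiderivative_le[OF _ _ Suc.prems])
    show "continuous_on UNIV (\<lambda>s. \<Sum>l\<in>UNIV. A i l s * dyson A k l j s)"
      by (intro continuous_intros c continuous_on_dyson)
    show "cmod (\<Sum>l\<in>UNIV. A i l s * dyson A k l j s) \<le> ((1::real) * (CARD('n) * K) ^ Suc k / fact k) * \<bar>s\<bar> ^ k"
      if "\<bar>s\<bar> \<le> T" for s
      by (rule iterated_bound_step) (use K Suc.IH that in auto)
  qed
  then show ?case by (simp add: field_simps)
qed auto

lemma bounded_coefficients:
  fixes A :: "'n::finite \<Rightarrow> 'n \<Rightarrow> real \<Rightarrow> complex"
  assumes c: "\<And>i j. continuous_on UNIV (A i j)"
  shows "\<exists>K>0. \<forall>i j s. \<bar>s\<bar> \<le> T \<longrightarrow> cmod (A i j s) \<le> K"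
proof -
  define Y where "Y = (\<Union>i. \<Union>j. A i j ` {-T..T})"
  have "bounded Y" unfolding Y_def
    by (intro bounded_UN ballI finite compact_imp_bounded compact_continuous_image compact_Icc)
       (use c continuous_on_subset in blast)
  then obtain K where K: "K > 0" "\<And>x. x \<in> Y \<Longrightarrow> norm x \<le> K"
    unfolding bounded_pos by metis
  have "cmod (A i j s) \<le> K" if "\<bar>s\<bar> \<le> T" for i j s
  proof (rule K(2))
    have "s \<in> {-T..T}" using that by auto
    then show "A i j s \<in> Y" unfolding Y_def by blast
  qed
  with K(1) show ?thesis by blast
qed

lemma power_div_fact_tendsto_0: "(\<lambda>k. x ^ k / fact k) \<longlonglongrightarrow> (0::real)"
  using summable_LIMSEQ_zero[OF summable_exp[of x]] by (simp add: divide_inverse mult.commute)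

text \<open>A solution with zero initial value equals the integral of \<open>A\<close> times itself.
  Iterating this \<open>k\<close> times bounds it by a constant times the \<open>k\<close>-th term
  of an exponential series, which tends to \<open>0\<close>.\<close>

lemma linear_ode_unique:
  fixes A :: "'n::finite \<Rightarrow> 'n \<Rightarrow> real \<Rightarrow> complex"
  assumes c: "\<And>i j. continuous_on UNIV (A i j)"
    and v: "\<And>i t. (v i has_vector_derivative (\<Sum>l\<in>UNIV. A i l t * v l t)) (at t)"
    and v0: "\<And>i. v i 0 = 0"
  shows "v i t = 0"
proof -
  obtain K where K: "K > 0" "\<And>i j s. \<bar>s\<bar> \<le> \<bar>t\<bar> \<Longrightarrow> cmod (A i j s) \<le> K"
    using bounded_coefficients[of A "\<bar>t\<bar>", OF c] by blast
  have cv: "continuous_on UNIV (v i)" for i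
    by (intro continuous_at_imp_continuous_on ballI has_vector_derivative_continuous[OF v])
  obtain C where C: "cmod (v i s) \<le> C" if "\<bar>s\<bar> \<le> \<bar>t\<bar>" for i s
    using bounded_coefficients[of "\<lambda>i (j::'n). v i" "\<bar>t\<bar>", OF cv] by blast
  have bd: "cmod (v i s) \<le> C * (CARD('n) * K) ^ k / fact k * \<bar>s\<bar> ^ k" if "\<bar>s\<bar> \<le> \<bar>t\<bar>" for i s k
    using that
  proof (induction k arbitrary: i s)
    case (Suc k)
    have eq: "v i s = antiderivative (\<lambda>s. \<Sum>l\<in>UNIV. A i l s * v l s) s"
      using antiderivative_eq_diff[where F = "v i", OF v, of s] by (simp add: v0)
    have "cmod (v i s) \<le> (C * (CARD('n) * K) ^ Suc k / fact k) * \<bar>s\<bar> ^ Suc k / Suc k"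
      unfolding eq
    proof (rule norm_antiderivative_le[OF _ _ Suc.prems])
      show "continuous_on UNIV (\<lambda>s. \<Sum>l\<in>UNIV. A i l s * v l s)"
        by (intro continuous_intros c cv)
      show "cmod (\<Sum>l\<in>UNIV. A i l s * v l s) \<le> (C * (CARD('n) * K) ^ Suc k / fact k) * \<bar>s\<bar> ^ k"
        if "\<bar>s\<bar> \<le> \<bar>t\<bar>" for s
        by (rule iterated_bound_step) (use K Suc.IH that in auto)
    qed
    then show ?case by (simp add: field_simps)
  qed (use C in simp)
  have "cmod (v i t) \<le> 0"
  proof (rule LIMSEQ_le_const)
    have "(\<lambda>k. C * ((CARD('n) * K * \<bar>t\<bar>) ^ k / fact k)) \<longlonglongrightarrow> C * 0"
      by (intro tendsto_mult tendsto_const power_div_fact_tendsto_0)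
    then show "(\<lambda>k. C * ((CARD('n) * K * \<bar>t\<bar>) ^ k / fact k)) \<longlonglongrightarrow> 0" by simp
    show "\<exists>N. \<forall>k\<ge>N. cmod (v i t) \<le> C * ((CARD('n) * K * \<bar>t\<bar>) ^ k / fact k)"
    proof (intro exI allI impI)
      fix k
      show "cmod (v i t) \<le> C * ((CARD('n) * K * \<bar>t\<bar>) ^ k / fact k)"
        using bd[of t i k] unfolding power_mult_distrib by simp
    qed
  qed
  then show ?thesis by simp
qed

lemma summable_power_div_fact: "summable (\<lambda>k. x ^ k / fact k :: real)"
  using summable_exp[of x] by (simp add: divide_inverse mult.commute)

context
  fixes A :: "'n::finite \<Rightarrow> 'n \<Rightarrow> real \<Rightarrow> complex"
  assumes c: "\<And>i j. continuous_on UNIV (A i j)"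
begin

lemma norm_dyson_le':
  fixes K T :: real
  assumes K: "\<And>i j s. \<bar>s\<bar> \<le> T \<Longrightarrow> cmod (A i j s) \<le> K" and "\<bar>t\<bar> \<le> T"
  shows "cmod (dyson A k i j t) \<le> (CARD('n) * K * T) ^ k / fact k"
proof -
  have "0 \<le> K" using K[of 0 undefined undefined] \<open>\<bar>t\<bar> \<le> T\<close> norm_ge_zero[of "A undefined undefined 0"]
    by linarith
  have "cmod (dyson A k i j t) \<le> (CARD('n) * K) ^ k / fact k * \<bar>t\<bar> ^ k"
    by (rule norm_dyson_le[OF c assms])
  also have "\<dots> \<le> (CARD('n) * K) ^ k / fact k * T ^ k"
    using \<open>0 \<le> K\<close> \<open>\<bar>t\<bar> \<le> T\<close> by (intro mult_left_mono power_mono) (auto simp del: of_nat_mult)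
  finally show ?thesis by (simp add: power_mult_distrib)
qed

lemma summable_dyson: "summable (\<lambda>k. dyson A k i j t)"
proof -
  obtain K where K: "K > 0" "\<And>i j s. \<bar>s\<bar> \<le> \<bar>t\<bar> \<Longrightarrow> cmod (A i j s) \<le> K"
    using bounded_coefficients[of A "\<bar>t\<bar>", OF c] by blast
  show ?thesis
    by (rule summable_comparison_test[OF _ summable_power_div_fact[of "CARD('n) * K * \<bar>t\<bar>"]])
       (use norm_dyson_le'[OF K(2)] in auto)
qed

lemma norm_linear_ode_solution_le:
  fixes K T :: real
  assumes K: "\<And>i j s. \<bar>s\<bar> \<le> T \<Longrightarrow> cmod (A i j s) \<le> K" and "\<bar>t\<bar> \<le> T"
  shows "cmod (linear_ode_solution A i j t) \<le> exp (CARD('n) * K * T)"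
proof -
  have s: "(\<lambda>k. (CARD('n) * K * T) ^ k / fact k) sums exp (CARD('n) * K * T)"
    using exp_converges[of "CARD('n) * K * T"] by (simp add: divide_inverse mult.commute)
  have "cmod (\<Sum>k. dyson A k i j t) \<le> (\<Sum>k. (CARD('n) * K * T) ^ k / fact k)"
    by (intro norm_suminf_le norm_dyson_le'[OF K] summable_power_div_fact assms)
  then show ?thesis using sums_unique[OF s] by (simp add: linear_ode_solution_def)
qed

lemma dyson_has_vector_derivative:
  "(dyson A k i j has_vector_derivative
      (case k of 0 \<Rightarrow> 0 | Suc m \<Rightarrow> \<Sum>l\<in>UNIV. A i l t * dyson A m l j t)) (at t)"
  by (cases k) (auto intro!: antiderivative_has_vector_derivative continuous_intros c continuous_on_dyson)

lemma linear_ode_solution_0: "linear_ode_solution A i j 0 = of_bool (i = j)"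
proof -
  have "dyson A k i j 0 = (if k = 0 then of_bool (i = j) else 0)" for k
    by (cases k) (auto simp: antiderivative_def)
  then show ?thesis using suminf_finite[of "{0}" "\<lambda>k. dyson A k i j 0"] by (simp add: linear_ode_solution_def)
qed

text \<open>Termwise differentiation. Each term differentiates to \<open>A\<close> times the
  preceding one, so an exponential series shifted by one index dominates the derivatives uniformly
  on \<open>{-T..T}\<close>.\<close>

lemma linear_ode_solution_has_vector_derivative:
  "(linear_ode_solution A i j has_vector_derivative
      (\<Sum>l\<in>UNIV. A i l t * linear_ode_solution A l j t)) (at t)"
proof -
  define T where "T = \<bar>t\<bar> + 1"
  obtain K where K: "K > 0" "\<And>i j s. \<bar>s\<bar> \<le> T \<Longrightarrow> cmod (A i j s) \<le> K"
    using bounded_coefficients[of A T, OF c] by blast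
  define F' where "F' = (\<lambda>k t. case k of 0 \<Rightarrow> 0 | Suc m \<Rightarrow> \<Sum>l\<in>UNIV. A i l t * dyson A m l j t)"
  define M where "M = (\<lambda>k. case k of 0 \<Rightarrow> 0 | Suc m \<Rightarrow> CARD('n) * K * ((CARD('n) * K * T) ^ m / fact m))"
  have M: "summable M"
    by (subst summable_Suc_iff[symmetric])
       (unfold M_def nat.case, intro summable_mult summable_power_div_fact)
  have F'M: "norm (F' k s) \<le> M k" if "\<bar>s\<bar> \<le> T" for k s
  proof (cases k)
    case (Suc m)
    have "norm (F' k s) \<le> (\<Sum>l\<in>(UNIV::'n set). K * ((CARD('n) * K * T) ^ m / fact m))"
      unfolding F'_def Suc nat.case
    proof (rule sum_norm_le)
      fix l
      show "norm (A i l s * dyson A m l j s) \<le> K * ((CARD('n) * K * T) ^ m / fact m)"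
        unfolding norm_mult using K(1)
        by (intro mult_mono K(2)[rule_format, OF that] norm_dyson_le'[OF K(2)[rule_format] that]) auto
    qed
    then show ?thesis by (simp add: M_def Suc)
  qed (simp_all add: F'_def M_def)
  have ul: "uniform_limit {-T..T} (\<lambda>n s. \<Sum>k<n. F' k s) (\<lambda>s. \<Sum>k. F' k s) sequentially"
    by (rule Weierstrass_m_test[OF F'M M]) auto
  have sumF': "(\<Sum>k. F' k s) = (\<Sum>l\<in>UNIV. A i l s * linear_ode_solution A l j s)" for s
  proof -
    have "(\<lambda>k. F' (Suc k) s) sums (\<Sum>l\<in>UNIV. A i l s * linear_ode_solution A l j s)"
      unfolding F'_def nat.case linear_ode_solution_def
      by (intro sums_sum sums_mult summable_sums summable_dyson)
    then have "(\<lambda>k. F' k s) sums (\<Sum>l\<in>UNIV. A i l s * linear_ode_solution A l j s)"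
      by (subst (asm) sums_Suc_iff) (simp add: F'_def)
    then show ?thesis by (rule sums_unique[symmetric])
  qed
  have t: "t \<in> {-T<..<T}" by (auto simp: T_def)
  have "\<exists>g. \<forall>s\<in>{-T<..<T}. (\<lambda>k. dyson A k i j s) sums g s \<and> (g has_derivative (\<lambda>h. h *\<^sub>R (\<Sum>k. F' k s))) (at s within {-T<..<T})"
  proof (rule has_derivative_series)
    show "convex {-T<..<T}" by simp
    show "t \<in> {-T<..<T}" by fact
    show "(\<lambda>k. dyson A k i j t) sums (\<Sum>k. dyson A k i j t)" by (intro summable_sums summable_dyson)
    show "(dyson A k i j has_derivative (\<lambda>h. h *\<^sub>R F' k s)) (at s within {-T<..<T})" for k s
      using dyson_has_vector_derivative[of k i j s]
      by (simp add: F'_def has_vector_derivative_def has_derivative_at_withinI)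
    fix e :: real assume "e > 0"
    then have "\<forall>\<^sub>F n in sequentially. \<forall>s\<in>{-T..T}. dist (\<Sum>k<n. F' k s) (\<Sum>k. F' k s) < e"
      using ul by (auto simp: uniform_limit_iff)
    then show "\<forall>\<^sub>F n in sequentially. \<forall>s\<in>{-T<..<T}. \<forall>h.
         norm ((\<Sum>k<n. h *\<^sub>R F' k s) - h *\<^sub>R (\<Sum>k. F' k s)) \<le> e * norm h"
    proof (rule eventually_mono, safe)
      fix n s and h :: real
      assume *: "\<forall>s\<in>{-T..T}. dist (\<Sum>k<n. F' k s) (\<Sum>k. F' k s) < e" and s: "s \<in> {-T<..<T}"
      then have "dist (\<Sum>k<n. F' k s) (\<Sum>k. F' k s) < e" by simp
      then have "norm ((\<Sum>k<n. F' k s) - (\<Sum>k. F' k s)) \<le> e" by (simp add: dist_norm)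
      then show "norm ((\<Sum>k<n. h *\<^sub>R F' k s) - h *\<^sub>R (\<Sum>k. F' k s)) \<le> e * norm h"
        unfolding scaleR_right.sum[symmetric] scaleR_diff_right[symmetric] norm_scaleR
        by (simp only: real_norm_def mult.commute[of e] mult_left_mono abs_ge_zero)
    qed
  qed
  then obtain g where g: "\<And>s. s \<in> {-T<..<T} \<Longrightarrow> (\<lambda>k. dyson A k i j s) sums g s"
     "\<And>s. s \<in> {-T<..<T} \<Longrightarrow> (g has_derivative (\<lambda>h. h *\<^sub>R (\<Sum>k. F' k s))) (at s within {-T<..<T})" by blast
  have "(g has_vector_derivative (\<Sum>k. F' k t)) (at t)"
    using g(2)[OF t] t by (simp add: has_vector_derivative_def at_within_open[OF _ open_greaterThanLessThan])
  then have "(linear_ode_solution A i j has_vector_derivative (\<Sum>k. F' k t)) (at t)"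
    by (rule has_vector_derivative_transform_within_open[OF _ open_greaterThanLessThan t])
       (use g(1) in \<open>auto simp: linear_ode_solution_def dest: sums_unique\<close>)
  then show ?thesis by (simp add: sumF')
qed

end

section \<open>Dependence of solutions on parameters\<close>

lemma uniform_limit_dyson_param:
  fixes A :: "'p::metric_space \<Rightarrow> 'n::finite \<Rightarrow> 'n \<Rightarrow> real \<Rightarrow> complex"
  assumes "compact X" and cont: "\<And>i j. continuous_on (UNIV \<times> X) (\<lambda>(t, z). A z i j t)"
  shows "uniform_limit X (\<lambda>n z. \<Sum>k<n. dyson (A z) k i j t) (\<lambda>z. linear_ode_solution (A z) i j t) sequentially"
proof -
  have cA: "continuous_on UNIV (A z i j)" if "z \<in> X" for z i j
  proof -
    have "continuous_on UNIV (\<lambda>s. (\<lambda>(t, z). A z i j t) (s, z))"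
      by (rule continuous_on_compose2[OF cont]) (use that in \<open>auto intro!: continuous_intros\<close>)
    then show ?thesis by simp
  qed
  define Y where "Y = (\<Union>i. \<Union>j. (\<lambda>(t, z). A z i j t) ` ({-\<bar>t\<bar>..\<bar>t\<bar>} \<times> X))"
  have "bounded Y" unfolding Y_def
    by (intro bounded_UN ballI finite compact_imp_bounded compact_continuous_image compact_Times compact_Icc
         \<open>compact X\<close> continuous_on_subset[OF cont]) auto
  then obtain K where KY: "\<And>y. y \<in> Y \<Longrightarrow> norm y \<le> K"
    unfolding bounded_iff by metis
  have K: "cmod (A z i j s) \<le> K" if "z \<in> X" "\<bar>s\<bar> \<le> \<bar>t\<bar>" for z i j s
  proof (rule KY)
    have "(s, z) \<in> {-\<bar>t\<bar>..\<bar>t\<bar>} \<times> X" using that by auto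
    then have "(\<lambda>(t, z). A z i j t) (s, z) \<in> Y" unfolding Y_def by blast
    then show "A z i j s \<in> Y" by simp
  qed
  show ?thesis
    unfolding linear_ode_solution_def
  proof (rule Weierstrass_m_test[OF _ summable_power_div_fact[of "CARD('n) * K * \<bar>t\<bar>"]])
    show "cmod (dyson (A z) k i j t) \<le> (CARD('n) * K * \<bar>t\<bar>) ^ k / fact k" if "z \<in> X" for k z
      using that by (intro norm_dyson_le' cA K) auto
  qed
qed

lemma continuous_on_linear_ode_solution_param:
  fixes A :: "'p::heine_borel \<Rightarrow> 'n::finite \<Rightarrow> 'n \<Rightarrow> real \<Rightarrow> complex"
  assumes "open S" and cont: "\<And>i j. continuous_on (UNIV \<times> S) (\<lambda>(t, z). A z i j t)"
  shows "continuous_on S (\<lambda>z. linear_ode_solution (A z) i j t)"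
proof -
  have "continuous (at x) (\<lambda>z. linear_ode_solution (A z) i j t)" if x: "x \<in> S" for x
  proof -
    obtain d where d: "d > 0" "cball x d \<subseteq> S" using \<open>open S\<close> x by (meson open_contains_cball)
    have cd: "continuous_on (cball x d) (\<lambda>z. dyson (A z) k i j t)" for k
    proof -
      have "continuous_on (cball x d) (\<lambda>z. (\<lambda>(t, z). dyson (A z) k i j t) (t, z))"
        by (rule continuous_on_compose2[OF continuous_on_dyson_param[OF cont]])
           (use d in \<open>auto intro!: continuous_intros\<close>)
      then show ?thesis by simp
    qed
    have "continuous_on (cball x d) (\<lambda>z. linear_ode_solution (A z) i j t)"
    proof (rule uniform_limit_theorem[OF _ uniform_limit_dyson_param[OF compact_cball]])
      show "\<forall>\<^sub>F n in sequentially. continuous_on (cball x d) (\<lambda>z. \<Sum>k<n. dyson (A z) k i j t)"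
        by (intro always_eventually allI continuous_on_sum cd)
      show "continuous_on (UNIV \<times> cball x d) (\<lambda>(t, z). A z i j t)" for i j
        by (rule continuous_on_subset[OF cont]) (use d in auto)
    qed simp
    then have "continuous_on (ball x d) (\<lambda>z. linear_ode_solution (A z) i j t)"
      by (rule continuous_on_subset) auto
    then show ?thesis using d by (simp add: continuous_on_eq_continuous_at)
  qed
  then show ?thesis by (simp add: continuous_at_imp_continuous_on)
qed

text \<open>The partial sums are holomorphic and converge uniformly on closed discs of
  parameters.\<close>

lemma holomorphic_linear_ode_solution_param:
  fixes A :: "complex \<Rightarrow> 'n::finite \<Rightarrow> 'n \<Rightarrow> real \<Rightarrow> complex"
  assumes "open S" and cont: "\<And>i j. continuous_on (UNIV \<times> S) (\<lambda>(t, z). A z i j t)"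
    and hol: "\<And>i j t. (\<lambda>z. A z i j t) holomorphic_on S"
  shows "(\<lambda>z. linear_ode_solution (A z) i j t) holomorphic_on S"
proof (rule holomorphic_uniform_sequence[OF \<open>open S\<close>])
  show "(\<lambda>z. \<Sum>k<n. dyson (A z) k i j t) holomorphic_on S" for n
    by (intro holomorphic_intros holomorphic_on_dyson_param assms)
  fix x assume "x \<in> S"
  then obtain d where d: "d > 0" "cball x d \<subseteq> S" using \<open>open S\<close> by (meson open_contains_cball)
  have "uniform_limit (cball x d) (\<lambda>n z. \<Sum>k<n. dyson (A z) k i j t) (\<lambda>z. linear_ode_solution (A z) i j t) sequentially"
    by (intro uniform_limit_dyson_param compact_cball continuous_on_subset[OF cont]) (use d in auto)
  then show "\<exists>d>0. cball x d \<subseteq> S \<and> uniform_limit (cball x d)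
      (\<lambda>n z. \<Sum>k<n. dyson (A z) k i j t) (\<lambda>z. linear_ode_solution (A z) i j t) sequentially"
    using d by blast
qed

section \<open>The fundamental solution and the discriminant\<close>

definition lax_coeff :: "complex \<Rightarrow> pot \<Rightarrow> 2 \<Rightarrow> 2 \<Rightarrow> real \<Rightarrow> complex" where
  "lax_coeff z \<psi> i j t = (mat (- 2 * \<i> * z\<^sup>2) ** sigma3 + V t z \<psi>) $ i $ j"

definition lax_solution :: "pot \<Rightarrow> complex \<Rightarrow> 2 \<Rightarrow> 2 \<Rightarrow> real \<Rightarrow> complex" where
  "lax_solution \<psi> z = linear_ode_solution (lax_coeff z \<psi>)"

lemma lax_coeff_simps:
  "lax_coeff z \<psi> 1 1 t = - 2 * \<i> * z\<^sup>2 - \<i> * h1_apply (\<psi> $ 1) t * h1_apply (\<psi> $ 2) t"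
  "lax_coeff z \<psi> 1 2 t = 2 * z * h1_apply (\<psi> $ 1) t + \<i> * h1_apply (\<psi> $ 3) t"
  "lax_coeff z \<psi> 2 1 t = 2 * z * h1_apply (\<psi> $ 2) t - \<i> * h1_apply (\<psi> $ 4) t"
  "lax_coeff z \<psi> 2 2 t = 2 * \<i> * z\<^sup>2 + \<i> * h1_apply (\<psi> $ 1) t * h1_apply (\<psi> $ 2) t"
  by (simp_all add: lax_coeff_def V_def sigma3_def matrix_matrix_mult_def mat_def sum_2 Let_def)

text \<open>The spectral parameter \<open>f x\<close> and the position \<open>g x\<close> on a
  complex line both vary with \<open>x\<close>. Specializing one of them to a constant gives
  separate regularity, and taking both as projections of a pair gives joint continuity.\<close>

lemma continuous_on_lax_coeff_param:
  fixes f :: "'p::metric_space \<Rightarrow> complex"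
  assumes f: "continuous_on S f" and g: "continuous_on S g"
  shows "continuous_on (UNIV \<times> S) (\<lambda>(t, x). lax_coeff (f x) (\<psi> + scaleC_pot (g x) h) i j t)"
proof -
  have c: "continuous_on (UNIV \<times> S) (\<lambda>p. h1_apply q (fst p))" for q :: h1
    by (rule continuous_on_compose2[OF continuous_on_h1_apply[of UNIV]]) (auto intro!: continuous_intros)
  have f': "continuous_on (UNIV \<times> S) (\<lambda>p. f (snd p))" "continuous_on (UNIV \<times> S) (\<lambda>p. g (snd p))"
    by (rule continuous_on_compose2[OF f] continuous_on_compose2[OF g]; auto intro!: continuous_intros)+
  consider "i = 1" "j = 1" | "i = 1" "j = 2" | "i = 2" "j = 1" | "i = 2" "j = 2"
    using exhaust_2 by metis
  then show ?thesis
    by cases (simp_all only: lax_coeff_simps split_def scaleC_pot_def vector_add_component vec_lambda_beta h1_apply_add h1_apply_scaleC,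
       (intro continuous_intros c f')+)
qed

lemma holomorphic_on_lax_coeff_param:
  assumes f: "f holomorphic_on S" and g: "g holomorphic_on S"
  shows "(\<lambda>x. lax_coeff (f x) (\<psi> + scaleC_pot (g x) h) i j t) holomorphic_on S"
proof -
  consider "i = 1" "j = 1" | "i = 1" "j = 2" | "i = 2" "j = 1" | "i = 2" "j = 2"
    using exhaust_2 by metis
  then show ?thesis
    by cases (simp_all only: lax_coeff_simps scaleC_pot_def vector_add_component vec_lambda_beta h1_apply_add h1_apply_scaleC,
       (intro holomorphic_intros f g)+)
qed

lemma continuous_on_lax_coeff: "continuous_on UNIV (lax_coeff z \<psi> i j)"
proof -
  have "continuous_on UNIV (\<lambda>t. (\<lambda>(t, x). lax_coeff z (\<psi> + scaleC_pot 0 0) i j t) (t, 0::complex))"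
    by (rule continuous_on_compose2[OF continuous_on_lax_coeff_param[of UNIV "\<lambda>_. z" "\<lambda>_. 0"]])
       (auto intro!: continuous_intros)
  then show ?thesis by simp
qed

lemma lax_solution_0: "lax_solution \<psi> z i j 0 = of_bool (i = j)"
  unfolding lax_solution_def by (rule linear_ode_solution_0[OF continuous_on_lax_coeff])

lemma lax_solution_has_vector_derivative:
  "(lax_solution \<psi> z i j has_vector_derivative
      lax_coeff z \<psi> i 1 t * lax_solution \<psi> z 1 j t + lax_coeff z \<psi> i 2 t * lax_solution \<psi> z 2 j t) (at t)"
  using linear_ode_solution_has_vector_derivative[of "lax_coeff z \<psi>" i j t, OF continuous_on_lax_coeff]
  by (simp add: lax_solution_def sum_2)

lemma has_vector_derivative_vec:
  fixes f :: "real \<Rightarrow> 'a::real_normed_vector ^ 'n::finite"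
  shows "(f has_vector_derivative f') (at t) \<longleftrightarrow> (\<forall>i. ((\<lambda>s. f s $ i) has_vector_derivative f' $ i) (at t))"
proof
  assume "(f has_vector_derivative f') (at t)"
  then show "\<forall>i. ((\<lambda>s. f s $ i) has_vector_derivative f' $ i) (at t)"
    using bounded_linear.has_vector_derivative[OF bounded_linear_vec_nth] by blast
next
  assume *: "\<forall>i. ((\<lambda>s. f s $ i) has_vector_derivative f' $ i) (at t)"
  have "((\<lambda>s. (1 / norm (s - t)) *\<^sub>R (f s - (f t + (s - t) *\<^sub>R f'))) \<longlongrightarrow> 0) (at t)"
  proof (rule vec_tendstoI)
    fix i
    have "((\<lambda>s. (1 / norm (s - t)) *\<^sub>R (f s $ i - (f t $ i + (s - t) *\<^sub>R f' $ i))) \<longlongrightarrow> 0) (at t)"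
      using * unfolding has_vector_derivative_def has_derivative_within by blast
    then show "((\<lambda>s. ((1 / norm (s - t)) *\<^sub>R (f s - (f t + (s - t) *\<^sub>R f'))) $ i) \<longlongrightarrow> 0 $ i) (at t)"
      by simp
  qed
  then show "(f has_vector_derivative f') (at t)"
    unfolding has_vector_derivative_def has_derivative_within by (simp add: bounded_linear_scaleR_left)
qed

text \<open>\<open>fundamental_solution\<close> is a definite description, so it acquires meaning
  only through existence and uniqueness together; both are read off entry by entry.\<close>

lemma fundamental_solution_nth: "fundamental_solution z \<psi> t $ i $ j = lax_solution \<psi> z i j t"
proof -
  define P where "P M \<longleftrightarrow> M 0 = mat 1 \<and> (\<forall>t. (M has_vector_derivative
             ((mat (- 2 * \<i> * z\<^sup>2) ** sigma3 + V t z \<psi>) ** M t)) (at t))" for M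
  define M0 where "M0 = (\<lambda>t. \<chi> i j. lax_solution \<psi> z i j t)"
  have P_iff: "P M \<longleftrightarrow> (\<forall>i j. M 0 $ i $ j = of_bool (i = j)) \<and> (\<forall>t i j. ((\<lambda>s. M s $ i $ j) has_vector_derivative
      (\<Sum>l\<in>UNIV. lax_coeff z \<psi> i l t * M t $ l $ j)) (at t))" for M
    unfolding P_def has_vector_derivative_vec
    by (auto simp: vec_eq_iff mat_def matrix_matrix_mult_def lax_coeff_def)
  have 1: "P M0"
    unfolding P_iff using lax_solution_0 lax_solution_has_vector_derivative by (simp add: M0_def sum_2)
  have 2: "M = M0" if "P M" for M
  proof -
    have "M t $ i $ j - M0 t $ i $ j = 0" for t i j
    proof (rule linear_ode_unique[OF continuous_on_lax_coeff[of z \<psi>], where v = "\<lambda>i t. M t $ i $ j - M0 t $ i $ j"])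
      show "((\<lambda>t. M t $ i $ j - M0 t $ i $ j) has_vector_derivative
         (\<Sum>l\<in>UNIV. lax_coeff z \<psi> i l t * (M t $ l $ j - M0 t $ l $ j))) (at t)" for i t
        unfolding right_diff_distrib sum_subtractf
        by (rule has_vector_derivative_diff) (use 1 that in \<open>simp_all only: P_iff\<close>)
      show "M 0 $ i $ j - M0 0 $ i $ j = 0" for i using 1 that by (simp add: P_iff)
    qed
    then show ?thesis by (simp add: fun_eq_iff vec_eq_iff)
  qed
  have "fundamental_solution z \<psi> = M0"
    unfolding fundamental_solution_def P_def[symmetric] by (rule the_equality) (fact 1 2)+
  then show ?thesis by (simp add: M0_def)
qed

lemma discr_eq: "discr \<psi> z = lax_solution \<psi> z 1 1 1 + lax_solution \<psi> z 2 2 1"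
  by (simp add: discr_def trace_def sum_2 fundamental_solution_nth)

lemma continuous_on_lax_solution_param:
  fixes f :: "'p::heine_borel \<Rightarrow> complex"
  assumes "open S" "continuous_on S f" "continuous_on S g"
  shows "continuous_on S (\<lambda>x. lax_solution (\<psi> + scaleC_pot (g x) h) (f x) i j t)"
  unfolding lax_solution_def
  by (rule continuous_on_linear_ode_solution_param[OF \<open>open S\<close> continuous_on_lax_coeff_param[OF assms(2,3)]])

lemma holomorphic_on_lax_solution_param:
  assumes "open S" "f holomorphic_on S" "g holomorphic_on S"
  shows "(\<lambda>x. lax_solution (\<psi> + scaleC_pot (g x) h) (f x) i j t) holomorphic_on S"
  unfolding lax_solution_def
  by (rule holomorphic_linear_ode_solution_param[OF \<open>open S\<close>
       continuous_on_lax_coeff_param holomorphic_on_lax_coeff_param])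
     (use assms holomorphic_on_imp_continuous_on in auto)

lemma exp_linear_has_vector_derivative:
  "((\<lambda>t. exp (c * of_real t)) has_vector_derivative c * exp (c * of_real t)) (at t)" for c :: complex and t :: real
proof -
  have "((\<lambda>u. exp (c * u)) has_field_derivative exp (c * of_real t) * c) (at (of_real t))"
    by (auto intro!: derivative_eq_intros)
  from has_vector_derivative_real_field[OF this] show ?thesis by (simp add: mult.commute)
qed

lemma discr_zero: "discr 0 z = 2 * cos (2 * z\<^sup>2)"
proof -
  define E where "E = (\<lambda>i j t. if i \<noteq> j then 0 else if i = (1::2) then exp (- 2 * \<i> * z\<^sup>2 * of_real t) else exp (2 * \<i> * z\<^sup>2 * of_real t))"
  have "lax_solution 0 z i j t - E i j t = 0" for i j t
  proof (rule linear_ode_unique[OF continuous_on_lax_coeff[of z 0], where v = "\<lambda>i t. lax_solution 0 z i j t - E i j t"])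
    show "((\<lambda>t. lax_solution 0 z i j t - E i j t) has_vector_derivative
         (\<Sum>l\<in>UNIV. lax_coeff z 0 i l t * (lax_solution 0 z l j t - E l j t))) (at t)" for i t
    proof -
      have "((\<lambda>t. E i j t) has_vector_derivative (\<Sum>l\<in>UNIV. lax_coeff z 0 i l t * E l j t)) (at t)"
        using exp_linear_has_vector_derivative[of "- 2 * \<i> * z\<^sup>2" t]
          exp_linear_has_vector_derivative[of "2 * \<i> * z\<^sup>2" t] exhaust_2[of i] exhaust_2[of j]
        unfolding E_def sum_2 by (auto simp: lax_coeff_simps)
      then show ?thesis
        unfolding right_diff_distrib sum_subtractf
        using lax_solution_has_vector_derivative[of 0 z i j t] unfolding sum_2
        by (intro has_vector_derivative_diff)
    qed
  qed (auto simp: lax_solution_0 E_def)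
  then have "discr 0 z = E 1 1 1 + E 2 2 1" by (simp add: discr_eq)
  then show ?thesis by (simp add: E_def cos_exp_eq mult_ac)
qed

text \<open>The coefficient matrix has trace zero (Liouville's formula).\<close>

lemma lax_solution_det:
  "lax_solution \<psi> z 1 1 t * lax_solution \<psi> z 2 2 t - lax_solution \<psi> z 1 2 t * lax_solution \<psi> z 2 1 t = 1"
proof -
  let ?f = "\<lambda>t. lax_solution \<psi> z 1 1 t * lax_solution \<psi> z 2 2 t - lax_solution \<psi> z 1 2 t * lax_solution \<psi> z 2 1 t"
  have "(?f has_vector_derivative 0) (at t)" for t
  proof -
    note d = lax_solution_has_vector_derivative[of \<psi> z _ _ t]
    have "(?f has_vector_derivative
        (lax_solution \<psi> z 1 1 t * (lax_coeff z \<psi> 2 1 t * lax_solution \<psi> z 1 2 t + lax_coeff z \<psi> 2 2 t * lax_solution \<psi> z 2 2 t)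
         + (lax_coeff z \<psi> 1 1 t * lax_solution \<psi> z 1 1 t + lax_coeff z \<psi> 1 2 t * lax_solution \<psi> z 2 1 t) * lax_solution \<psi> z 2 2 t)
        - (lax_solution \<psi> z 1 2 t * (lax_coeff z \<psi> 2 1 t * lax_solution \<psi> z 1 1 t + lax_coeff z \<psi> 2 2 t * lax_solution \<psi> z 2 1 t)
         + (lax_coeff z \<psi> 1 1 t * lax_solution \<psi> z 1 2 t + lax_coeff z \<psi> 1 2 t * lax_solution \<psi> z 2 2 t) * lax_solution \<psi> z 2 1 t)) (at t)"
      by (intro has_vector_derivative_diff has_vector_derivative_mult d)
    moreover have "lax_coeff z \<psi> 2 2 t = - lax_coeff z \<psi> 1 1 t" by (simp add: lax_coeff_simps)
    ultimately show ?thesis by (simp add: algebra_simps)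
  qed
  then have "(?f has_derivative (\<lambda>h. 0)) (at t within UNIV)" for t
    by (simp add: has_vector_derivative_def)
  from has_derivative_zero_constant[OF convex_UNIV this] obtain c where "\<And>t. ?f t = c" by auto
  then have "?f t = ?f 0" for t by metis
  then show ?thesis by (simp add: lax_solution_0)
qed

section \<open>Asymptotics for large spectral parameter\<close>

text \<open>
  The combination \<open>u - p v\<close> removes the large off-diagonal coefficient \<open>-2 S p\<close>; only an
  integration by parts in \<open>p\<close> is needed, so that one weak derivative suffices.
\<close>

lemma gauged_component_estimate:
  fixes S :: complex and u v a p q p' :: "real \<Rightarrow> complex"
  assumes u: "\<And>t. (u has_vector_derivative (S + a t) * u t - 2 * S * p t * v t) (at t)"
    and v: "\<And>t. (v has_vector_derivative - (2 * S * q t * u t) - (S + a t) * v t) (at t)"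
    and p: "h1_deriv_of p p'" and cp: "continuous_on UNIV p" and cq: "continuous_on UNIV q"
    and ca: "continuous_on UNIV a"
    and \<kappa>: "(LBINT t:{0..1}. cmod (a t + 2 * S * p t * q t) + cmod (p t * a t) + cmod (p' t)) \<le> \<kappa>"
    and m: "\<And>s. s \<in> {0..1} \<Longrightarrow> cmod (u s) \<le> m * exp (\<bar>Re S\<bar> * s)"
       "\<And>s. s \<in> {0..1} \<Longrightarrow> cmod (v s) \<le> m * exp (\<bar>Re S\<bar> * s)"
    and t: "t \<in> {0..1}"
  shows "cmod (u t - p t * v t - exp (S * t) * (u 0 - p 0 * v 0)) \<le> exp (\<bar>Re S\<bar> * t) * (\<kappa> * m)"
proof -
  have cu: "continuous_on A u" "continuous_on A v" for A
    by (intro continuous_at_imp_continuous_on ballI has_vector_derivative_continuous[OF u]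
         has_vector_derivative_continuous[OF v])+
  have cc: "continuous_on A a" "continuous_on A p" "continuous_on A q" for A
    using ca cp cq continuous_on_subset by blast+
  have "0 \<le> m" using order_trans[OF norm_ge_zero m(1)[of 0]] by simp
  \<comment> \<open>Integrating factor: \<open>x\<close> and \<open>w\<close> are the two components
    in the frame where the free motion of the first is at rest. There the second turns at rate
    \<open>2 * S\<close>.\<close>
  define e where "e = (\<lambda>s::real. exp (- S * of_real s))"
  have e: "(e has_vector_derivative - S * e s) (at s)" for s
    unfolding e_def by (rule exp_linear_has_vector_derivative)
  have ce: "continuous_on A e" for A unfolding e_def by (intro continuous_intros)
  define w where "w = (\<lambda>s. e s * v s)"
  define w' where "w' = (\<lambda>s. e s * (- (2 * S * q s * u s) - (2 * S + a s) * v s))"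
  define x where "x = (\<lambda>s. e s * u s)"
  define x' where "x' = (\<lambda>s. e s * (a s * u s - 2 * S * p s * v s))"
  have w: "(w has_vector_derivative w' s) (at s)" for s
    unfolding w_def w'_def
    by (rule has_vector_derivative_eq_rhs[OF has_vector_derivative_mult[OF e v]]) (simp add: algebra_simps)
  have x: "(x has_vector_derivative x' s) (at s)" for s
    unfolding x_def x'_def
    by (rule has_vector_derivative_eq_rhs[OF has_vector_derivative_mult[OF e u]]) (simp add: algebra_simps)
  have cw': "continuous_on A w'" and cx': "continuous_on A x'" for A
    unfolding w'_def x'_def by (intro continuous_intros cu cc ce)+
  have cw: "continuous_on A w" for A unfolding w_def by (intro continuous_intros cu ce)
  note pr = h1_deriv_of_product_rule[OF p t w cw']
  have X: "x t - x 0 = (LBINT s:{0..t}. x' s)"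
    unfolding set_lebesgue_integral_def using t
    by (intro integral_FTC_atLeastAtMost[symmetric] cx' has_vector_derivative_at_within[OF x]) auto
  have ix: "set_integrable lborel {0..t} x'" by (intro set_integrable_continuous_Icc cx')
  have ipw: "set_integrable lborel {0..t} (\<lambda>s. p' s * w s + p s * w' s)"
    by (intro set_integral_add pr(2) set_integrable_continuous_Icc continuous_intros cc cw')
  define k where "k = (\<lambda>s. cmod (a s + 2 * S * p s * q s) + cmod (p s * a s) + cmod (p' s))"
  have ik: "set_integrable lborel {0..1} k"
    unfolding k_def
    by (intro set_integral_add set_integrable_norm[OF h1_deriv_of_integrable[OF p]]
        set_integrable_continuous_Icc continuous_intros cc)
  have ik': "set_integrable lborel {0..t} k" using ik t by (auto elim!: set_integrable_subset)
  define f where "f = (\<lambda>s. exp (S * t) * (x' s - (p' s * w s + p s * w' s)))"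
  have if': "set_integrable lborel {0..t} f"
    unfolding f_def by (intro set_integrable_mult_right set_integral_diff ix ipw)
  \<comment> \<open>The large terms \<open>2 * S * p s * v s\<close> in \<open>x'\<close> and in
    \<open>p s * w' s\<close> cancel. The three coefficients left are exactly those controlled by
    \<kappa>, and all are of order \<open>1 / z\<close> in the application.\<close>
  have fe: "f s = exp (S * t) * e s * ((a s + 2 * S * p s * q s) * u s + (p s * a s) * v s - p' s * v s)" for s
    unfolding f_def x'_def w_def w'_def by (simp add: algebra_simps)
  have fle: "cmod (f s) \<le> exp (\<bar>Re S\<bar> * t) * m * k s" if s: "s \<in> {0..t}" for s
  proof -
    have s1: "s \<in> {0..1}" using s t by auto
    have "cmod (exp (S * t) * e s) = exp (Re S * (t - s))"
      by (simp add: e_def norm_mult exp_add[symmetric] algebra_simps)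
    also have "\<dots> \<le> exp (\<bar>Re S\<bar> * (t - s))"
      using s by (simp add: mult_right_mono)
    finally have 1: "cmod (exp (S * t) * e s) \<le> exp (\<bar>Re S\<bar> * (t - s))" .
    have "cmod ((a s + 2 * S * p s * q s) * u s + (p s * a s) * v s - p' s * v s)
       \<le> cmod (a s + 2 * S * p s * q s) * cmod (u s) + cmod (p s * a s) * cmod (v s) + cmod (p' s) * cmod (v s)"
      unfolding norm_mult[symmetric]
      by (rule order_trans[OF norm_triangle_ineq4 add_right_mono[OF norm_triangle_ineq]])
    also have "\<dots> \<le> cmod (a s + 2 * S * p s * q s) * (m * exp (\<bar>Re S\<bar> * s))
         + cmod (p s * a s) * (m * exp (\<bar>Re S\<bar> * s)) + cmod (p' s) * (m * exp (\<bar>Re S\<bar> * s))"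
      using m[OF s1] by (intro add_mono mult_left_mono) auto
    also have "\<dots> = exp (\<bar>Re S\<bar> * s) * (m * k s)" by (simp add: k_def algebra_simps)
    finally have 2: "cmod ((a s + 2 * S * p s * q s) * u s + (p s * a s) * v s - p' s * v s) \<le> exp (\<bar>Re S\<bar> * s) * (m * k s)" .
    have "cmod (f s) \<le> exp (\<bar>Re S\<bar> * (t - s)) * (exp (\<bar>Re S\<bar> * s) * (m * k s))"
      unfolding fe norm_mult[of "exp (S * t) * e s"] by (intro mult_mono 1 2) auto
    also have "\<dots> = (exp (\<bar>Re S\<bar> * (t - s)) * exp (\<bar>Re S\<bar> * s)) * m * k s"
      by (simp only: mult.assoc)
    also have "exp (\<bar>Re S\<bar> * (t - s)) * exp (\<bar>Re S\<bar> * s) = exp (\<bar>Re S\<bar> * t)"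
      unfolding exp_add[symmetric] by (simp add: algebra_simps)
    finally show ?thesis .
  qed
  have "u t - p t * v t - exp (S * t) * (u 0 - p 0 * v 0) = exp (S * t) * ((x t - x 0) - (p t * w t - p 0 * w 0))"
  proof -
    have 1: "exp (S * t) * e t = 1" "e 0 = 1"
      by (simp_all add: e_def mult_exp_exp)
    have "exp (S * t) * ((x t - x 0) - (p t * w t - p 0 * w 0)) =
      (exp (S * t) * e t) * (u t - p t * v t) - exp (S * t) * (e 0 * (u 0 - p 0 * v 0))"
      unfolding x_def w_def by (simp only: algebra_simps)
    then show ?thesis unfolding 1 by simp
  qed
  also have "(x t - x 0) - (p t * w t - p 0 * w 0) = (LBINT s:{0..t}. x' s - (p' s * w s + p s * w' s))"
    unfolding X pr(1) using ix ipw by (rule set_integral_diff(2)[symmetric])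
  also have "exp (S * t) * \<dots> = (LBINT s:{0..t}. f s)" by (simp add: f_def)
  finally have "cmod (u t - p t * v t - exp (S * t) * (u 0 - p 0 * v 0)) = cmod (LBINT s:{0..t}. f s)" by simp
  also have "\<dots> \<le> (LBINT s:{0..t}. cmod (f s))" by (rule set_integral_norm_bound[OF if'])
  also have "\<dots> \<le> (LBINT s:{0..t}. exp (\<bar>Re S\<bar> * t) * m * k s)"
    using ik' by (intro set_integral_mono set_integrable_norm[OF if'] fle) auto
  also have "\<dots> = exp (\<bar>Re S\<bar> * t) * m * (LBINT s:{0..t}. k s)" by simp
  also have "\<dots> \<le> exp (\<bar>Re S\<bar> * t) * m * \<kappa>"
  proof (intro mult_left_mono)
    have "(LBINT s:{0..t}. k s) \<le> (LBINT s:{0..1}. k s)"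
      unfolding set_lebesgue_integral_def using t
      by (intro integral_mono ik[unfolded set_integrable_def] ik'[unfolded set_integrable_def])
         (auto simp: indicator_def k_def)
    then show "(LBINT s:{0..t}. k s) \<le> \<kappa>" using \<kappa> by (simp add: k_def)
  qed (use \<open>0 \<le> m\<close> in auto)
  finally show ?thesis by (simp add: mult_ac)
qed

text \<open>A self-improving bound. Let \<open>m\<close> be the maximum over the unit interval of
  both components, weighted by \<open>exp (- (\<bar>Re S\<bar> * s))\<close>. The gauged estimates
  give \<open>m \<le> \<kappa> * m + P * m + (1 + P)\<close>, and since \<kappa> and
  \<open>P\<close> are at most \<open>1 / 4\<close> the terms with \<open>m\<close> are absorbed: m
  is at most \<open>5 / 2\<close>. Inserted again, this leaves only errors proportional to
  \<open>\<kappa> + P\<close>.\<close>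

lemma column_estimate:
  fixes S :: complex and u v a p q p' q' :: "real \<Rightarrow> complex"
  assumes u: "\<And>t. (u has_vector_derivative (S + a t) * u t - 2 * S * p t * v t) (at t)"
    and v: "\<And>t. (v has_vector_derivative - (2 * S * q t * u t) - (S + a t) * v t) (at t)"
    and p: "h1_deriv_of p p'" and q: "h1_deriv_of q q'" and cp: "continuous_on UNIV p" and cq: "continuous_on UNIV q"
    and ca: "continuous_on UNIV a"
    and \<kappa>p: "(LBINT t:{0..1}. cmod (a t + 2 * S * p t * q t) + cmod (p t * a t) + cmod (p' t)) \<le> \<kappa>"
    and \<kappa>q: "(LBINT t:{0..1}. cmod (a t + 2 * S * p t * q t) + cmod (q t * a t) + cmod (q' t)) \<le> \<kappa>"
    and P: "\<And>t. cmod (p t) \<le> P" "\<And>t. cmod (q t) \<le> P" and "P \<le> 1 / 4" "\<kappa> \<le> 1 / 4"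
    and i: "cmod (u 0) \<le> 1" "cmod (v 0) \<le> 1"
  shows "cmod (u 1 - exp S * u 0) \<le> 4 * exp \<bar>Re S\<bar> * (\<kappa> + P)"
    and "cmod (v 1 - exp (- S) * v 0) \<le> 4 * exp \<bar>Re S\<bar> * (\<kappa> + P)"
proof -
  have cu: "continuous_on A u" "continuous_on A v" for A
    by (intro continuous_at_imp_continuous_on ballI has_vector_derivative_continuous[OF u]
         has_vector_derivative_continuous[OF v])+
  define X where "X = (\<lambda>s. max (cmod (u s)) (cmod (v s)) * exp (- (\<bar>Re S\<bar> * s)))"
  have "continuous_on {0..1} X" unfolding X_def by (intro continuous_intros cu)
  then obtain s0 where s0: "s0 \<in> {0..1}" "\<And>s. s \<in> {0..1} \<Longrightarrow> X s \<le> X s0"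
    using continuous_attains_sup[of "{0..1}" X] by auto
  define m where "m = X s0"
  have mx: "max (cmod (u s)) (cmod (v s)) \<le> m * exp (\<bar>Re S\<bar> * s)" if "s \<in> {0..1}" for s
  proof -
    have "max (cmod (u s)) (cmod (v s)) = X s * exp (\<bar>Re S\<bar> * s)"
      unfolding X_def mult.assoc exp_add[symmetric] by simp
    then show ?thesis using s0(2)[OF that] by (simp only: m_def mult_right_mono exp_ge_zero)
  qed
  have m: "cmod (u s) \<le> m * exp (\<bar>Re S\<bar> * s)" "cmod (v s) \<le> m * exp (\<bar>Re S\<bar> * s)" if "s \<in> {0..1}" for s
    using mx[OF that] by auto
  have m0: "0 \<le> m" by (simp add: m_def X_def le_max_iff_disj)
  have P0: "0 \<le> P" using P(1)[of 0] norm_ge_zero order_trans by blast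
  have \<kappa>0: "0 \<le> \<kappa>"
  proof -
    have "0 \<le> (LBINT t:{0..1}. cmod (a t + 2 * S * p t * q t) + cmod (p t * a t) + cmod (p' t))"
      unfolding set_lebesgue_integral_def by (intro Bochner_Integration.integral_nonneg) auto
    then show ?thesis using \<kappa>p by simp
  qed
  have 1: "cmod (u t - p t * v t - exp (S * t) * (u 0 - p 0 * v 0)) \<le> exp (\<bar>Re S\<bar> * t) * (\<kappa> * m)"
    if "t \<in> {0..1}" for t
    by (rule gauged_component_estimate[OF u v p cp cq ca \<kappa>p m that])
  have 2: "cmod (v t + q t * u t - exp (- S * t) * (v 0 + q 0 * u 0)) \<le> exp (\<bar>Re S\<bar> * t) * (\<kappa> * m)"
    if "t \<in> {0..1}" for t
  proof -
    \<comment> \<open>The system is invariant under exchanging \<open>u\<close> with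
      \<open>v\<close> and replacing \<open>S\<close>, \<open>a\<close>, \<open>p\<close>,
      \<open>q\<close> by \<open>- S\<close>, \<open>- a\<close>, \<open>- q\<close>,
      \<open>- p\<close>, so the second component needs no new computation.\<close>
    have q': "h1_deriv_of (\<lambda>t. - q t) (\<lambda>t. - q' t)"
      using h1_deriv_of_mult[OF q, of "-1"] by simp
    have "cmod (v t - (- q t) * u t - exp (- S * t) * (v 0 - (- q 0) * u 0)) \<le> exp (\<bar>Re (- S)\<bar> * t) * (\<kappa> * m)"
    proof (rule gauged_component_estimate[where u = v and v = u and a = "\<lambda>t. - a t" and q = "\<lambda>t. - p t", OF _ _ q' _ _ _ _ _ _ that])
      show "(v has_vector_derivative (- S + - a t) * v t - 2 * (- S) * (- q t) * u t) (at t)" for t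
        by (rule has_vector_derivative_eq_rhs[OF v]) (simp add: algebra_simps)
      show "(u has_vector_derivative - (2 * (- S) * (- p t) * v t) - (- S + - a t) * u t) (at t)" for t
        by (rule has_vector_derivative_eq_rhs[OF u]) (simp add: algebra_simps)
      have "cmod (- a t + 2 * - S * - q t * - p t) = cmod (a t + 2 * S * p t * q t)" for t
        using norm_minus_cancel[of "a t + 2 * S * p t * q t"] by (simp add: algebra_simps)
      then show "(LBINT t:{0..1}. cmod (- a t + 2 * - S * - q t * - p t) + cmod (- q t * - a t) + cmod (- q' t)) \<le> \<kappa>"
        using \<kappa>q by simp
    qed (use cp cq ca m in \<open>auto intro: continuous_intros\<close>)
    then show ?thesis by simp
  qed
  have eb: "cmod (exp (S * t)) \<le> exp (\<bar>Re S\<bar> * t)" "cmod (exp (- S * t)) \<le> exp (\<bar>Re S\<bar> * t)" if "t \<in> {0..1}" for t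
    using that mult_right_mono[of "Re S" "\<bar>Re S\<bar>" t] mult_right_mono[of "- Re S" "\<bar>Re S\<bar>" t] by auto
  have pm: "cmod (r * y) \<le> P * (m * E)" if "cmod r \<le> P" "cmod y \<le> m * E" for r y E
    unfolding norm_mult using that P0 by (intro mult_mono) auto
  have im: "cmod (x * (y + r * z)) \<le> E * (1 + P)" if "cmod x \<le> E" "cmod y \<le> 1" "cmod r \<le> P" "cmod z \<le> 1" for x y z r E
  proof -
    have "cmod (y + r * z) \<le> 1 + P * 1"
      using that P0 by (intro order_trans[OF norm_triangle_ineq] add_mono) (auto simp only: norm_mult intro!: mult_mono norm_ge_zero)
    then show ?thesis unfolding norm_mult using that by (intro mult_mono order_trans[OF norm_ge_zero that(1)]) auto
  qed
  have tri: "cmod x \<le> A + B + C" if "cmod (x + y - z) \<le> A" "cmod y \<le> B" "cmod z \<le> C" for x y z A B C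
  proof -
    have "cmod x = cmod ((x + y - z) - y + z)" by simp
    also have "\<dots> \<le> cmod (x + y - z) + cmod y + cmod z"
      by (rule order_trans[OF norm_triangle_ineq]) (intro add_right_mono norm_triangle_ineq4)
    finally show ?thesis using that by simp
  qed
  have key: "max (cmod (u t)) (cmod (v t)) \<le> exp (\<bar>Re S\<bar> * t) * (\<kappa> * m + P * m + (1 + P))" if t: "t \<in> {0..1}" for t
  proof -
    have "cmod (u t) \<le> exp (\<bar>Re S\<bar> * t) * (\<kappa> * m) + P * (m * exp (\<bar>Re S\<bar> * t)) + exp (\<bar>Re S\<bar> * t) * (1 + P)"
    proof (rule tri)
      show "cmod (u t + - p t * v t - exp (S * t) * (u 0 + - p 0 * v 0)) \<le> exp (\<bar>Re S\<bar> * t) * (\<kappa> * m)"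
        using 1[OF t] by simp
      show "cmod (- p t * v t) \<le> P * (m * exp (\<bar>Re S\<bar> * t))" using m(2)[OF t] P(1) by (intro pm) auto
      show "cmod (exp (S * t) * (u 0 + - p 0 * v 0)) \<le> exp (\<bar>Re S\<bar> * t) * (1 + P)"
        using P(1) i by (intro im eb(1)[OF t]) auto
    qed
    moreover have "cmod (v t) \<le> exp (\<bar>Re S\<bar> * t) * (\<kappa> * m) + P * (m * exp (\<bar>Re S\<bar> * t)) + exp (\<bar>Re S\<bar> * t) * (1 + P)"
    proof (rule tri)
      show "cmod (v t + q t * u t - exp (- S * t) * (v 0 + q 0 * u 0)) \<le> exp (\<bar>Re S\<bar> * t) * (\<kappa> * m)"
        using 2[OF t] by simp
      show "cmod (q t * u t) \<le> P * (m * exp (\<bar>Re S\<bar> * t))" using m(1)[OF t] P(2) by (intro pm) auto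
      show "cmod (exp (- S * t) * (v 0 + q 0 * u 0)) \<le> exp (\<bar>Re S\<bar> * t) * (1 + P)"
        using P(2) i by (intro im eb(2)[OF t]) auto
    qed
    ultimately show ?thesis by (simp add: algebra_simps)
  qed
  have "m \<le> \<kappa> * m + P * m + (1 + P)"
  proof -
    have "m \<le> exp (\<bar>Re S\<bar> * s0) * (\<kappa> * m + P * m + (1 + P)) * exp (- (\<bar>Re S\<bar> * s0))"
      using key[OF s0(1)] by (simp only: m_def[unfolded X_def] mult_right_mono exp_ge_zero)
    also have "\<dots> = (exp (\<bar>Re S\<bar> * s0) * exp (- (\<bar>Re S\<bar> * s0))) * (\<kappa> * m + P * m + (1 + P))"
      by (simp only: mult_ac)
    finally show ?thesis by (simp add: exp_add[symmetric])
  qed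
  moreover have "\<kappa> * m \<le> 1 / 4 * m" "P * m \<le> 1 / 4 * m" using m0 assms(12,13) by (intro mult_right_mono; simp)+
  ultimately have m52: "m \<le> 5 / 2" using \<open>P \<le> 1 / 4\<close> by linarith
  \<comment> \<open>\<kappa> occurs with factor \<open>5 / 2\<close>; \<open>P\<close> occurs with
    \<open>5 / 2\<close> at time \<open>1\<close> and with \<open>1\<close> at time
    \<open>0\<close>. Hence \<open>4\<close> suffices for both.\<close>
  have fin: "exp \<bar>Re S\<bar> * (\<kappa> * m) + P * (m * exp \<bar>Re S\<bar>) + exp \<bar>Re S\<bar> * P \<le> 4 * exp \<bar>Re S\<bar> * (\<kappa> + P)"
  proof -
    have "\<kappa> * m \<le> 5 / 2 * \<kappa>" "P * m \<le> 5 / 2 * P"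
      using mult_left_mono[OF m52 \<kappa>0] mult_left_mono[OF m52 P0] by simp_all
    then have "\<kappa> * m + P * m + P \<le> 5 / 2 * \<kappa> + 5 / 2 * P + P" by (intro add_mono) auto
    also have "\<dots> \<le> 4 * (\<kappa> + P)" using \<kappa>0 P0 by simp
    finally have "\<kappa> * m + P * m + P \<le> 4 * (\<kappa> + P)" .
    then have "exp \<bar>Re S\<bar> * (\<kappa> * m + P * m + P) \<le> exp \<bar>Re S\<bar> * (4 * (\<kappa> + P))" by (intro mult_left_mono) auto
    then show ?thesis by (simp add: algebra_simps)
  qed
  have ip: "cmod (x * (r * z)) \<le> E * P" if "cmod x \<le> E" "cmod r \<le> P" "cmod z \<le> 1" for x r z E
  proof -
    have "cmod (r * z) \<le> P * 1" unfolding norm_mult using that P0 by (intro mult_mono) auto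
    then show ?thesis unfolding norm_mult[of x] using that by (intro mult_mono order_trans[OF norm_ge_zero that(1)]) auto
  qed
  have "cmod (u 1 - exp S * u 0) \<le> exp \<bar>Re S\<bar> * (\<kappa> * m) + P * (m * exp \<bar>Re S\<bar>) + exp \<bar>Re S\<bar> * P"
  proof (rule tri)
    have "u 1 - exp S * u 0 + - p 1 * v 1 - exp S * (- p 0 * v 0) = u 1 - p 1 * v 1 - exp (S * of_real 1) * (u 0 - p 0 * v 0)"
      by (simp add: algebra_simps)
    from arg_cong[OF this, of cmod] show "cmod (u 1 - exp S * u 0 + - p 1 * v 1 - exp S * (- p 0 * v 0)) \<le> exp \<bar>Re S\<bar> * (\<kappa> * m)"
      using 1[of 1] by simp
    show "cmod (- p 1 * v 1) \<le> P * (m * exp \<bar>Re S\<bar>)" using m(2)[of 1] P(1) by (intro pm) auto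
    show "cmod (exp S * (- p 0 * v 0)) \<le> exp \<bar>Re S\<bar> * P" using eb(1)[of 1] P(1) i(2) by (intro ip) auto
  qed
  then show "cmod (u 1 - exp S * u 0) \<le> 4 * exp \<bar>Re S\<bar> * (\<kappa> + P)" using fin by linarith
  have "cmod (v 1 - exp (- S) * v 0) \<le> exp \<bar>Re S\<bar> * (\<kappa> * m) + P * (m * exp \<bar>Re S\<bar>) + exp \<bar>Re S\<bar> * P"
  proof (rule tri)
    have "v 1 - exp (- S) * v 0 + q 1 * u 1 - exp (- S) * (q 0 * u 0) = v 1 + q 1 * u 1 - exp (- S * of_real 1) * (v 0 + q 0 * u 0)"
      by (simp add: algebra_simps)
    from arg_cong[OF this, of cmod] show "cmod (v 1 - exp (- S) * v 0 + q 1 * u 1 - exp (- S) * (q 0 * u 0)) \<le> exp \<bar>Re S\<bar> * (\<kappa> * m)"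
      using 2[of 1] by simp
    show "cmod (q 1 * u 1) \<le> P * (m * exp \<bar>Re S\<bar>)" using m(1)[of 1] P(2) by (intro pm) auto
    show "cmod (exp (- S) * (q 0 * u 0)) \<le> exp \<bar>Re S\<bar> * P" using eb(2)[of 1] P(2) i(1) by (intro ip) auto
  qed
  then show "cmod (v 1 - exp (- S) * v 0) \<le> 4 * exp \<bar>Re S\<bar> * (\<kappa> + P)" using fin by linarith
qed

text \<open>The modulus of the larger of the two free exponentials at time \<open>1\<close>, the
  natural unit for all errors.\<close>

definition growth :: "complex \<Rightarrow> real" where
  "growth z = exp \<bar>Im (2 * z\<^sup>2)\<bar>"

lemma growth_ge_1: "1 \<le> growth z" by (simp add: growth_def)

lemma norm_exp_le_growth:
  "cmod (exp (- 2 * \<i> * z\<^sup>2)) \<le> growth z" "cmod (exp (2 * \<i> * z\<^sup>2)) \<le> growth z"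
  by (simp_all add: growth_def)

lemma norm_pot_nth_le: "norm (\<psi> $ k) \<le> norm (\<psi> :: pot)"
  by (rule Finite_Cartesian_Product.norm_nth_le)

lemma norm_pot_apply_le: "cmod (h1_apply (\<psi> $ k) t) \<le> 2 * norm (\<psi> :: pot)"
  using norm_h1_apply_le[of "\<psi> $ k" t] norm_pot_nth_le[of \<psi> k] by linarith

text \<open>
  The gauge functions \<open>p = V\<^sub>1\<^sub>2 / (4 \<i> z\<^sup>2)\<close> and \<open>q = V\<^sub>2\<^sub>1 / (4 \<i> z\<^sup>2)\<close>; with them the
  diagonal of \<open>V\<close> is cancelled up to order \<open>1 / z\<close>.
\<close>

lemma lax_solution_asymptotics_large:
  fixes \<psi> :: pot
  assumes R: "norm \<psi> \<le> R" and z: "cmod z \<ge> 1" "cmod z \<ge> 4 * C" and C: "C = 5 * R\<^sup>2 + 8 * R ^ 3 + 2 * R"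
  shows "cmod (lax_solution \<psi> z 1 j 1 - exp (- 2 * \<i> * z\<^sup>2) * of_bool (1 = j)) \<le> 8 * growth z * C / cmod z"
    and "cmod (lax_solution \<psi> z 2 j 1 - exp (2 * \<i> * z\<^sup>2) * of_bool (2 = j)) \<le> 8 * growth z * C / cmod z"
proof -
  have R0: "0 \<le> R" using R norm_ge_zero order_trans by blast
  have C0: "0 \<le> C" using R0 by (simp add: C)
  have z0: "z \<noteq> 0" using z by auto
  define S where "S = - 2 * \<i> * z\<^sup>2"
  have S0: "S \<noteq> 0" using z0 by (simp add: S_def)
  define x where "x = (\<lambda>k t. h1_apply (\<psi> $ k) t)"
  have x: "cmod (x k t) \<le> 2 * R" for k t
    using norm_pot_apply_le[of \<psi> k t] R unfolding x_def by linarith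
  \<comment> \<open>The gauge functions are built as elements of \<open>h1\<close>, so that weak
    derivative, sup bound and norm come from the space.\<close>
  define pf where "pf = scaleC_h1 (1 / (2 * \<i> * z)) (\<psi> $ 1) + scaleC_h1 (1 / (4 * z\<^sup>2)) (\<psi> $ 3)"
  define qf where "qf = scaleC_h1 (1 / (2 * \<i> * z)) (\<psi> $ 2) + scaleC_h1 (- 1 / (4 * z\<^sup>2)) (\<psi> $ 4)"
  define p where "p = h1_apply pf"
  define q where "q = h1_apply qf"
  define a where "a = (\<lambda>t. - \<i> * x 1 t * x 2 t)"
  have z2: "1 / (cmod z)\<^sup>2 \<le> 1 / cmod z"
    using z by (intro frac_le) (auto simp: power2_eq_square mult_le_cancel_left1)
  have z4: "1 / (4 * (cmod z)\<^sup>2) \<le> 1 / (2 * cmod z)"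
    using mult_mono[of "1 / 4" "1 / 2", OF _ z2] by simp
  have nf: "norm (scaleC_h1 (1 / (2 * \<i> * z)) f + scaleC_h1 c g) \<le> R / cmod z"
    if "norm f \<le> R" "norm g \<le> R" "cmod c = 1 / (4 * (cmod z)\<^sup>2)" for f g c
  proof -
    have "norm (scaleC_h1 (1 / (2 * \<i> * z)) f + scaleC_h1 c g) \<le> 1 / (2 * cmod z) * norm f + cmod c * norm g"
      by (rule order_trans[OF norm_triangle_ineq]) (simp add: norm_scaleC_h1 norm_divide norm_mult)
    also have "\<dots> \<le> 1 / (2 * cmod z) * R + (1 / 2 * (1 / cmod z)) * R"
      using that z4 R0 by (intro add_mono mult_mono) auto
    finally show ?thesis by simp
  qed
  have npf: "norm pf \<le> R / cmod z" "norm qf \<le> R / cmod z"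
    unfolding pf_def qf_def using order_trans[OF norm_pot_nth_le R]
    by (intro nf; simp add: norm_divide norm_mult norm_power)+
  have p: "p t = (2 * z * x 1 t + \<i> * x 3 t) / (4 * \<i> * z\<^sup>2)" and q: "q t = (2 * z * x 2 t - \<i> * x 4 t) / (4 * \<i> * z\<^sup>2)" for t
    using z0 by (simp_all add: p_def q_def pf_def qf_def x_def field_simps power2_eq_square)
  \<comment> \<open>One constant for three purposes: \<open>5 * R\<^sup>2\<close> and
    \<open>8 * R ^ 3\<close> come from the two coefficients with \<open>a\<close>, while
    \<open>2 * R\<close> covers both the sup bound of \<open>p\<close> and \<open>q\<close> and the
    norm of their derivatives. The assumption on \<open>z\<close> makes \<open>P\<close> at most
    \<open>1 / 4\<close>.\<close>
  define P where "P = C / cmod z"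
  have P4: "P \<le> 1 / 4" using z z0 by (simp add: P_def field_simps)
  have RC: "2 * R \<le> C" using R0 by (simp add: C)
  have pP: "cmod (p t) \<le> P" "cmod (q t) \<le> P" for t
  proof -
    have "2 * (R / cmod z) \<le> P" using divide_right_mono[OF RC, of "cmod z"] by (simp add: P_def)
    then show "cmod (p t) \<le> P" "cmod (q t) \<le> P"
      using norm_h1_apply_le[of pf t] norm_h1_apply_le[of qf t] npf unfolding p_def q_def by linarith+
  qed
  have pR: "cmod (p t) \<le> 2 * R / cmod z" "cmod (q t) \<le> 2 * R / cmod z" for t
    using norm_h1_apply_le[of pf t] norm_h1_apply_le[of qf t] npf unfolding p_def q_def by simp_all
  have xx: "cmod (x k t * x l t) \<le> 4 * R\<^sup>2" for k l t
  proof -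
    have "cmod (x k t * x l t) \<le> (2 * R) * (2 * R)" unfolding norm_mult using x R0 by (intro mult_mono) auto
    then show ?thesis by (simp add: power2_eq_square)
  qed
  \<comment> \<open>The leading part of \<open>2 * S * p t * q t\<close> is
    \<open>\<i> * x 1 t * x 2 t\<close>, that is \<open>- a t\<close>. What survives has at least
    one factor \<open>1 / z\<close>, and \<open>5\<close> is \<open>2 + 2 + 1\<close> from the three
    terms.\<close>
  have rho: "cmod (a t + 2 * S * p t * q t) \<le> 5 * R\<^sup>2 / cmod z" for t
  proof -
    have "a t + 2 * S * p t * q t = (1 / (2 * z)) * (x 1 t * x 4 t) - (1 / (2 * z)) * (x 2 t * x 3 t) + (\<i> / (4 * z\<^sup>2)) * (x 3 t * x 4 t)"
      unfolding p q a_def S_def using z0 by (simp add: field_simps power2_eq_square)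
    also have "cmod \<dots> \<le> 1 / (2 * cmod z) * (4 * R\<^sup>2) + 1 / (2 * cmod z) * (4 * R\<^sup>2) + 1 / (4 * (cmod z)\<^sup>2) * (4 * R\<^sup>2)"
      by (rule order_trans[OF norm_triangle_ineq], intro add_mono, rule order_trans[OF norm_triangle_ineq4], intro add_mono)
         (unfold norm_mult[of "_ / _"], (intro mult_mono xx; simp add: norm_divide norm_mult norm_power)+)
    also have "\<dots> \<le> 4 * R\<^sup>2 * (1 / cmod z) + R\<^sup>2 * (1 / cmod z)"
      using mult_left_mono[OF z2, of "R\<^sup>2"] by simp
    finally show ?thesis by simp
  qed
  have aR: "cmod (a t) \<le> 4 * R\<^sup>2" for t using xx[of 1 t 2] by (simp add: a_def norm_mult mult.assoc)
  have ca: "continuous_on A a" for A unfolding a_def x_def by (intro continuous_intros continuous_on_h1_apply)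
  have int: "(LBINT t:{0..1}. cmod (a t + 2 * S * p t * q t) + cmod (h1_apply f t * a t) + cmod (h1_deriv f t)) \<le> P"
    if f: "norm f \<le> R / cmod z" for f
  proof -
    have i: "set_integrable lborel {0..1} (\<lambda>t. cmod (a t + 2 * S * p t * q t) + cmod (h1_apply f t * a t))"
      unfolding p_def q_def by (intro set_integrable_continuous_Icc continuous_intros continuous_on_h1_apply ca)
    have "(LBINT t:{0..1}. cmod (a t + 2 * S * p t * q t) + cmod (h1_apply f t * a t) + cmod (h1_deriv f t))
      = (LBINT t:{0..1}. cmod (a t + 2 * S * p t * q t) + cmod (h1_apply f t * a t)) + (LBINT t:{0..1}. cmod (h1_deriv f t))"
      by (rule set_integral_add(2)[OF i set_integrable_norm_h1_deriv])
    also have "\<dots> \<le> (LBINT t:{0..1::real}. 5 * R\<^sup>2 / cmod z + 8 * R ^ 3 / cmod z) + R / cmod z"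
    proof (intro add_mono set_integral_mono i)
      show "set_integrable lborel {0..1::real} (\<lambda>t. 5 * R\<^sup>2 / cmod z + 8 * R ^ 3 / cmod z)"
        by (intro set_integrable_continuous_Icc continuous_intros)
      show "cmod (a t + 2 * S * p t * q t) \<le> 5 * R\<^sup>2 / cmod z" for t by (rule rho)
      show "cmod (h1_apply f t * a t) \<le> 8 * R ^ 3 / cmod z" for t
      proof -
        have "cmod (h1_apply f t * a t) \<le> (2 * (R / cmod z)) * (4 * R\<^sup>2)"
          unfolding norm_mult using R0 f norm_h1_apply_le[of f t] by (intro mult_mono aR) auto
        then show ?thesis by (simp add: power2_eq_square power3_eq_cube)
      qed
      show "(LBINT t:{0..1}. cmod (h1_deriv f t)) \<le> R / cmod z"
        using set_integral_norm_h1_deriv_le[of f] f by linarith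
    qed
    also have "\<dots> = (5 * R\<^sup>2 + 8 * R ^ 3 + R) / cmod z"
      by (simp add: set_integral_const_unit_interval add_divide_distrib)
    also have "\<dots> \<le> P" unfolding P_def C using R0 by (intro divide_right_mono) auto
    finally show ?thesis .
  qed
  have coeff: "lax_coeff z \<psi> 1 1 t = S + a t" "lax_coeff z \<psi> 1 2 t = - 2 * S * p t"
     "lax_coeff z \<psi> 2 1 t = - 2 * S * q t" "lax_coeff z \<psi> 2 2 t = - (S + a t)" for t
    unfolding lax_coeff_simps p q S_def a_def x_def using z0 by (simp_all add: field_simps)
  have ReS: "\<bar>Re S\<bar> = \<bar>Im (2 * z\<^sup>2)\<bar>" by (simp add: S_def)
  let ?u = "lax_solution \<psi> z 1 j" and ?v = "lax_solution \<psi> z 2 j"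
  have u: "(?u has_vector_derivative (S + a t) * ?u t - 2 * S * p t * ?v t) (at t)" for t
    by (rule has_vector_derivative_eq_rhs[OF lax_solution_has_vector_derivative]) (simp add: coeff algebra_simps)
  have v: "(?v has_vector_derivative - (2 * S * q t * ?u t) - (S + a t) * ?v t) (at t)" for t
    by (rule has_vector_derivative_eq_rhs[OF lax_solution_has_vector_derivative]) (simp add: coeff algebra_simps)
  have i: "cmod (?u 0) \<le> 1" "cmod (?v 0) \<le> 1" by (simp_all add: lax_solution_0)
  note ce = column_estimate[OF u v h1_deriv[of pf, folded p_def] h1_deriv[of qf, folded q_def]
     continuous_on_h1_apply[of _ pf, folded p_def] continuous_on_h1_apply[of _ qf, folded q_def] ca
     int[OF npf(1), folded p_def] int[OF npf(2), folded q_def] pP P4 P4 i]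
  have e: "4 * exp \<bar>Re S\<bar> * (P + P) = 8 * growth z * C / cmod z" by (simp add: growth_def ReS P_def)
  show "cmod (lax_solution \<psi> z 1 j 1 - exp (- 2 * \<i> * z\<^sup>2) * of_bool (1 = j)) \<le> 8 * growth z * C / cmod z"
    using ce(1) unfolding e lax_solution_0 unfolding S_def .
  have "- S = 2 * \<i> * z\<^sup>2" by (simp add: S_def)
  then show "cmod (lax_solution \<psi> z 2 j 1 - exp (2 * \<i> * z\<^sup>2) * of_bool (2 = j)) \<le> 8 * growth z * C / cmod z"
    using ce(2) unfolding e lax_solution_0 by (simp only:)
qed

lemma norm_lax_coeff_le:
  fixes \<psi> :: pot
  assumes "norm \<psi> \<le> R" "cmod z \<le> L"
  shows "cmod (lax_coeff z \<psi> i j t) \<le> 2 * L\<^sup>2 + 4 * R\<^sup>2 + 4 * L * R + 2 * R"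
proof -
  have R0: "0 \<le> R" "0 \<le> L" using assms norm_ge_zero order_trans by blast+
  define x where "x = (\<lambda>k t. h1_apply (\<psi> $ k) t)"
  have x: "cmod (x k t) \<le> 2 * R" for k t
    using norm_pot_apply_le[of \<psi> k t] assms(1) unfolding x_def by linarith
  have zx: "cmod (2 * z * x k t) \<le> 4 * L * R" for k t
  proof -
    have "cmod (2 * z * x k t) \<le> (2 * L) * (2 * R)" unfolding norm_mult using x assms R0 by (intro mult_mono) auto
    then show ?thesis by simp
  qed
  have xx: "cmod (\<i> * x k t * x l t) \<le> 4 * R\<^sup>2" for k l t
  proof -
    have "cmod (x k t * x l t) \<le> (2 * R) * (2 * R)" unfolding norm_mult using x R0 by (intro mult_mono) auto
    then show ?thesis by (simp add: power2_eq_square norm_mult)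
  qed
  have zz: "cmod (2 * \<i> * z\<^sup>2) \<le> 2 * L\<^sup>2"
    using assms power_mono[of "cmod z" L 2] by (simp add: norm_mult norm_power)
  have ix: "cmod (\<i> * x k t) \<le> 2 * R" for k t using x[of k t] by (simp add: norm_mult)
  have LR: "0 \<le> L * R" using R0 by simp
  consider "i = 1" "j = 1" | "i = 1" "j = 2" | "i = 2" "j = 1" | "i = 2" "j = 2"
    using exhaust_2 by metis
  then show ?thesis
  proof cases
    case 1
    have "lax_coeff z \<psi> i j t = - (2 * \<i> * z\<^sup>2) - \<i> * x 1 t * x 2 t" by (simp add: 1 lax_coeff_simps x_def)
    then show ?thesis
      using norm_triangle_ineq4[of "- (2 * \<i> * z\<^sup>2)" "\<i> * x 1 t * x 2 t"] zz xx[of 1 t 2] LR R0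
      by (simp only: norm_minus_cancel)
  next
    case 2
    have "lax_coeff z \<psi> i j t = 2 * z * x 1 t + \<i> * x 3 t" by (simp add: 2 lax_coeff_simps x_def)
    then show ?thesis
      using norm_triangle_ineq[of "2 * z * x 1 t" "\<i> * x 3 t"] zx[of 1 t] ix[of 3 t] R0 zero_le_power2[of L] zero_le_power2[of R]
      by (simp only:)
  next
    case 3
    have "lax_coeff z \<psi> i j t = 2 * z * x 2 t - \<i> * x 4 t" by (simp add: 3 lax_coeff_simps x_def)
    then show ?thesis
      using norm_triangle_ineq4[of "2 * z * x 2 t" "\<i> * x 4 t"] zx[of 2 t] ix[of 4 t] R0 zero_le_power2[of L] zero_le_power2[of R]
      by (simp only:)
  next
    case 4
    have "lax_coeff z \<psi> i j t = 2 * \<i> * z\<^sup>2 + \<i> * x 1 t * x 2 t" by (simp add: 4 lax_coeff_simps x_def)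
    then show ?thesis
      using norm_triangle_ineq[of "2 * \<i> * z\<^sup>2" "\<i> * x 1 t * x 2 t"] zz xx[of 1 t 2] LR R0
      by (simp only:)
  qed
qed

text \<open>A crude bound for the compact set of spectral parameters below the threshold of the
  asymptotics; the outer \<open>2\<close> is the size of the matrix.\<close>

lemma norm_lax_solution_le:
  fixes \<psi> :: pot
  assumes "norm \<psi> \<le> R" "cmod z \<le> L"
  shows "cmod (lax_solution \<psi> z i j 1) \<le> exp (2 * (2 * L\<^sup>2 + 4 * R\<^sup>2 + 4 * L * R + 2 * R))"
  using norm_linear_ode_solution_le[OF continuous_on_lax_coeff norm_lax_coeff_le[OF assms], where T = 1 and t = 1 and i = i and j = j]
  by (simp add: lax_solution_def)

definition free_lax :: "complex \<Rightarrow> 2 \<Rightarrow> 2 \<Rightarrow> complex" where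
  "free_lax z i j = (if i \<noteq> j then 0 else if i = 1 then exp (- 2 * \<i> * z\<^sup>2) else exp (2 * \<i> * z\<^sup>2))"

lemma norm_free_lax_le: "cmod (free_lax z i j) \<le> growth z"
  using norm_exp_le_growth[of z] growth_ge_1[of z] by (auto simp: free_lax_def simp del: norm_exp_eq_Re)

text \<open>Above the threshold \<open>L\<close> the gauge estimate applies, with \<open>16\<close>
  in place of \<open>8\<close> because \<open>1 + cmod z\<close> is at most
  \<open>2 * cmod z\<close>. Below \<open>L\<close> the crude bound is enough, since
  \<open>1 + cmod z\<close> is bounded there.\<close>

proposition lax_solution_asymptotics:
  "\<exists>C>0. \<forall>\<psi> z i j. norm \<psi> \<le> R \<longrightarrow> cmod (lax_solution \<psi> z i j 1 - free_lax z i j) \<le> C * growth z / (1 + cmod z)"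
proof -
  define C0 where "C0 = 5 * R\<^sup>2 + 8 * R ^ 3 + 2 * R"
  define L where "L = max 1 (4 * C0)"
  define K where "K = exp (2 * (2 * L\<^sup>2 + 4 * R\<^sup>2 + 4 * L * R + 2 * R))"
  define C where "C = max (16 * C0) ((K + 1) * (1 + L))"
  have "L \<ge> 1" by (simp add: L_def)
  then have "(K + 1) * (1 + L) > 0" by (intro mult_pos_pos) (auto simp: K_def add_pos_pos)
  then have "C > 0" unfolding C_def by linarith
  moreover have "cmod (lax_solution \<psi> z i j 1 - free_lax z i j) \<le> C * growth z / (1 + cmod z)"
    if R: "norm \<psi> \<le> R" for \<psi> z i j
  proof (cases "cmod z \<ge> L")
    case True
    then have z: "cmod z \<ge> 1" "cmod z \<ge> 4 * C0" by (auto simp: L_def)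
    note as = lax_solution_asymptotics_large[OF R z C0_def, of j]
    have "free_lax z 1 j = exp (- 2 * \<i> * z\<^sup>2) * of_bool (1 = j)" "free_lax z 2 j = exp (2 * \<i> * z\<^sup>2) * of_bool (2 = j)"
      by (auto simp: free_lax_def)
    with as have "cmod (lax_solution \<psi> z i j 1 - free_lax z i j) \<le> 8 * growth z * C0 / cmod z"
      using exhaust_2[of i] by metis
    also have "\<dots> \<le> 16 * C0 * growth z / (1 + cmod z)"
    proof -
      have R0: "0 \<le> R" using R norm_ge_zero order_trans by blast
      have "0 \<le> C0 * growth z" using R0 growth_ge_1[of z] by (simp add: C0_def)
      then have "(16 * C0 * growth z) / (2 * cmod z) \<le> (16 * C0 * growth z) / (1 + cmod z)"
        using z by (intro frac_le) auto
      then show ?thesis by (simp add: mult_ac)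
    qed
    also have "\<dots> \<le> C * growth z / (1 + cmod z)"
      using growth_ge_1[of z] by (intro divide_right_mono mult_right_mono) (auto simp: C_def)
    finally show ?thesis .
  next
    case False
    then have zL: "cmod z \<le> L" by simp
    have K0: "0 < K" by (simp add: K_def)
    have "cmod (lax_solution \<psi> z i j 1 - free_lax z i j) \<le> K + growth z"
      using norm_lax_solution_le[OF R zL, of i j] norm_free_lax_le[of z i j]
      by (intro order_trans[OF norm_triangle_ineq4] add_mono) (simp_all add: K_def)
    also have "\<dots> \<le> (K + 1) * growth z"
      using growth_ge_1[of z] mult_left_mono[OF growth_ge_1[of z], of K] K0 by (simp add: algebra_simps)
    also have "\<dots> = ((K + 1) * (1 + cmod z)) * growth z / (1 + cmod z)"
      using norm_ge_zero[of z] by (simp add: field_simps add_nonneg_eq_0_iff)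
    also have "\<dots> \<le> C * growth z / (1 + cmod z)"
    proof (intro divide_right_mono mult_right_mono)
      have "(K + 1) * (1 + cmod z) \<le> (K + 1) * (1 + L)" using zL K0 by (intro mult_left_mono) auto
      then show "(K + 1) * (1 + cmod z) \<le> C" by (simp add: C_def)
    qed (use growth_ge_1[of z] in auto)
    finally show ?thesis .
  qed
  ultimately show ?thesis by blast
qed

section \<open>Holomorphy and asymptotics of the discriminant\<close>

lemma holomorphic_discr: "discr \<psi> holomorphic_on A"
proof -
  have "(\<lambda>x. lax_solution (\<psi> + scaleC_pot 0 0) x i j 1) holomorphic_on UNIV" for i j
    by (rule holomorphic_on_lax_solution_param[of UNIV "\<lambda>x. x" "\<lambda>_. 0"]) auto
  then have "(\<lambda>x. lax_solution \<psi> x 1 1 1 + lax_solution \<psi> x 2 2 1) holomorphic_on A"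
    by (intro holomorphic_intros) (auto intro: holomorphic_on_subset)
  then show ?thesis by (simp add: discr_eq[abs_def])
qed

lemma holomorphic_discr_line: "(\<lambda>z. discr (\<psi> + scaleC_pot z h) w) holomorphic_on A"
proof -
  have "(\<lambda>x. lax_solution (\<psi> + scaleC_pot x h) w i j 1) holomorphic_on UNIV" for i j
    by (rule holomorphic_on_lax_solution_param[of UNIV "\<lambda>x. w" "\<lambda>x. x"]) auto
  then have "(\<lambda>x. lax_solution (\<psi> + scaleC_pot x h) w 1 1 1 + lax_solution (\<psi> + scaleC_pot x h) w 2 2 1) holomorphic_on A"
    by (intro holomorphic_intros) (auto intro: holomorphic_on_subset)
  then show ?thesis by (simp add: discr_eq[abs_def])
qed

lemma continuous_on_discr_line: "continuous_on A (\<lambda>(z, w). discr (\<psi> + scaleC_pot z h) w)"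
proof -
  have c: "continuous_on UNIV (\<lambda>x. lax_solution (\<psi> + scaleC_pot (fst x) h) (snd x) i j 1)" for i j
    by (rule continuous_on_lax_solution_param[of UNIV snd fst]) (auto intro: continuous_intros)
  have "continuous_on UNIV (\<lambda>x. lax_solution (\<psi> + scaleC_pot (fst x) h) (snd x) 1 1 1 +
      lax_solution (\<psi> + scaleC_pot (fst x) h) (snd x) 2 2 1)"
    by (intro continuous_on_add c)
  then show ?thesis by (auto simp: discr_eq split_def intro: continuous_on_subset)
qed

lemma discr_asymptotics:
  assumes "R > 0"
  shows "\<exists>C>0. \<forall>\<psi> z. norm \<psi> < R \<longrightarrow>
    cmod (discr \<psi> z - 2 * cos (2 * z\<^sup>2)) \<le> C * norm \<psi> * growth z / (1 + cmod z)"
proof -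
  obtain C where C: "C > 0" and as: "\<And>\<psi> z i j. norm \<psi> \<le> R \<Longrightarrow>
      cmod (lax_solution \<psi> z i j 1 - free_lax z i j) \<le> C * growth z / (1 + cmod z)"
    using lax_solution_asymptotics[of R] by blast
  have fr: "free_lax z 1 1 + free_lax z 2 2 = 2 * cos (2 * z\<^sup>2)" for z
    by (simp add: free_lax_def cos_exp_eq mult_ac)
  have "cmod (discr \<psi> z - 2 * cos (2 * z\<^sup>2)) \<le> (6 * C / R) * norm \<psi> * growth z / (1 + cmod z)"
    if R: "norm \<psi> < R" for \<psi> z
  proof -
    \<comment> \<open>Two diagonal entries contribute \<open>2\<close>; the third unit makes the
      bound strict. The estimate below is taken at the centre \<open>0\<close>, where
      \<open>F\<close> vanishes.\<close>
    define K where "K = 3 * C * growth z / (1 + cmod z)"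
    define F where "F = (\<lambda>\<psi>. discr \<psi> z - 2 * cos (2 * z\<^sup>2))"
    have pos: "1 + cmod z > 0" "growth z > 0"
      using growth_ge_1[of z] norm_ge_zero[of z] by linarith+
    have "cmod (F (0 + \<psi>) - F 0) \<le> 2 * K * norm \<psi> / R"
    proof (rule gateaux_holomorphic_Lipschitz[OF _ \<open>R > 0\<close> _ R])
      show "gateaux_holomorphic F (ball 0 R)"
        unfolding gateaux_holomorphic_def F_def
        by (intro allI holomorphic_intros holomorphic_discr_line)
      fix \<phi> :: pot assume "\<phi> \<in> ball 0 R"
      then have \<phi>: "norm \<phi> \<le> R" by simp
      have "F \<phi> = (lax_solution \<phi> z 1 1 1 - free_lax z 1 1) + (lax_solution \<phi> z 2 2 1 - free_lax z 2 2)"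
        by (simp add: F_def discr_eq fr[symmetric])
      also have "cmod \<dots> \<le> C * growth z / (1 + cmod z) + C * growth z / (1 + cmod z)"
        by (intro order_trans[OF norm_triangle_ineq] add_mono as[OF \<phi>])
      also have "\<dots> < K"
      proof -
        have "C * growth z / (1 + cmod z) > 0" using C pos by simp
        moreover have "K = 3 * (C * growth z / (1 + cmod z))" by (simp add: K_def)
        ultimately show ?thesis by linarith
      qed
      finally show "cmod (F \<phi>) < K" .
    qed
    moreover have "F 0 = 0" by (simp add: F_def discr_zero)
    ultimately show ?thesis by (simp add: F_def K_def mult_ac)
  qed
  moreover have "6 * C / R > 0" using C \<open>R > 0\<close> by simp
  ultimately show ?thesis by blast
qed

text \<open>The radius is of order \<open>1 / cmod z\<close> because \<open>2 * z\<^sup>2\<close>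
  has derivative \<open>4 * z\<close>: on such a disc it moves by at most \<open>2\<close>, and the
  growth factor by at most \<open>exp 2\<close>.\<close>

lemma growth_near:
  assumes "cmod (w - z) \<le> 1 / (2 * (1 + cmod z))"
  shows "growth w \<le> exp 2 * growth z" and "1 + cmod z \<le> 2 * (1 + cmod w)"
proof -
  define r where "r = 1 / (2 * (1 + cmod z))"
  have r: "r * (2 * (1 + cmod z)) = 1" "r > 0" "r \<le> 1 / 2"
    unfolding r_def by (auto simp: field_simps add_nonneg_eq_0_iff add_pos_nonneg)
  have "w + z = (w - z) + 2 * z" by simp
  then have "cmod (w + z) \<le> cmod (w - z) + cmod (2 * z)" by (metis norm_triangle_ineq)
  also have "\<dots> \<le> r + 2 * cmod z" using assms by (simp add: r_def norm_mult)
  finally have "cmod (w + z) \<le> r + 2 * cmod z" .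
  then have "cmod (w - z) * cmod (w + z) \<le> r * (r + 2 * cmod z)"
    using assms r by (intro mult_mono) (auto simp: r_def)
  also have "\<dots> \<le> r * (2 * (1 + cmod z))" using r by (intro mult_left_mono) auto
  finally have "cmod (w\<^sup>2 - z\<^sup>2) \<le> 1"
    unfolding norm_mult[symmetric] r by (simp add: power2_eq_square algebra_simps)
  then have "\<bar>Im (2 * w\<^sup>2) - Im (2 * z\<^sup>2)\<bar> \<le> 2"
    using abs_Im_le_cmod[of "2 * w\<^sup>2 - 2 * z\<^sup>2"] norm_mult[of 2 "w\<^sup>2 - z\<^sup>2"]
    by (simp add: right_diff_distrib)
  then have "\<bar>Im (2 * w\<^sup>2)\<bar> \<le> 2 + \<bar>Im (2 * z\<^sup>2)\<bar>" by linarith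
  then show "growth w \<le> exp 2 * growth z" unfolding growth_def exp_add[symmetric] by simp
  have "cmod z \<le> cmod w + cmod (w - z)" using norm_triangle_ineq4[of w "w - z"] by simp
  then show "1 + cmod z \<le> 2 * (1 + cmod w)"
    using assms r(3) norm_ge_zero[of w] unfolding r_def[symmetric] by argo
qed

lemma deriv_free_discr: "deriv (\<lambda>z. 2 * cos (2 * z\<^sup>2)) z = - 8 * z * sin (2 * z\<^sup>2)" for z :: complex
  by (rule DERIV_imp_deriv) (auto intro!: derivative_eq_intros)

text \<open>Cauchy's inequality on a circle of radius \<open>1 / (2 * (1 + cmod z))\<close> costs a
  factor \<open>1 + cmod z\<close>, which is exactly the decay of the error of
  \<open>discr\<close>.\<close>

lemma deriv_discr_asymptotics:
  assumes "R > 0"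
  shows "\<exists>C>0. \<forall>\<psi> z. norm \<psi> < R \<longrightarrow>
    cmod (deriv (discr \<psi>) z - (- 8 * z * sin (2 * z\<^sup>2))) \<le> C * norm \<psi> * growth z"
proof -
  obtain C where C: "C > 0" and as: "\<And>\<psi> z. norm \<psi> < R \<Longrightarrow>
      cmod (discr \<psi> z - 2 * cos (2 * z\<^sup>2)) \<le> C * norm \<psi> * growth z / (1 + cmod z)"
    using discr_asymptotics[OF assms] by blast
  have "cmod (deriv (discr \<psi>) z - (- 8 * z * sin (2 * z\<^sup>2))) \<le> (4 * exp 2 * C) * norm \<psi> * growth z"
    if R: "norm \<psi> < R" for \<psi> z
  proof -
    define r where "r = 1 / (2 * (1 + cmod z))"
    have r: "r > 0" by (auto simp: r_def add_pos_nonneg)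
    define F where "F = (\<lambda>w. discr \<psi> w - 2 * cos (2 * w\<^sup>2))"
    define B where "B = 2 * exp 2 * C * norm \<psi> * growth z / (1 + cmod z)"
    have hF: "F holomorphic_on A" for A unfolding F_def by (intro holomorphic_intros holomorphic_discr)
    have "norm ((deriv ^^ 1) F z) \<le> fact 1 * B / r ^ 1"
    proof (rule Cauchy_inequality[OF hF holomorphic_on_imp_continuous_on[OF hF] r])
      fix w assume "cmod (z - w) = r"
      then have w: "cmod (w - z) \<le> 1 / (2 * (1 + cmod z))" by (simp add: r_def norm_minus_commute)
      have "cmod (F w) \<le> C * norm \<psi> * growth w / (1 + cmod w)" unfolding F_def by (rule as[OF R])
      also have "\<dots> \<le> C * norm \<psi> * (exp 2 * growth z) / ((1 + cmod z) / 2)"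
        using growth_near[OF w] C growth_ge_1[of z] norm_ge_zero[of z]
        by (intro frac_le mult_left_mono) (auto intro: add_pos_nonneg)
      also have "\<dots> = B" by (simp add: B_def mult_ac)
      finally show "cmod (F w) \<le> B" .
    qed
    also have "fact 1 * B / r ^ 1 = (4 * exp 2 * C) * norm \<psi> * growth z"
      using norm_ge_zero[of z] by (simp add: B_def r_def field_simps add_nonneg_eq_0_iff)
    finally have "norm (deriv F z) \<le> (4 * exp 2 * C) * norm \<psi> * growth z" by simp
    moreover have "deriv F z = deriv (discr \<psi>) z - (- 8 * z * sin (2 * z\<^sup>2))"
      unfolding F_def deriv_free_discr[symmetric]
      by (intro deriv_diff) (auto intro!: holomorphic_on_imp_differentiable_at[of _ UNIV] holomorphic_discr holomorphic_intros)
    ultimately show ?thesis by simp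
  qed
  moreover have "4 * exp 2 * C > 0" using C by simp
  ultimately show ?thesis by blast
qed

section \<open>The free roots and their discs\<close>

lemma exp_near_1_imp:
  fixes v :: complex
  assumes "cmod (exp v - 1) < 1 / 2"
  shows "\<exists>m::int. cmod (v - of_int m * (2 * of_real pi * \<i>)) \<le> 2 * cmod (exp v - 1)"
proof -
  have nz: "exp v \<noteq> 0" by simp
  have "exp (Ln (exp v)) = exp v" by (rule exp_Ln) simp
  then obtain m :: int where m: "Ln (exp v) = v + (of_int (2 * m) * pi) * \<i>"
    unfolding exp_eq by auto
  have "cmod (Ln (1 + (exp v - 1))) \<le> 2 * cmod (exp v - 1)" by (rule norm_Ln_le[OF assms])
  then have "cmod (v - of_int (- m) * (2 * of_real pi * \<i>)) \<le> 2 * cmod (exp v - 1)"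
    by (simp add: m algebra_simps)
  then show ?thesis by blast
qed

text \<open>\<open>sin w\<close> is
  \<open>exp (- \<i> * w) * (exp (2 * \<i> * w) - 1) / (2 * \<i>)\<close>. Away from the multiples
  of pi the middle factor is at least \<open>1 / 4\<close>, since otherwise a logarithm of
  \<open>exp (2 * \<i> * w)\<close> would be too close to a period. Using \<open>w\<close> and
  \<open>- w\<close> gives the absolute value in the exponent.\<close>

lemma norm_sin_ge:
  fixes w :: complex
  assumes "\<And>m::int. 1 / 4 \<le> cmod (w - of_int m * of_real pi)"
  shows "exp \<bar>Im w\<bar> / 8 \<le> cmod (sin w)"
proof -
  have main: "exp (Im w) / 8 \<le> cmod (sin w)"
    if w: "\<And>m::int. 1 / 4 \<le> cmod (w - of_int m * of_real pi)" for w :: complex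
  proof -
    define v where "v = 2 * \<i> * w"
    have "\<not> cmod (exp v - 1) < 1 / 4"
    proof
      assume *: "cmod (exp v - 1) < 1 / 4"
      then obtain m :: int where m: "cmod (v - of_int m * (2 * of_real pi * \<i>)) \<le> 2 * cmod (exp v - 1)"
        using exp_near_1_imp[of v] by auto
      have "v - of_int m * (2 * of_real pi * \<i>) = 2 * \<i> * (w - of_int m * of_real pi)"
        by (simp add: v_def algebra_simps)
      then have "cmod (v - of_int m * (2 * of_real pi * \<i>)) = 2 * cmod (w - of_int m * of_real pi)"
        by (simp add: norm_mult)
      with m w[of m] * show False by linarith
    qed
    moreover have "sin w = exp (- \<i> * w) * (exp v - 1) / (2 * \<i>)"
    proof -
      have "exp (- \<i> * w) * exp v = exp (\<i> * w)" unfolding v_def exp_add[symmetric] by simp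
      then show ?thesis unfolding sin_exp_eq right_diff_distrib by simp
    qed
    then have "cmod (sin w) = exp (Im w) * cmod (exp v - 1) / 2"
      by (simp add: norm_mult norm_divide)
    moreover have "exp (Im w) * (1 / 4) \<le> exp (Im w) * cmod (exp v - 1)"
      using calculation(1) by (intro mult_left_mono) auto
    ultimately show ?thesis by argo
  qed
  have "1 / 4 \<le> cmod (- w - of_int m * of_real pi)" for m :: int
    using assms[of "- m"] norm_minus_cancel[of "w - of_int (- m) * of_real pi"] by simp
  from main[OF assms] main[OF this] show ?thesis by (auto simp: abs_if)
qed

lemma Re_cos_ge:
  assumes "cmod u \<le> pi / 4"
  shows "1 / 2 \<le> Re (cos u)"
proof -
  have "\<bar>Re u\<bar> \<le> pi / 4" using abs_Re_le_cmod[of u] assms by linarith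
  then have "cos (pi / 4) \<le> cos \<bar>Re u\<bar>" by (intro cos_monotone_0_pi_le) auto
  moreover have "1 / 2 \<le> cos (pi / 4)" unfolding cos_45 using sqrt2_less_2 real_le_rsqrt[of 1 2] by simp
  ultimately have 1: "1 / 2 \<le> cos (Re u)" by simp
  have "1 \<le> (exp (Im u) + exp (- Im u)) / 2" using cosh_real_ge_1[of "Im u"] by (simp add: cosh_field_def)
  then have "1 / 2 * 1 \<le> cos (Re u) * ((exp (Im u) + exp (- Im u)) / 2)"
    using 1 by (intro mult_mono) auto
  then show ?thesis by (simp add: Re_cos)
qed

text \<open>The mean value theorem along the segment from \<open>0\<close> to \<open>u\<close>,
  applied to the real part of \<open>sin\<close> times \<open>cnj u\<close>; the real part of
  \<open>cos\<close> is at least \<open>1 / 2\<close> on the segment.\<close>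

lemma norm_sin_ge_near:
  assumes "cmod u \<le> pi / 4"
  shows "cmod u / 2 \<le> cmod (sin u)"
proof (cases "u = 0")
  case False
  have "\<exists>\<xi>. \<xi> \<in> closed_segment 0 u \<and> Re (sin u * cnj u) - Re (sin 0 * cnj u) = Re (cos \<xi> * cnj u * (u - 0))"
    by (rule complex_mvt_line) (auto intro!: derivative_eq_intros)
  then obtain \<xi> where \<xi>: "\<xi> \<in> closed_segment 0 u" and eq: "Re (sin u * cnj u) = Re (cos \<xi> * cnj u * u)" by auto
  have "cmod \<xi> \<le> pi / 4" using segment_bound1[OF \<xi>] assms by simp
  define r where "r = (cmod u)\<^sup>2"
  have "cnj u * u = of_real r" unfolding r_def by (metis complex_norm_square mult.commute)
  then have "cos \<xi> * cnj u * u = cos \<xi> * of_real r" by (simp only: mult.assoc)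
  with eq have "Re (sin u * cnj u) = Re (cos \<xi> * of_real r)" by (simp only:)
  also have "\<dots> = Re (cos \<xi>) * (cmod u)\<^sup>2" unfolding r_def[symmetric] by simp
  finally have "Re (sin u * cnj u) = Re (cos \<xi>) * (cmod u)\<^sup>2" .
  also have "\<dots> \<ge> 1 / 2 * (cmod u)\<^sup>2"
    using Re_cos_ge[OF \<open>cmod \<xi> \<le> pi / 4\<close>] by (intro mult_right_mono) auto
  also have "Re (sin u * cnj u) \<le> cmod (sin u) * cmod u"
    using complex_Re_le_cmod[of "sin u * cnj u"] by (simp add: norm_mult)
  finally show ?thesis using False by (simp add: power2_eq_square)
qed simp

lemma sin_diff_int_pi: "sin (w - of_int m * of_real pi) = (-1) powi m * sin (w::complex)"
  and cos_diff_int_pi: "cos (w - of_int m * of_real pi) = (-1) powi m * cos (w::complex)"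
proof -
  have s: "sin (of_int m * of_real pi :: complex) = 0"
  proof -
    have "sin (of_int m * of_real pi :: complex) = of_real (sin (of_int m * pi))"
      unfolding sin_of_real[symmetric] by simp
    also have "sin (of_int m * pi) = 0" by (simp add: mult.commute[of _ pi])
    finally show ?thesis by simp
  qed
  have c: "cos (of_int m * of_real pi :: complex) = (-1) powi m"
  proof -
    have "cos (of_int m * of_real pi :: complex) = of_real (cos (of_int m * pi))"
      unfolding cos_of_real[symmetric] by simp
    also have "cos (of_int m * pi) = (-1) powi m"
      by (simp add: mult.commute[of _ pi] power_int_minus_left)
    finally show ?thesis by simp
  qed
  show "sin (w - of_int m * of_real pi) = (-1) powi m * sin (w::complex)"
    by (simp add: sin_diff s c)
  show "cos (w - of_int m * of_real pi) = (-1) powi m * cos (w::complex)"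
    by (simp add: cos_diff s c)
qed

lemma norm_powi_minus_one: "cmod ((-1) powi m) = 1"
  by (cases "even m") (simp_all add: power_int_minus_left)

text \<open>\<open>2 z\<^sup>2 = root_index i n * pi\<close> for the free root \<open>z\<close> in the disc \<open>D i n\<close>.\<close>

definition root_index :: "nat \<Rightarrow> int \<Rightarrow> int" where
  "root_index i n = (if i = 1 then \<bar>n\<bar> else - \<bar>n\<bar>)"

lemma abs_root_index [simp]: "\<bar>root_index i n\<bar> = \<bar>n\<bar>" by (simp add: root_index_def)
lemma root_index_eq_0_iff [simp]: "root_index i n = 0 \<longleftrightarrow> n = 0" by (simp add: root_index_def)

lemma free_root_1: "free_root 1 n = of_real (of_int (sgn n) * sqrt (of_int \<bar>n\<bar> * pi / 2))"
  and free_root_2: "free_root 2 n = \<i> * of_real (of_int (sgn n) * sqrt (of_int \<bar>n\<bar> * pi / 2))"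
proof -
  have 0: "0 \<le> of_int \<bar>n\<bar> * pi / 2" by simp
  have "free_root 1 n = of_int (sgn n) * csqrt (of_real (of_int \<bar>n\<bar> * pi / 2))"
    by (simp add: free_root_def)
  then show "free_root 1 n = of_real (of_int (sgn n) * sqrt (of_int \<bar>n\<bar> * pi / 2))"
    unfolding of_real_sqrt[OF 0] by simp
  have "free_root 2 n = of_int (sgn n) * csqrt (of_real (- (of_int \<bar>n\<bar> * pi / 2)))"
    by (simp add: free_root_def)
  moreover have "csqrt (of_real (- (of_int \<bar>n\<bar> * pi / 2))) = \<i> * of_real (sqrt (of_int \<bar>n\<bar> * pi / 2))"
    using csqrt_of_real_nonpos[of "- (of_int \<bar>n\<bar> * pi / 2)"] 0 by (simp del: of_real_minus of_real_mult of_real_divide)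
  ultimately show "free_root 2 n = \<i> * of_real (of_int (sgn n) * sqrt (of_int \<bar>n\<bar> * pi / 2))" by simp
qed

lemma norm_free_root:
  assumes "i \<in> {1, 2}"
  shows "cmod (free_root i n) = sqrt (of_int \<bar>n\<bar> * pi / 2)"
proof -
  define s where "s = sqrt (of_int \<bar>n\<bar> * pi / 2)"
  have "0 \<le> s" "n = 0 \<Longrightarrow> s = 0" by (simp_all add: s_def)
  then have "\<bar>of_int (sgn n) * s\<bar> = s" by (auto simp: sgn_if)
  moreover have "cmod (free_root i n) = \<bar>of_int (sgn n) * s\<bar>"
    using assms free_root_1[of n] free_root_2[of n] unfolding s_def[symmetric] by (auto simp only: norm_mult norm_of_real norm_ii)
  ultimately show ?thesis unfolding s_def by simp
qed

lemma free_root_0 [simp]: "free_root i 0 = 0" by (simp add: free_root_def)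

lemma free_root_power2:
  assumes "i \<in> {1, 2}"
  shows "2 * (free_root i n)\<^sup>2 = of_int (root_index i n) * of_real pi"
proof -
  define x where "x = of_int (sgn n) * sqrt (of_int \<bar>n\<bar> * pi / 2)"
  have "x\<^sup>2 = (of_int (sgn n))\<^sup>2 * (of_int \<bar>n\<bar> * pi / 2)" by (simp add: x_def power_mult_distrib)
  also have "\<dots> = of_int \<bar>n\<bar> * pi / 2" by (auto simp: sgn_if)
  finally have "x\<^sup>2 = of_int \<bar>n\<bar> * pi / 2" .
  then have "of_real (x\<^sup>2) = (of_real (of_int \<bar>n\<bar> * pi / 2) :: complex)" by (simp only:)
  then have x2: "(of_real x)\<^sup>2 = (of_int \<bar>n\<bar> * of_real pi / 2 :: complex)"
    by (simp del: of_int_abs)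
  from assms consider "i = 1" | "i = 2" by auto
  then show ?thesis
    by cases (simp_all add: free_root_1[of n, folded x_def] free_root_2[of n, folded x_def] root_index_def x2 power_mult_distrib
       del: One_nat_def of_int_abs of_real_mult)
qed

lemma in_D_iff:
  assumes "i \<in> {1, 2}" "n \<noteq> 0"
  shows "z \<in> D i n \<longleftrightarrow> cmod (2 * z\<^sup>2 - of_int (root_index i n) * of_real pi) < pi / 4 \<and>
     (if i = 1 then of_int (sgn n) * Re z > 0 else of_int (sgn n) * Im z > 0)"
  using assms by (auto simp: D_def U_def root_index_def sgn_if split: if_splits)

text \<open>The half-plane condition puts \<open>z\<close> and the free root on the same side of an
  axis, so \<open>z\<close> stays away from the opposite root of the same equation.\<close>

lemma norm_add_free_root_ge:
  assumes i: "i \<in> {1, 2}" and z: "if i = 1 then of_int (sgn n) * Re z > 0 else of_int (sgn n) * Im z > 0"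
  shows "cmod (free_root i n) \<le> cmod (z + free_root i n)"
proof -
  define s where "s = sqrt (of_int \<bar>n\<bar> * pi / 2)"
  have s: "s \<ge> 0" by (simp add: s_def)
  have *: "s \<le> \<bar>x + of_int (sgn n) * s\<bar>" if "of_int (sgn n) * x > 0" for x :: real
    using that s by (auto simp: sgn_if split: if_splits)
  from i consider "i = 1" | "i = 2" by auto
  then show ?thesis
  proof cases
    case 1
    have "s \<le> \<bar>Re (z + free_root i n)\<bar>" using * z 1 by (simp add: free_root_1[of n, folded s_def] del: One_nat_def)
    then show ?thesis using abs_Re_le_cmod[of "z + free_root i n"] norm_free_root[OF i, of n] unfolding s_def by linarith
  next
    case 2
    have "s \<le> \<bar>Im (z + free_root i n)\<bar>" using * z 2 by (simp add: free_root_2[of n, folded s_def])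
    then show ?thesis using abs_Im_le_cmod[of "z + free_root i n"] norm_free_root[OF i, of n] unfolding s_def by linarith
  qed
qed

text \<open>\<open>2 * z\<^sup>2\<close> minus its free value factors as
  \<open>2 * (z - r) * (z + r)\<close> with \<open>r\<close> the free root, and the last factor is
  at least \<open>cmod r\<close>. Closeness of \<open>2 * z\<^sup>2\<close> to a multiple of pi thus
  transfers to \<open>z\<close> with a gain of order \<open>sqrt n\<close>.\<close>

lemma norm_diff_free_root_le:
  assumes i: "i \<in> {1, 2}" and z: "if i = 1 then of_int (sgn n) * Re z > 0 else of_int (sgn n) * Im z > 0"
  shows "2 * cmod (z - free_root i n) * cmod (free_root i n) \<le> cmod (2 * z\<^sup>2 - of_int (root_index i n) * of_real pi)"
proof -
  have "2 * z\<^sup>2 - of_int (root_index i n) * of_real pi = 2 * ((z - free_root i n) * (z + free_root i n))"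
    unfolding free_root_power2[OF i, symmetric] by (simp add: power2_eq_square algebra_simps)
  then have "cmod (2 * z\<^sup>2 - of_int (root_index i n) * of_real pi) = 2 * (cmod (z - free_root i n) * cmod (z + free_root i n))"
    by (simp add: norm_mult)
  moreover have "cmod (z - free_root i n) * cmod (free_root i n) \<le> cmod (z - free_root i n) * cmod (z + free_root i n)"
    by (intro mult_left_mono norm_add_free_root_ge[OF assms]) auto
  ultimately show ?thesis by simp
qed

text \<open>For nonzero \<open>m\<close> the real part of \<open>z\<^sup>2\<close> has the sign of
  \<open>m\<close>, because pi exceeds \<open>pi / 4\<close>. This sign selects \<open>i\<close> and
  keeps \<open>z\<close> off the axis that separates \<open>n\<close> from
  \<open>- n\<close>.\<close>

lemma ex_D_of_near_multiple:
  assumes "cmod (2 * z\<^sup>2 - of_int m * of_real pi) < pi / 4" and "m \<noteq> 0"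
  shows "\<exists>i\<in>{1, 2}. \<exists>n. n \<noteq> 0 \<and> \<bar>n\<bar> = \<bar>m\<bar> \<and> root_index i n = m \<and> z \<in> D i n"
proof -
  have re: "\<bar>2 * ((Re z)\<^sup>2 - (Im z)\<^sup>2) - of_int m * pi\<bar> < pi / 4"
    using abs_Re_le_cmod[of "2 * z\<^sup>2 - of_int m * of_real pi"] assms(1) by (simp add: Re_power2)
  show ?thesis
  proof (cases "m > 0")
    case True
    then have "pi \<le> of_int m * pi" by simp
    then have "(Re z)\<^sup>2 - (Im z)\<^sup>2 > 0" using re pi_gt_zero unfolding abs_less_iff by argo
    then have "Re z \<noteq> 0" by auto
    then consider "Re z > 0" | "Re z < 0" by linarith
    then show ?thesis
    proof cases
      case 1 then show ?thesis using True assms by (intro bexI[of _ 1] exI[of _ m]) (auto simp: in_D_iff root_index_def)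
    next
      case 2 then show ?thesis using True assms by (intro bexI[of _ 1] exI[of _ "- m"]) (auto simp: in_D_iff root_index_def)
    qed
  next
    case False
    then have "of_int m \<le> (-1::real)" using assms(2) by linarith
    then have "of_int m * pi \<le> -1 * pi" by (intro mult_right_mono) auto
    then have "(Re z)\<^sup>2 - (Im z)\<^sup>2 < 0" using re pi_gt_zero unfolding abs_less_iff by argo
    then have "Im z \<noteq> 0" by auto
    then consider "Im z > 0" | "Im z < 0" by linarith
    then show ?thesis
    proof cases
      case 1 then show ?thesis using False assms by (intro bexI[of _ 2] exI[of _ "- m"]) (auto simp: in_D_iff root_index_def)
    next
      case 2 then show ?thesis using False assms by (intro bexI[of _ 2] exI[of _ m]) (auto simp: in_D_iff root_index_def)
    qed
  qed
qed

lemma near_multiple_unique: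
  assumes "cmod (w - of_int m * of_real pi) < pi / 4" and "m' \<noteq> m"
  shows "pi / 4 \<le> cmod (w - of_int m' * of_real pi)"
proof -
  have "1 \<le> \<bar>of_int (m' - m) :: real\<bar>" using assms(2) by linarith
  then have "pi \<le> \<bar>of_int (m' - m) :: real\<bar> * pi" by simp
  also have "\<dots> = cmod ((w - of_int m * of_real pi) - (w - of_int m' * of_real pi))"
    by (simp add: norm_mult flip: left_diff_distrib of_int_diff)
  also have "\<dots> \<le> cmod (w - of_int m * of_real pi) + cmod (w - of_int m' * of_real pi)"
    by (rule norm_triangle_ineq4)
  finally show ?thesis using assms(1) pi_gt_zero by argo
qed

lemma D_disjoint:
  assumes "i \<in> {1, 2}" "j \<in> {1, 2}" "n \<noteq> 0" "k \<noteq> 0" "z \<in> D i n" "z \<in> D j k"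
  shows "i = j \<and> n = k"
proof -
  have z: "cmod (2 * z\<^sup>2 - of_int (root_index i n) * of_real pi) < pi / 4"
      "cmod (2 * z\<^sup>2 - of_int (root_index j k) * of_real pi) < pi / 4"
    using assms by (simp_all add: in_D_iff)
  then have "root_index i n = root_index j k"
    using near_multiple_unique[OF z(1), of "root_index j k"] by force
  then have "i = j \<and> \<bar>n\<bar> = \<bar>k\<bar>" using assms(1-4) by (auto simp: root_index_def)
  then show ?thesis using assms by (auto simp: in_D_iff abs_eq_iff split: if_splits)
qed

lemma in_BB_iff: "z \<in> BB N \<longleftrightarrow> 2 * (cmod z)\<^sup>2 < (real N + 1 / 4) * pi"
proof -
  have "cmod z < sqrt ((real N + 1 / 4) * pi / 2) \<longleftrightarrow> (cmod z)\<^sup>2 < (real N + 1 / 4) * pi / 2"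
    using real_sqrt_less_iff[of "(cmod z)\<^sup>2" "(real N + 1 / 4) * pi / 2"] by (simp del: real_sqrt_less_iff)
  then show ?thesis by (auto simp: BB_def)
qed

lemma D_0 [simp]: "D i 0 = BB 0"
  by (simp add: D_def BB_def)

lemma near_multiple_size:
  assumes "cmod (2 * z\<^sup>2 - of_int m * of_real pi) < pi / 4"
  shows "\<bar>of_int m\<bar> * pi - pi / 4 < 2 * (cmod z)\<^sup>2" "2 * (cmod z)\<^sup>2 < \<bar>of_int m\<bar> * pi + pi / 4"
proof -
  have "\<bar>cmod (2 * z\<^sup>2) - cmod (of_int m * of_real pi)\<bar> < pi / 4"
    using norm_triangle_ineq3[of "2 * z\<^sup>2" "of_int m * of_real pi"] assms by linarith
  moreover have "cmod (2 * z\<^sup>2) = 2 * (cmod z)\<^sup>2" "cmod (of_int m * of_real pi) = \<bar>of_int m\<bar> * pi"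
    by (simp_all add: norm_mult norm_power)
  ultimately show "\<bar>of_int m\<bar> * pi - pi / 4 < 2 * (cmod z)\<^sup>2" "2 * (cmod z)\<^sup>2 < \<bar>of_int m\<bar> * pi + pi / 4"
    by linarith+
qed

text \<open>The radius of \<open>BB N\<close> is placed between the annuli:
  \<open>2 * (cmod z)\<^sup>2\<close> is below \<open>(N + 1 / 4) * pi\<close> on the discs with
  index up to \<open>N\<close>, and above \<open>(N + 3 / 4) * pi\<close> on all others.\<close>

lemma D_subset_BB: "i \<in> {1, 2} \<Longrightarrow> n \<noteq> 0 \<Longrightarrow> \<bar>n\<bar> \<le> int N \<Longrightarrow> z \<in> D i n \<Longrightarrow> z \<in> BB N"
proof -
  assume *: "i \<in> {1, 2}" "n \<noteq> 0" "\<bar>n\<bar> \<le> int N" "z \<in> D i n"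
  then have "2 * (cmod z)\<^sup>2 < \<bar>of_int (root_index i n)\<bar> * pi + pi / 4"
    by (intro near_multiple_size) (simp add: in_D_iff)
  also have "\<bar>of_int (root_index i n) :: real\<bar> = of_int \<bar>n\<bar>"
    by (metis abs_root_index of_int_abs)
  also have "of_int \<bar>n\<bar> * pi \<le> real N * pi" using *(3) by (intro mult_right_mono) (linarith, simp)
  finally show ?thesis by (simp add: in_BB_iff algebra_simps)
qed

lemma D_disjoint_BB: "i \<in> {1, 2} \<Longrightarrow> \<bar>n\<bar> > int N \<Longrightarrow> z \<in> D i n \<Longrightarrow> z \<notin> BB N"
proof -
  assume *: "i \<in> {1, 2}" "\<bar>n\<bar> > int N" "z \<in> D i n"
  then have "n \<noteq> 0" by auto
  with * have "\<bar>of_int (root_index i n)\<bar> * pi - pi / 4 < 2 * (cmod z)\<^sup>2"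
    by (intro near_multiple_size) (simp add: in_D_iff)
  moreover have "\<bar>of_int (root_index i n) :: real\<bar> = of_int \<bar>n\<bar>"
    by (metis abs_root_index of_int_abs)
  then have "(real N + 1) * pi \<le> \<bar>of_int (root_index i n)\<bar> * pi" using *(2) by (intro mult_right_mono) (linarith, simp)
  ultimately have "(real N + 1) * pi - pi / 4 < 2 * (cmod z)\<^sup>2" by argo
  then show ?thesis unfolding in_BB_iff distrib_right using pi_gt_zero by argo
qed

text \<open>
  A round disc inside \<open>D i n\<close> for Rouche's theorem; on its boundary \<open>2 z\<^sup>2\<close> keeps distance
  \<open>1/4\<close> from all multiples of \<open>pi\<close>.
\<close>

definition circle_radius :: "int \<Rightarrow> real" where
  "circle_radius n = 1 / (8 * sqrt (of_int \<bar>n\<bar> * pi / 2))"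

lemma circle_radius_pos: "n \<noteq> 0 \<Longrightarrow> circle_radius n > 0"
  by (simp add: circle_radius_def)

text \<open>With \<open>s = cmod (free_root i n)\<close> the radius is \<open>1 / (8 * s)\<close>.
  On the circle \<open>2 * cmod (z - r) * cmod (z + r)\<close> is at least
  \<open>2 * (1 / 8)\<close>, as the second factor is at least \<open>s\<close>. Inside it is at
  most \<open>1 / 2 + 1 / 32\<close>, which is below \<open>pi / 4\<close>.\<close>

lemma
  assumes i: "i \<in> {1, 2}" and n: "n \<noteq> 0"
  shows cball_circle_subset_D: "cball (free_root i n) (circle_radius n) \<subseteq> D i n"
    and circle_away: "cmod (z - free_root i n) = circle_radius n \<Longrightarrow> 1 / 4 \<le> cmod (2 * z\<^sup>2 - of_int m * of_real pi)"
    and near_imp_in_circle: "z \<in> D i n \<Longrightarrow> cmod (2 * z\<^sup>2 - of_int (root_index i n) * of_real pi) < 1 / 4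
      \<Longrightarrow> z \<in> ball (free_root i n) (circle_radius n)"
proof -
  define s where "s = sqrt (of_int \<bar>n\<bar> * pi / 2)"
  have n1: "1 \<le> (of_int \<bar>n\<bar> :: real)" using n by linarith
  have "3 / 2 \<le> pi / 2" using pi_gt3 by simp
  also have "\<dots> \<le> of_int \<bar>n\<bar> * pi / 2" using n1 by simp
  finally have s2: "3 / 2 \<le> s\<^sup>2" by (simp add: s_def)
  have s1: "s \<ge> 1"
  proof (rule ccontr)
    assume "\<not> s \<ge> 1"
    then have "s\<^sup>2 \<le> 1\<^sup>2" by (intro power_mono) (auto simp: s_def)
    with s2 show False by simp
  qed
  have ns: "cmod (free_root i n) = s" unfolding s_def by (rule norm_free_root[OF i])
  have r: "circle_radius n = 1 / (8 * s)" by (simp add: circle_radius_def s_def)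
  have rs: "circle_radius n * s = 1 / 8" "circle_radius n \<le> 1 / 8" using s1 by (simp_all add: r field_simps)
  have sg: "if i = 1 then of_int (sgn n) * Re z > 0 else of_int (sgn n) * Im z > 0"
    if "cmod (z - free_root i n) \<le> circle_radius n" for z
  proof -
    have *: "of_int (sgn n) * x > 0" if "\<bar>x - of_int (sgn n) * s\<bar> \<le> 1 / 8" for x :: real
    proof (cases "n > 0")
      case True
      then have "\<bar>x - s\<bar> \<le> 1 / 8" using that by simp
      then have "0 < x" using s1 unfolding abs_le_iff by argo
      then show ?thesis using True by simp
    next
      case False
      then have n': "sgn n = -1" using n by simp
      then have "\<bar>x + s\<bar> \<le> 1 / 8" using that by simp
      then have "x < 0" using s1 unfolding abs_le_iff by argo
      then show ?thesis using n' by simp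
    qed
    have 1: "\<bar>Re (z - free_root i n)\<bar> \<le> 1 / 8" "\<bar>Im (z - free_root i n)\<bar> \<le> 1 / 8"
      using abs_Re_le_cmod[of "z - free_root i n"] abs_Im_le_cmod[of "z - free_root i n"] that rs by linarith+
    from i consider "i = 1" | "i = 2" by auto
    then show ?thesis
    proof cases
      case 1
      then show ?thesis using * \<open>\<bar>Re (z - free_root i n)\<bar> \<le> 1 / 8\<close> by (simp add: free_root_1[of n, folded s_def] del: One_nat_def)
    next
      case 2
      then show ?thesis using * \<open>\<bar>Im (z - free_root i n)\<bar> \<le> 1 / 8\<close> by (simp add: free_root_2[of n, folded s_def])
    qed
  qed
  have inD: "z \<in> D i n" if z: "cmod (z - free_root i n) \<le> circle_radius n" for z
  proof -
    have "2 * z\<^sup>2 - of_int (root_index i n) * of_real pi = 2 * ((z - free_root i n) * ((z - free_root i n) + 2 * free_root i n))"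
      unfolding free_root_power2[OF i, symmetric] by (simp add: power2_eq_square algebra_simps)
    also have "cmod \<dots> = 2 * (cmod (z - free_root i n) * cmod ((z - free_root i n) + 2 * free_root i n))"
      by (simp add: norm_mult)
    also have "\<dots> \<le> 2 * (circle_radius n * (circle_radius n + 2 * s))"
    proof (intro mult_left_mono mult_mono z)
      have "cmod ((z - free_root i n) + 2 * free_root i n) \<le> cmod (z - free_root i n) + cmod (2 * free_root i n)"
        by (rule norm_triangle_ineq)
      then show "cmod ((z - free_root i n) + 2 * free_root i n) \<le> circle_radius n + 2 * s"
        using z ns by (simp add: norm_mult)
    qed (use circle_radius_pos[OF n] in auto)
    also have "\<dots> = 2 * (circle_radius n)\<^sup>2 + 1 / 2" using rs(1) by (simp add: power2_eq_square algebra_simps)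
    also have "(circle_radius n)\<^sup>2 \<le> (1 / 8)\<^sup>2" using rs(2) circle_radius_pos[OF n] by (intro power_mono) auto
    finally have "cmod (2 * z\<^sup>2 - of_int (root_index i n) * of_real pi) < pi / 4"
      using pi_gt3 by (simp add: power2_eq_square)
    then show ?thesis unfolding in_D_iff[OF i n] using sg[OF z] by blast
  qed
  then show "cball (free_root i n) (circle_radius n) \<subseteq> D i n"
    by (auto simp: dist_norm norm_minus_commute)
  show "1 / 4 \<le> cmod (2 * z\<^sup>2 - of_int m * of_real pi)" if z: "cmod (z - free_root i n) = circle_radius n"
  proof (cases "m = root_index i n")
    case True
    then show ?thesis using norm_diff_free_root_le[OF i sg[OF eq_refl[OF z]]] z ns rs by simp
  next
    case False
    have "cmod (2 * z\<^sup>2 - of_int (root_index i n) * of_real pi) < pi / 4"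
      using inD[of z] z in_D_iff[OF i n] by simp
    from near_multiple_unique[OF this False] show ?thesis using pi_gt3 by argo
  qed
  show "z \<in> ball (free_root i n) (circle_radius n)"
    if "z \<in> D i n" "cmod (2 * z\<^sup>2 - of_int (root_index i n) * of_real pi) < 1 / 4"
  proof -
    have "if i = 1 then of_int (sgn n) * Re z > 0 else of_int (sgn n) * Im z > 0"
      using that(1) in_D_iff[OF i n] by blast
    from norm_diff_free_root_le[OF i this] have "2 * cmod (z - free_root i n) * s < 1 / 4"
      using that(2) ns by simp
    then have "cmod (z - free_root i n) < circle_radius n" using s1 by (simp add: r field_simps)
    then show ?thesis by (simp add: dist_norm norm_minus_commute)
  qed
qed

lemma free_root_in_D: "i \<in> {1, 2} \<Longrightarrow> n \<noteq> 0 \<Longrightarrow> free_root i n \<in> D i n"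
  using cball_circle_subset_D[of i n] circle_radius_pos[of n] by auto

lemma open_D: "i \<in> {1, 2} \<Longrightarrow> open (D i n)"
proof -
  assume i: "i \<in> {1, 2}"
  show ?thesis
  proof (cases "n = 0")
    case False
    have "D i n = {z. cmod (2 * z\<^sup>2 - of_int (root_index i n) * of_real pi) < pi / 4} \<inter>
      {z. if i = 1 then of_int (sgn n) * Re z > 0 else of_int (sgn n) * Im z > 0}"
      unfolding set_eq_iff Int_iff mem_Collect_eq by (intro allI in_D_iff[OF i False])
    moreover have "open {z. cmod (2 * z\<^sup>2 - of_int (root_index i n) * of_real pi) < pi / 4}"
      by (rule open_Collect_less) (intro continuous_intros)+
    moreover have "open {z. of_int (sgn n) * Re z > 0}" "open {z. of_int (sgn n) * Im z > 0}"
      by (rule open_Collect_less; intro continuous_intros)+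
    then have "open {z. if i = 1 then of_int (sgn n) * Re z > 0 else of_int (sgn n) * Im z > 0}"
      by (cases "i = 1") (simp_all only: if_True if_False simp_thms)
    ultimately show ?thesis by (simp only: open_Int)
  qed (simp add: BB_def)
qed

section \<open>Localization of the zeros\<close>

lemma finite_zeros_compact:
  assumes "f holomorphic_on UNIV" "f w \<noteq> 0" "compact K"
  shows "finite {z \<in> K. f z = 0}"
proof (cases "f constant_on UNIV")
  case True
  then have "f z \<noteq> 0" for z using assms(2) by (auto simp: constant_on_def)
  then show ?thesis by simp
qed (use assms in \<open>auto intro!: holomorphic_compact_finite_zeros[of f UNIV]\<close>)

text \<open>\<open>root_mult\<close> passes through \<open>nat\<close>. Zeros of an entire function
  that is not identically zero are isolated, which makes \<open>zorder\<close> positive there, so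
  the conversion loses nothing.\<close>

lemma
  assumes f: "f holomorphic_on UNIV" "f w \<noteq> 0"
  shows zorder_eq_root_mult: "f z = 0 \<Longrightarrow> zorder f z = int (root_mult f z)"
    and root_mult_pos_iff: "0 < root_mult f z \<longleftrightarrow> f z = 0"
proof -
  have "finite {u \<in> cball z 1. f u = 0}" by (rule finite_zeros_compact[OF f compact_cball])
  then have "\<not> z islimpt {u \<in> cball z 1. f u = 0}" by (rule islimpt_finite)
  then have "\<forall>\<^sub>F u in at z. u \<notin> {u \<in> cball z 1. f u = 0}"
    by (simp add: islimpt_iff_eventually)
  moreover have "\<forall>\<^sub>F u in at z. u \<in> ball z 1"
    unfolding eventually_at by (intro exI[of _ 1]) (simp add: dist_commute)
  ultimately have "\<forall>\<^sub>F u in at z. f u \<noteq> 0" by eventually_elim auto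
  then have fr: "\<exists>\<^sub>F u in at z. f u \<noteq> 0" by (rule eventually_frequently[rotated]) simp
  have pos: "zorder f z > 0 \<longleftrightarrow> f z = 0" by (rule zorder_pos_iff[OF f(1) open_UNIV _ fr]) simp
  show "f z = 0 \<Longrightarrow> zorder f z = int (root_mult f z)" "0 < root_mult f z \<longleftrightarrow> f z = 0"
    using pos by (auto simp: root_mult_def)
qed

lemma root_count_ball_eq:
  assumes F: "F holomorphic_on UNIV" and f: "f holomorphic_on UNIV" and r: "r > 0"
    and less: "\<And>z. cmod (z - c) = r \<Longrightarrow> cmod (F z - f z) < cmod (f z)"
  shows "root_count F (ball c r) = root_count f (ball c r)"
proof -
  have w: "cmod ((c + of_real r) - c) = r" using r by simp
  have Fw: "F (c + of_real r) \<noteq> 0" and fw: "f (c + of_real r) \<noteq> 0" using less[OF w] by auto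
  \<comment> \<open>Rouche's theorem sums over all zeros in an open set around the circle. The
    winding number, \<open>1\<close> inside and \<open>0\<close> outside, restricts both sums to the
    ball.\<close>
  define S where "S = ball c (r + 1)"
  have fin: "finite {z \<in> S. g z = 0}" if "g holomorphic_on UNIV" "g (c + of_real r) \<noteq> 0" for g
    using finite_zeros_compact[OF that compact_cball[of c "r + 1"]] by (rule finite_subset[rotated]) (auto simp: S_def)
  have wn: "winding_number (circlepath c r) z = (if z \<in> ball c r then 1 else 0)" if "z \<notin> sphere c r" for z
  proof (cases "z \<in> ball c r")
    case True
    then show ?thesis by (simp add: winding_number_circlepath dist_norm norm_minus_commute)
  next
    case False
    then have "z \<notin> cball c r" using that by (auto simp: sphere_def)
    then have "winding_number (circlepath c r) z = 0"
      by (intro winding_number_zero_outside[of _ "cball c r"]) (use r in \<open>auto simp: path_image_circlepath\<close>)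
    then show ?thesis using False by simp
  qed
  have count: "(\<Sum>p\<in>{p \<in> S. g p = 0}. winding_number (circlepath c r) p * of_int (zorder g p)) = of_nat (root_count g (ball c r))"
    if g: "g holomorphic_on UNIV" "g (c + of_real r) \<noteq> 0" and nz: "\<And>z. z \<in> sphere c r \<Longrightarrow> g z \<noteq> 0" for g
  proof -
    have "(\<Sum>p\<in>{p \<in> S. g p = 0}. winding_number (circlepath c r) p * of_int (zorder g p)) =
       (\<Sum>p\<in>{p \<in> S. g p = 0}. if p \<in> ball c r then of_nat (root_mult g p) else 0)"
    proof (rule sum.cong[OF refl])
      fix p assume p: "p \<in> {p \<in> S. g p = 0}"
      then have "p \<notin> sphere c r" using nz by auto
      then show "winding_number (circlepath c r) p * of_int (zorder g p) = (if p \<in> ball c r then of_nat (root_mult g p) else 0)"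
        using zorder_eq_root_mult[OF g, of p] p by (simp add: wn)
    qed
    also have "\<dots> = (\<Sum>p\<in>{p \<in> S. g p = 0} \<inter> ball c r. of_nat (root_mult g p))"
      by (rule sum.inter_restrict[symmetric, OF fin[OF g]])
    also have "{p \<in> S. g p = 0} \<inter> ball c r = {p \<in> ball c r. g p = 0}"
      by (auto simp: S_def)
    finally show ?thesis by (simp add: root_count_def)
  qed
  have nz: "F z \<noteq> 0" "f z \<noteq> 0" if "z \<in> sphere c r" for z
    using less[of z] that by (auto simp: dist_norm norm_minus_commute)
  have "(\<Sum>p\<in>{p\<in>S. f p + (F p - f p) = 0}. winding_number (circlepath c r) p * zorder (\<lambda>p. f p + (F p - f p)) p)
      = (\<Sum>p\<in>{p\<in>S. f p = 0}. winding_number (circlepath c r) p * zorder f p)"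
  proof (rule Rouche_theorem)
    show "finite {p \<in> S. f p + (F p - f p) = 0}" using fin[OF F Fw] by simp
    show "finite {p \<in> S. f p = 0}" by (rule fin[OF f fw])
    show "f holomorphic_on S" "(\<lambda>p. F p - f p) holomorphic_on S"
      using F f by (auto intro!: holomorphic_on_diff intro: holomorphic_on_subset)
    show "path_image (circlepath c r) \<subseteq> S" using r by (auto simp: S_def path_image_circlepath)
    show "\<forall>z\<in>path_image (circlepath c r). cmod (F z - f z) < cmod (f z)"
      using less r by (auto simp: path_image_circlepath dist_norm norm_minus_commute)
    show "\<forall>z. z \<notin> S \<longrightarrow> winding_number (circlepath c r) z = 0"
      using wn r by (auto simp: S_def)
  qed (auto simp: S_def)
  then show ?thesis using count[OF F Fw nz(1)] count[OF f fw nz(2)] by simp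
qed

text \<open>
  Shared by \<open>\<Delta>\<^sup>2 - 4 = -4 sin\<^sup>2 (2 z\<^sup>2)\<close>, with \<open>k = 2\<close> and \<open>a = 4\<close>, and the derivative
  \<open>-8 z sin (2 z\<^sup>2)\<close> of \<open>\<Delta>\<close>, with \<open>k = 1\<close> and \<open>a = 3\<close>, for the zero potential.
\<close>

definition free_zeros :: "(complex \<Rightarrow> complex) \<Rightarrow> nat \<Rightarrow> nat \<Rightarrow> bool" where
  "free_zeros f k a \<longleftrightarrow> f holomorphic_on UNIV \<and>
     (\<forall>z. f z = 0 \<longleftrightarrow> (\<exists>m::int. 2 * z\<^sup>2 = of_int m * of_real pi)) \<and>
     root_mult f 0 = a \<and> (\<forall>z. z \<noteq> 0 \<longrightarrow> f z = 0 \<longrightarrow> root_mult f z = k)"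

lemma free_root_zero: "free_zeros f k a \<Longrightarrow> i \<in> {1, 2} \<Longrightarrow> f (free_root i n) = 0"
  using free_root_power2 by (auto simp: free_zeros_def)

lemma free_root_nonzero: "i \<in> {1, 2} \<Longrightarrow> n \<noteq> 0 \<Longrightarrow> free_root i n \<noteq> 0"
  using norm_free_root[of i n] by force

lemma zero_in_D_eq_free_root:
  assumes "i \<in> {1, 2}" "n \<noteq> 0" "z \<in> D i n" "2 * z\<^sup>2 = of_int m * of_real pi"
  shows "z = free_root i n"
proof -
  have z: "cmod (2 * z\<^sup>2 - of_int (root_index i n) * of_real pi) < pi / 4"
    "if i = 1 then of_int (sgn n) * Re z > 0 else of_int (sgn n) * Im z > 0"
    using assms in_D_iff by blast+
  have "m = root_index i n"
  proof (rule ccontr)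
    assume "m \<noteq> root_index i n"
    from near_multiple_unique[OF z(1) this] assms(4) pi_gt_zero show False by simp
  qed
  then have "2 * cmod (z - free_root i n) * cmod (free_root i n) \<le> 0"
    using norm_diff_free_root_le[OF assms(1) z(2)] assms(4) by simp
  then show ?thesis using free_root_nonzero[OF assms(1,2)] by (simp add: mult_le_0_iff)
qed

lemma free_root_inj:
  assumes "i \<in> {1, 2}" "j \<in> {1, 2}" "n \<noteq> 0" "k \<noteq> 0" "free_root i n = free_root j k"
  shows "i = j \<and> n = k"
  using D_disjoint[OF assms(1-4)] free_root_in_D[OF assms(1,3)] free_root_in_D[OF assms(2,4)] assms(5) by simp

text \<open>Apart from the origin the zeros in \<open>BB N\<close> are parametrized injectively by
  \<open>i\<close> and the nonzero \<open>n\<close> with modulus up to \<open>N\<close>, which makes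
  \<open>2 * 2 * N\<close> of them.\<close>

lemma root_count_free_BB:
  assumes f: "free_zeros f k a"
  shows "root_count f (BB N) = 4 * N * k + a"
proof -
  define I where "I = {1, 2::nat} \<times> ({- int N..int N} - {0})"
  have zeros: "{z \<in> BB N. f z = 0} = insert 0 ((\<lambda>(i, n). free_root i n) ` I)"
  proof (intro set_eqI iffI)
    fix z assume z: "z \<in> {z \<in> BB N. f z = 0}"
    then obtain m :: int where m: "2 * z\<^sup>2 = of_int m * of_real pi" using f by (auto simp: free_zeros_def)
    show "z \<in> insert 0 ((\<lambda>(i, n). free_root i n) ` I)"
    proof (cases "m = 0")
      case False
      have "cmod (2 * z\<^sup>2 - of_int m * of_real pi) < pi / 4" using m by simp
      from ex_D_of_near_multiple[OF this False] obtain i n where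
        i: "i \<in> {1, 2}" "n \<noteq> 0" "z \<in> D i n" by blast
      have "\<bar>n\<bar> \<le> int N" using D_disjoint_BB[OF i(1) _ i(3), of N] z by force
      moreover have "z = free_root i n" by (rule zero_in_D_eq_free_root[OF i m])
      moreover have "(i, n) \<in> I" using i calculation(1) by (simp add: I_def abs_le_iff)
      ultimately show ?thesis by (intro insertI2 image_eqI[of _ _ "(i, n)"]) simp_all
    qed (use m in auto)
  next
    fix z assume "z \<in> insert 0 ((\<lambda>(i, n). free_root i n) ` I)"
    then consider "z = 0" | i n where "i \<in> {1, 2}" "n \<noteq> 0" "\<bar>n\<bar> \<le> int N" "z = free_root i n"
      by (fastforce simp: I_def)
    then show "z \<in> {z \<in> BB N. f z = 0}"
    proof cases
      case 1
      have "\<exists>m::int. 2 * (0::complex)\<^sup>2 = of_int m * of_real pi" by (intro exI[of _ 0]) simp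
      then have "f 0 = 0" using f unfolding free_zeros_def by blast
      then show ?thesis using 1 by (simp add: in_BB_iff)
    next
      case 2
      then show ?thesis
        using D_subset_BB[OF 2(1-3) free_root_in_D[OF 2(1,2)]] free_root_zero[OF f 2(1)] by simp
    qed
  qed
  have inj: "inj_on (\<lambda>(i, n). free_root i n) I"
  proof (rule inj_onI)
    fix x y assume xy: "x \<in> I" "y \<in> I" "(case x of (i, n) \<Rightarrow> free_root i n) = (case y of (i, n) \<Rightarrow> free_root i n)"
    obtain i n where x: "x = (i, n)" by fastforce
    obtain j l where y: "y = (j, l)" by fastforce
    have "i = j \<and> n = l" using xy by (intro free_root_inj) (auto simp: x y I_def)
    then show "x = y" by (simp add: x y)
  qed
  have n0: "0 \<notin> (\<lambda>(i, n). free_root i n) ` I"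
    using free_root_nonzero by (force simp: I_def)
  have finI: "finite I" by (simp add: I_def)
  have "root_count f (BB N) = root_mult f 0 + (\<Sum>z\<in>(\<lambda>(i, n). free_root i n) ` I. root_mult f z)"
    unfolding root_count_def zeros using finI n0 by simp
  also have "(\<Sum>z\<in>(\<lambda>(i, n). free_root i n) ` I. root_mult f z) = (\<Sum>z\<in>(\<lambda>(i, n). free_root i n) ` I. k)"
  proof (rule sum.cong[OF refl])
    fix z assume z: "z \<in> (\<lambda>(i, n). free_root i n) ` I"
    then have "z \<noteq> 0" using n0 by metis
    moreover have "f z = 0" using z zeros by blast
    ultimately show "root_mult f z = k" using f by (simp add: free_zeros_def)
  qed
  also have "\<dots> = card I * k" using card_image[OF inj] by simp
  also have "card I = 4 * N"
    unfolding I_def card_cartesian_product by (simp add: card_Diff_singleton)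
  finally show ?thesis using f by (simp add: free_zeros_def)
qed

text \<open>The comparison is assumed outside \<open>BB N\<close> and away from the multiples of pi.
  This region contains the small circles with index beyond \<open>N\<close> and the boundary of
  \<open>BB N\<close>, so Rouche's theorem gives all counts; and \<open>F\<close> has no zero in the
  region, which excludes further ones.\<close>

proposition localized_of_perturbation:
  assumes f: "free_zeros f k a" and F: "F holomorphic_on UNIV"
    and less: "\<And>z. z \<notin> BB N \<Longrightarrow> (\<And>m::int. 1 / 4 \<le> cmod (2 * z\<^sup>2 - of_int m * of_real pi)) \<Longrightarrow> cmod (F z - f z) < cmod (f z)"
  shows "localized F k (4 * N * k + a) N"
proof -
  have holf: "f holomorphic_on UNIV" using f by (simp add: free_zeros_def)
  have near: "\<exists>m::int. cmod (2 * z\<^sup>2 - of_int m * of_real pi) < 1 / 4" if "F z = 0" "z \<notin> BB N" for z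
  proof (rule ccontr)
    assume "\<nexists>m::int. cmod (2 * z\<^sup>2 - of_int m * of_real pi) < 1 / 4"
    then have "cmod (F z - f z) < cmod (f z)" by (intro less that(2)) (auto simp: not_less)
    then show False using that(1) by simp
  qed
  have pi14: "1 / 4 < pi / 4" using pi_gt3 by simp
  have D: "root_count F (D i n) = k" if i: "i \<in> {1, 2}" and n: "\<bar>n\<bar> > int N" for i n
  proof -
    have n0: "n \<noteq> 0" using n by auto
    define B where "B = ball (free_root i n) (circle_radius n)"
    have BD: "B \<subseteq> D i n" using cball_circle_subset_D[OF i n0] ball_subset_cball unfolding B_def by blast
    have "z \<in> B" if z: "z \<in> D i n" "F z = 0" for z
    proof -
      obtain m :: int where m: "cmod (2 * z\<^sup>2 - of_int m * of_real pi) < 1 / 4"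
        using near[OF z(2) D_disjoint_BB[OF i n z(1)]] by blast
      have zD: "cmod (2 * z\<^sup>2 - of_int (root_index i n) * of_real pi) < pi / 4"
        using z(1) in_D_iff[OF i n0] by blast
      have "m = root_index i n" using near_multiple_unique[OF zD, of m] m pi14 by force
      then show ?thesis using near_imp_in_circle[OF i n0 z(1)] m by (simp add: B_def)
    qed
    then have "{z \<in> D i n. F z = 0} = {z \<in> B. F z = 0}" using BD by auto
    then have "root_count F (D i n) = root_count F B" by (simp add: root_count_def)
    also have "\<dots> = root_count f B"
      unfolding B_def
    proof (rule root_count_ball_eq[OF F holf circle_radius_pos[OF n0]])
      fix z assume z: "cmod (z - free_root i n) = circle_radius n"
      then have "z \<in> D i n" using cball_circle_subset_D[OF i n0] by (auto simp: dist_norm norm_minus_commute subset_iff)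
      then show "cmod (F z - f z) < cmod (f z)"
        by (intro less D_disjoint_BB[OF i n] circle_away[OF i n0 z])
    qed
    also have "\<dots> = k"
    proof -
      have "{z \<in> B. f z = 0} = {free_root i n}"
      proof (intro set_eqI iffI)
        fix z assume z: "z \<in> {z \<in> B. f z = 0}"
        then obtain m :: int where "2 * z\<^sup>2 = of_int m * of_real pi" using f by (auto simp: free_zeros_def)
        then show "z \<in> {free_root i n}" using zero_in_D_eq_free_root[OF i n0] z BD by auto
      next
        fix z assume "z \<in> {free_root i n}"
        then show "z \<in> {z \<in> B. f z = 0}"
          using free_root_zero[OF f i] circle_radius_pos[OF n0] by (simp add: B_def)
      qed
      moreover have "root_mult f (free_root i n) = k"
        using f free_root_zero[OF f i, of n] free_root_nonzero[OF i n0] by (simp add: free_zeros_def)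
      ultimately show ?thesis by (simp add: root_count_def)
    qed
    finally show ?thesis .
  qed
  have BBc: "root_count F (BB N) = 4 * N * k + a"
  proof -
    define \<rho> where "\<rho> = sqrt ((real N + 1 / 4) * pi / 2)"
    have \<rho>: "\<rho> > 0" "2 * \<rho>\<^sup>2 = (real N + 1 / 4) * pi" by (simp_all add: \<rho>_def add_nonneg_pos)
    have "root_count F (ball 0 \<rho>) = root_count f (ball 0 \<rho>)"
    proof (rule root_count_ball_eq[OF F holf \<rho>(1)])
      fix z :: complex assume "cmod (z - 0) = \<rho>"
      then have z: "2 * (cmod z)\<^sup>2 = (real N + 1 / 4) * pi" using \<rho> by simp
      show "cmod (F z - f z) < cmod (f z)"
      proof (rule less)
        show "z \<notin> BB N" by (simp add: in_BB_iff z)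
        fix m :: int
        \<comment> \<open>On this circle \<open>2 * cmod (z\<^sup>2)\<close> is
          \<open>(N + 1 / 4) * pi\<close>, at distance at least \<open>pi / 4\<close> from every
          multiple of pi.\<close>
        show "1 / 4 \<le> cmod (2 * z\<^sup>2 - of_int m * of_real pi)"
        proof (rule ccontr)
          assume "\<not> ?thesis"
          then have "cmod (2 * z\<^sup>2 - of_int m * of_real pi) < pi / 4" using pi14 by linarith
          note s = near_multiple_size[OF this, unfolded z]
          have "\<bar>of_int m\<bar> * pi < (real N + 1 / 2) * pi" using s(1) by (simp add: algebra_simps)
          then have "real_of_int \<bar>m\<bar> < real N + 1 / 2" by simp
          then have "\<bar>m\<bar> \<le> int N" by linarith
          then have "\<bar>of_int m\<bar> * pi \<le> real N * pi" by (intro mult_right_mono) (linarith, simp)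
          then show False using s(2) by (simp add: algebra_simps)
        qed
      qed
    qed
    then show ?thesis using root_count_free_BB[OF f, of N] by (simp add: BB_def \<rho>_def)
  qed
  have rest: "z \<in> BB N \<or> (\<exists>i\<in>{1, 2}. \<exists>n. \<bar>n\<bar> > int N \<and> z \<in> D i n)" if z: "F z = 0" for z
  proof (cases "z \<in> BB N")
    case zN: False
    obtain m :: int where m: "cmod (2 * z\<^sup>2 - of_int m * of_real pi) < 1 / 4" using near[OF z zN] by blast
    then have m': "cmod (2 * z\<^sup>2 - of_int m * of_real pi) < pi / 4" using pi14 by linarith
    have "m \<noteq> 0"
    proof
      assume "m = 0"
      then have "2 * (cmod z)\<^sup>2 < pi / 4" using near_multiple_size(2)[OF m'] by simp
      also have "\<dots> \<le> (real N + 1 / 4) * pi" by (simp add: algebra_simps)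
      finally show False using zN by (simp add: in_BB_iff)
    qed
    from ex_D_of_near_multiple[OF m' this] obtain i n where
      i: "i \<in> {1, 2}" "n \<noteq> 0" "z \<in> D i n" by blast
    then have "\<bar>n\<bar> > int N" using D_subset_BB[OF i(1,2) _ i(3), of N] zN by force
    then show ?thesis using i by blast
  qed simp
  show ?thesis unfolding localized_def using D BBc rest by blast
qed

text \<open>The local factorization from which \<open>zorder\<close> is read off:
  \<open>sin w = w * h w\<close> with \<open>h 0 = 1\<close>, and
  \<open>2 * z\<^sup>2 - 2 * r\<^sup>2\<close> is \<open>2 * (z - r) * (z + r)\<close>, whose zero
  is double exactly when \<open>r = 0\<close>.\<close>

lemma sin_square_factor:
  fixes r :: complex
  assumes r: "2 * r\<^sup>2 = of_int m * of_real pi"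
  shows "\<exists>g S. open S \<and> r \<in> S \<and> g holomorphic_on S \<and> g r \<noteq> 0 \<and>
    (\<forall>z\<in>S. sin (2 * z\<^sup>2) = g z * (z - r) ^ (if r = 0 then 2 else 1))"
proof -
  have "(sin :: complex \<Rightarrow> complex) holomorphic_on ball 0 1" by (intro holomorphic_intros)
  then obtain h :: "complex \<Rightarrow> complex" where h: "h holomorphic_on ball 0 1"
    "\<And>z. cmod z < 1 \<Longrightarrow> sin z = z * h z" "deriv sin 0 = h 0"
    using Schwarz3[of sin 1] sin_zero by blast
  have h0: "h 0 = 1" using h(3) by (simp add: DERIV_imp_deriv[OF DERIV_sin])
  define S where "S = {z. cmod (2 * z\<^sup>2 - of_int m * of_real pi) < 1}"
  define g where "g = (\<lambda>z. (-1) powi m * (if r = 0 then 2 else 2 * (z + r)) * h (2 * z\<^sup>2 - of_int m * of_real pi))"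
  have "open S" unfolding S_def by (intro open_Collect_less continuous_intros)
  moreover have "r \<in> S" using r by (simp add: S_def)
  moreover have "g holomorphic_on S"
  proof -
    have "(\<lambda>z. h (2 * z\<^sup>2 - of_int m * of_real pi)) holomorphic_on S"
      by (rule holomorphic_on_compose_gen[OF _ h(1), unfolded o_def]) (auto intro!: holomorphic_intros simp: S_def)
    then show ?thesis unfolding g_def by (cases "r = 0") (auto intro!: holomorphic_intros)
  qed
  moreover have "g r \<noteq> 0" using r h0 by (simp add: g_def)
  moreover have "sin (2 * z\<^sup>2) = g z * (z - r) ^ (if r = 0 then 2 else 1)" if "z \<in> S" for z
  proof -
    have e: "(-1) powi m * (-1) powi m = (1::complex)" by (cases "even m") (simp_all add: power_int_minus_left)
    have "sin (2 * z\<^sup>2) = ((-1) powi m * (-1) powi m) * sin (2 * z\<^sup>2)" by (simp add: e)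
    also have "\<dots> = (-1) powi m * sin (2 * z\<^sup>2 - of_int m * of_real pi)"
      unfolding sin_diff_int_pi by (simp only: mult.assoc)
    also have "sin (2 * z\<^sup>2 - of_int m * of_real pi) = (2 * z\<^sup>2 - of_int m * of_real pi) * h (2 * z\<^sup>2 - of_int m * of_real pi)"
      using that by (intro h(2)) (simp add: S_def)
    also have "2 * z\<^sup>2 - of_int m * of_real pi = (if r = 0 then 2 else 2 * (z + r)) * (z - r) ^ (if r = 0 then 2 else 1)"
      unfolding r[symmetric] by (simp add: power2_eq_square algebra_simps)
    then have "(2 * z\<^sup>2 - of_int m * of_real pi) * h (2 * z\<^sup>2 - of_int m * of_real pi) =
      (if r = 0 then 2 else 2 * (z + r)) * (z - r) ^ (if r = 0 then 2 else 1) * h (2 * z\<^sup>2 - of_int m * of_real pi)"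
      by (simp only:)
    finally show ?thesis unfolding g_def by (simp only: mult_ac)
  qed
  ultimately show ?thesis by blast
qed

lemma sin_square_eq_0_iff: "sin (2 * z\<^sup>2) = 0 \<longleftrightarrow> (\<exists>m::int. 2 * z\<^sup>2 = of_int m * of_real pi)" for z :: complex
  by (simp add: sin_eq_0)

section \<open>Zeros of the two free functions\<close>

lemma free_zeros_periodic: "free_zeros (\<lambda>z. (2 * cos (2 * z\<^sup>2))\<^sup>2 - 4) 2 4"
proof -
  let ?f = "\<lambda>z::complex. (2 * cos (2 * z\<^sup>2))\<^sup>2 - 4"
  have eq: "?f z = - 4 * (sin (2 * z\<^sup>2))\<^sup>2" for z
    by (simp add: power_mult_distrib cos_squared_eq)
  have zero: "?f z = 0 \<longleftrightarrow> (\<exists>m::int. 2 * z\<^sup>2 = of_int m * of_real pi)" for z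
    unfolding eq by (simp flip: sin_square_eq_0_iff)
  have mult: "root_mult ?f r = (if r = 0 then 4 else 2)" if r: "2 * r\<^sup>2 = of_int m * of_real pi" for r m
  proof -
    obtain g S where g: "open S" "r \<in> S" "g holomorphic_on S" "g r \<noteq> 0"
      "\<And>z. z \<in> S \<Longrightarrow> sin (2 * z\<^sup>2) = g z * (z - r) ^ (if r = 0 then 2 else 1)"
      using sin_square_factor[OF r] by blast
    have "zorder ?f r = (if r = 0 then 4 else 2)"
    proof (rule zorder_eqI[OF g(1,2)])
      show "(\<lambda>z. - 4 * (g z)\<^sup>2) holomorphic_on S" by (intro holomorphic_intros g)
      show "- 4 * (g r)\<^sup>2 \<noteq> 0" using g by simp
      show "?f w = - 4 * (g w)\<^sup>2 * (w - r) powi (if r = 0 then 4 else 2)" if "w \<in> S" for w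
        unfolding eq g(5)[OF that] by (simp add: power_mult_distrib flip: power_mult)
    qed
    moreover have "?f r = 0" using zero r by blast
    ultimately show ?thesis by (simp add: root_mult_def)
  qed
  show ?thesis
    unfolding free_zeros_def
  proof (intro conjI allI impI)
    show "?f holomorphic_on UNIV" by (intro holomorphic_intros)
    show "root_mult ?f 0 = 4" using mult[of 0 0] by simp
    fix z :: complex assume "z \<noteq> 0" "?f z = 0"
    then show "root_mult ?f z = 2" using mult[of z] zero[of z] by auto
  qed (rule zero)
qed

lemma free_zeros_critical: "free_zeros (\<lambda>z. - 8 * z * sin (2 * z\<^sup>2)) 1 3"
proof -
  let ?f = "\<lambda>z::complex. - 8 * z * sin (2 * z\<^sup>2)"
  have "\<exists>m::int. 2 * z\<^sup>2 = of_int m * of_real pi" if "z = 0" for z :: complex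
    using that by (intro exI[of _ 0]) simp
  then have zero: "?f z = 0 \<longleftrightarrow> (\<exists>m::int. 2 * z\<^sup>2 = of_int m * of_real pi)" for z
    by (auto simp flip: sin_square_eq_0_iff)
  have mult: "root_mult ?f r = (if r = 0 then 3 else 1)" if r: "2 * r\<^sup>2 = of_int m * of_real pi" for r m
  proof -
    obtain g S where g: "open S" "r \<in> S" "g holomorphic_on S" "g r \<noteq> 0"
      "\<And>z. z \<in> S \<Longrightarrow> sin (2 * z\<^sup>2) = g z * (z - r) ^ (if r = 0 then 2 else 1)"
      using sin_square_factor[OF r] by blast
    have "zorder ?f r = (if r = 0 then 3 else 1)"
    proof (rule zorder_eqI[OF g(1,2)])
      show "(\<lambda>z. - 8 * (if r = 0 then 1 else z) * g z) holomorphic_on S"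
        by (cases "r = 0") (auto intro!: holomorphic_intros g)
      show "- 8 * (if r = 0 then 1 else r) * g r \<noteq> 0" using g by simp
      show "?f w = - 8 * (if r = 0 then 1 else w) * g w * (w - r) powi (if r = 0 then 3 else 1)" if "w \<in> S" for w
        unfolding g(5)[OF that] by (simp add: power2_eq_square power3_eq_cube)
    qed
    moreover have "?f r = 0" using zero r by blast
    ultimately show ?thesis by (simp add: root_mult_def)
  qed
  show ?thesis
    unfolding free_zeros_def
  proof (intro conjI allI impI)
    show "?f holomorphic_on UNIV" by (intro holomorphic_intros)
    show "root_mult ?f 0 = 3" using mult[of 0 0] by simp
    fix z :: complex assume "z \<noteq> 0" "?f z = 0"
    then show "root_mult ?f z = 1" using mult[of z] zero[of z] by auto
  qed (rule zero)
qed

lemma norm_cos_le_growth: "cmod (cos (2 * z\<^sup>2)) \<le> growth z"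
proof -
  have "cos (2 * z\<^sup>2) = (exp (2 * \<i> * z\<^sup>2) + exp (- 2 * \<i> * z\<^sup>2)) / 2"
    by (simp add: cos_exp_eq mult_ac)
  also have "cmod \<dots> \<le> (growth z + growth z) / 2"
    unfolding norm_divide norm_numeral
    by (intro divide_right_mono order_trans[OF norm_triangle_ineq] add_mono norm_exp_le_growth) simp
  finally show ?thesis by simp
qed

lemma growth_le_norm_sin:
  assumes "\<And>m::int. 1 / 4 \<le> cmod (2 * z\<^sup>2 - of_int m * of_real pi)"
  shows "growth z / 8 \<le> cmod (sin (2 * z\<^sup>2))"
  unfolding growth_def by (rule norm_sin_ge[OF assms])

lemma holomorphic_chi_P: "chi_P \<psi> holomorphic_on A"
  unfolding chi_P_def[abs_def] by (intro holomorphic_intros holomorphic_discr)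

lemma holomorphic_deriv_discr: "deriv (discr \<psi>) holomorphic_on A"
  by (rule holomorphic_on_subset[OF holomorphic_deriv[OF holomorphic_discr open_UNIV]]) simp

lemma periodic_localized:
  assumes "\<And>z. z \<notin> BB N \<Longrightarrow> cmod (discr \<psi> z - 2 * cos (2 * z\<^sup>2)) \<le> growth z / 100"
  shows "localized (chi_P \<psi>) 2 (4 * (2 * N + 1)) N"
proof -
  have "localized (chi_P \<psi>) 2 (4 * N * 2 + 4) N"
  proof (rule localized_of_perturbation[OF free_zeros_periodic holomorphic_chi_P])
    fix z assume z: "z \<notin> BB N" "\<And>m::int. 1 / 4 \<le> cmod (2 * z\<^sup>2 - of_int m * of_real pi)"
    define g where "g = growth z"
    define d where "d = discr \<psi> z - 2 * cos (2 * z\<^sup>2)"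
    have g1: "1 \<le> g" unfolding g_def by (rule growth_ge_1)
    have d: "cmod d \<le> g / 100" unfolding d_def g_def by (rule assms[OF z(1)])
    have "chi_P \<psi> z - ((2 * cos (2 * z\<^sup>2))\<^sup>2 - 4) = d * (d + 4 * cos (2 * z\<^sup>2))"
      by (simp add: chi_P_def d_def power2_eq_square algebra_simps)
    also have "cmod \<dots> \<le> g / 100 * (g / 100 + 4 * g)"
      unfolding norm_mult[of d]
    proof (intro mult_mono d)
      have "cmod (d + 4 * cos (2 * z\<^sup>2)) \<le> cmod d + 4 * cmod (cos (2 * z\<^sup>2))"
        using norm_triangle_ineq[of d "4 * cos (2 * z\<^sup>2)"] by (simp add: norm_mult)
      then show "cmod (d + 4 * cos (2 * z\<^sup>2)) \<le> g / 100 + 4 * g"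
        using d norm_cos_le_growth[of z] unfolding g_def by argo
    qed (use g1 in auto)
    \<comment> \<open>Here the constant \<open>100\<close> is settled: the left side is
      \<open>401 / 10000 * g\<^sup>2\<close>, the right side \<open>g\<^sup>2 / 16\<close>.\<close>
    also have "\<dots> < 4 * (g / 8)\<^sup>2" using g1 by (simp add: power2_eq_square)
    also have "\<dots> \<le> 4 * (cmod (sin (2 * z\<^sup>2)))\<^sup>2"
      using growth_le_norm_sin[OF z(2)] g1 by (intro mult_left_mono power_mono) (auto simp: g_def)
    also have "\<dots> = cmod ((2 * cos (2 * z\<^sup>2))\<^sup>2 - 4)"
    proof -
      have "(2 * cos (2 * z\<^sup>2))\<^sup>2 - 4 = - 4 * (sin (2 * z\<^sup>2))\<^sup>2" by (simp add: power_mult_distrib cos_squared_eq)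
      then show ?thesis by (simp add: norm_mult norm_power)
    qed
    finally show "cmod (chi_P \<psi> z - ((2 * cos (2 * z\<^sup>2))\<^sup>2 - 4)) < cmod ((2 * cos (2 * z\<^sup>2))\<^sup>2 - 4)" .
  qed
  then show ?thesis by (simp add: algebra_simps)
qed

lemma critical_localized:
  assumes "\<And>z. z \<notin> BB N \<Longrightarrow> cmod (deriv (discr \<psi>) z - (- 8 * z * sin (2 * z\<^sup>2))) < cmod z * growth z"
  shows "localized (deriv (discr \<psi>)) 1 (4 * N + 3) N"
proof -
  have "localized (deriv (discr \<psi>)) 1 (4 * N * 1 + 3) N"
  proof (rule localized_of_perturbation[OF free_zeros_critical holomorphic_deriv_discr])
    fix z assume z: "z \<notin> BB N" "\<And>m::int. 1 / 4 \<le> cmod (2 * z\<^sup>2 - of_int m * of_real pi)"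
    \<comment> \<open>The \<open>8\<close> of the free derivative compensates the
      \<open>1 / 8\<close> in the lower bound for the sine.\<close>
    have "cmod z * growth z \<le> cmod z * (8 * cmod (sin (2 * z\<^sup>2)))"
      using growth_le_norm_sin[OF z(2)] by (intro mult_left_mono) auto
    then have "cmod z * growth z \<le> cmod (- 8 * z * sin (2 * z\<^sup>2))" by (simp add: norm_mult mult_ac)
    with assms[OF z(1)] show "cmod (deriv (discr \<psi>) z - (- 8 * z * sin (2 * z\<^sup>2))) < cmod (- 8 * z * sin (2 * z\<^sup>2))"
      by linarith
  qed
  then show ?thesis by simp
qed

lemma not_in_BB_norm_ge:
  assumes "z \<notin> BB N"
  shows "1 / 2 \<le> cmod z" and "sqrt (real N) \<le> cmod z"
proof -
  have z: "(real N + 1 / 4) * pi \<le> 2 * (cmod z)\<^sup>2" using assms by (simp add: in_BB_iff)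
  have "(real N + 1 / 4) * 2 \<le> (real N + 1 / 4) * pi" using pi_gt3 by (intro mult_left_mono) auto
  with z have z': "real N + 1 / 4 \<le> (cmod z)\<^sup>2" by argo
  then have "(1 / 2)\<^sup>2 \<le> (cmod z)\<^sup>2" by (simp add: power2_eq_square)
  then show "1 / 2 \<le> cmod z" by (rule power2_le_imp_le) simp
  show "sqrt (real N) \<le> cmod z" using z' by (intro real_le_lsqrt) auto
qed

lemma localized_uniformly:
  assumes "R > 0"
  shows "\<exists>N. \<forall>\<psi>. norm \<psi> < R \<longrightarrow> localized (chi_P \<psi>) 2 (4 * (2 * N + 1)) N \<and>
     localized (deriv (discr \<psi>)) 1 (4 * N + 3) N"
proof -
  obtain C1 where C1: "C1 > 0" "\<And>\<psi> z. norm \<psi> < R \<Longrightarrow>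
      cmod (discr \<psi> z - 2 * cos (2 * z\<^sup>2)) \<le> C1 * norm \<psi> * growth z / (1 + cmod z)"
    using discr_asymptotics[OF assms] by blast
  obtain C2 where C2: "C2 > 0" "\<And>\<psi> z. norm \<psi> < R \<Longrightarrow>
      cmod (deriv (discr \<psi>) z - (- 8 * z * sin (2 * z\<^sup>2))) \<le> C2 * norm \<psi> * growth z"
    using deriv_discr_asymptotics[OF assms] by blast
  \<comment> \<open>The first entry makes the error of \<open>discr\<close> at most
    \<open>growth z / 100\<close>, the second makes \<open>C2 * R\<close> strictly smaller than
    \<open>cmod z\<close>. Choosing \<open>N\<close> above \<open>L\<^sup>2\<close> enforces both
    outside \<open>BB N\<close>.\<close>
  define L where "L = max (100 * C1 * R) (C2 * R + 1)"
  obtain N :: nat where N: "L\<^sup>2 \<le> real N" using real_arch_simple by blast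
  have L: "L \<le> cmod z" if "z \<notin> BB N" for z
  proof -
    have "L \<le> sqrt (real N)" using N by (rule real_le_rsqrt)
    then show ?thesis using not_in_BB_norm_ge(2)[OF that] by linarith
  qed
  have "localized (chi_P \<psi>) 2 (4 * (2 * N + 1)) N" if \<psi>: "norm \<psi> < R" for \<psi>
  proof (rule periodic_localized)
    fix z assume z: "z \<notin> BB N"
    have "100 * (C1 * norm \<psi>) \<le> 100 * (C1 * R)" using \<psi> C1(1) by simp
    then have "100 * (C1 * norm \<psi>) \<le> 1 + cmod z" using L[OF z] by (simp add: L_def)
    then have "growth z * (100 * (C1 * norm \<psi>)) \<le> growth z * (1 + cmod z)"
      using growth_ge_1[of z] by (intro mult_left_mono) auto
    moreover have "1 + cmod z > 0" by (simp add: add_pos_nonneg)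
    ultimately have "C1 * norm \<psi> * growth z / (1 + cmod z) \<le> growth z / 100"
      by (simp add: divide_le_eq mult_ac)
    then show "cmod (discr \<psi> z - 2 * cos (2 * z\<^sup>2)) \<le> growth z / 100"
      using C1(2)[OF \<psi>, of z] by linarith
  qed
  moreover have "localized (deriv (discr \<psi>)) 1 (4 * N + 3) N" if \<psi>: "norm \<psi> < R" for \<psi>
  proof (rule critical_localized)
    fix z assume z: "z \<notin> BB N"
    have "C2 * norm \<psi> \<le> C2 * R" using \<psi> C2(1) by simp
    also have "\<dots> < cmod z" using L[OF z] by (simp add: L_def)
    finally have "C2 * norm \<psi> * growth z < cmod z * growth z"
      using growth_ge_1[of z] by (intro mult_strict_right_mono) auto
    then show "cmod (deriv (discr \<psi>) z - (- 8 * z * sin (2 * z\<^sup>2))) < cmod z * growth z"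
      using C2(2)[OF \<psi>, of z] by linarith
  qed
  ultimately show ?thesis by blast
qed

lemma localized_near_zero:
  "\<exists>\<delta>>0. \<forall>\<psi>. norm \<psi> < \<delta> \<longrightarrow> localized (chi_P \<psi>) 2 4 0 \<and> localized (deriv (discr \<psi>)) 1 3 0 \<and>
     (\<forall>z. cmod (discr \<psi> z - 2 * cos (2 * z\<^sup>2)) \<le> growth z / 100)"
proof -
  obtain C1 where C1: "C1 > 0" "\<And>\<psi> z. norm \<psi> < 1 \<Longrightarrow>
      cmod (discr \<psi> z - 2 * cos (2 * z\<^sup>2)) \<le> C1 * norm \<psi> * growth z / (1 + cmod z)"
    using discr_asymptotics[of 1] by auto
  obtain C2 where C2: "C2 > 0" "\<And>\<psi> z. norm \<psi> < 1 \<Longrightarrow>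
      cmod (deriv (discr \<psi>) z - (- 8 * z * sin (2 * z\<^sup>2))) \<le> C2 * norm \<psi> * growth z"
    using deriv_discr_asymptotics[of 1] by auto
  \<comment> \<open>Now \<open>norm \<psi>\<close> instead of \<open>cmod z\<close> provides the
    smallness. The factor \<open>2\<close> beside \<open>C2\<close> matches the lower bound
    \<open>1 / 2\<close> for \<open>cmod z\<close> outside \<open>BB 0\<close>.\<close>
  define \<delta> where "\<delta> = min 1 (min (1 / (100 * C1)) (1 / (2 * C2)))"
  have "\<delta> > 0" using C1(1) C2(1) by (simp add: \<delta>_def)
  moreover have d: "cmod (discr \<psi> z - 2 * cos (2 * z\<^sup>2)) \<le> growth z / 100" if \<psi>: "norm \<psi> < \<delta>" for \<psi> z
  proof -
    have n: "norm \<psi> < 1" "norm \<psi> < 1 / (100 * C1)" using \<psi> by (auto simp: \<delta>_def)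
    have "C1 * norm \<psi> \<le> 1 / 100" using n(2) C1(1) by (simp add: field_simps)
    then have 1: "C1 * norm \<psi> * growth z \<le> 1 / 100 * growth z"
      using growth_ge_1[of z] by (intro mult_right_mono) auto
    have "C1 * norm \<psi> * growth z / (1 + cmod z) \<le> C1 * norm \<psi> * growth z / 1"
      using C1(1) growth_ge_1[of z] by (intro divide_left_mono) (auto simp: add_pos_nonneg)
    then show ?thesis using C1(2)[OF n(1), of z] 1 by linarith
  qed
  moreover have "localized (chi_P \<psi>) 2 4 0" if "norm \<psi> < \<delta>" for \<psi>
    using periodic_localized[of 0 \<psi>] d[OF that] by simp
  moreover have "localized (deriv (discr \<psi>)) 1 3 0" if \<psi>: "norm \<psi> < \<delta>" for \<psi>
  proof -
    have n: "norm \<psi> < 1" "norm \<psi> < 1 / (2 * C2)" using \<psi> by (auto simp: \<delta>_def)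
    have c: "C2 * norm \<psi> < 1 / 2" using n(2) C2(1) by (simp add: field_simps)
    have "cmod (deriv (discr \<psi>) z - (- 8 * z * sin (2 * z\<^sup>2))) < cmod z * growth z" if z: "z \<notin> BB 0" for z
    proof -
      have "C2 * norm \<psi> < cmod z" using c not_in_BB_norm_ge(1)[OF z] by linarith
      then have "C2 * norm \<psi> * growth z < cmod z * growth z"
        using growth_ge_1[of z] by (intro mult_strict_right_mono) auto
      then show ?thesis using C2(2)[OF n(1), of z] by linarith
    qed
    from critical_localized[of 0 \<psi>, OF this] show ?thesis by simp
  qed
  ultimately show ?thesis by blast
qed

section \<open>Deviation from the free roots\<close>

lemma near_multiple_growth:
  assumes "cmod (2 * z\<^sup>2 - of_int m * of_real pi) < pi / 4"
  shows "growth z \<le> 3"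
proof -
  have "\<bar>Im (2 * z\<^sup>2)\<bar> \<le> cmod (2 * z\<^sup>2 - of_int m * of_real pi)"
    using abs_Im_le_cmod[of "2 * z\<^sup>2 - of_int m * of_real pi"] by simp
  then have "\<bar>Im (2 * z\<^sup>2)\<bar> \<le> 1" using assms pi_less_4 by linarith
  then have "growth z \<le> exp 1" unfolding growth_def by simp
  then show ?thesis using exp_le by linarith
qed

text \<open>The distance \<open>u\<close> of \<open>2 * z\<^sup>2\<close> from its free value
  satisfies \<open>cmod u \<le> 2 * cmod (sin (2 * z\<^sup>2))\<close>, and \<open>z\<close> itself
  is off by at most \<open>cmod u / (2 * cmod (free_root i n))\<close>. Both \<open>cmod z\<close>
  and \<open>cmod (free_root i n)\<close> are at least \<open>sqrt \<bar>n\<bar>\<close>, so their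
  product accounts for the full \<open>\<bar>n\<bar>\<close>.\<close>

lemma diff_free_root_bound:
  assumes i: "i \<in> {1, 2}" and n: "n \<noteq> 0" and z: "z \<in> D i n"
    and K: "cmod (sin (2 * z\<^sup>2)) * cmod z \<le> K"
  shows "cmod (z - free_root i n) \<le> K / of_int \<bar>n\<bar>"
proof -
  define u where "u = 2 * z\<^sup>2 - of_int (root_index i n) * of_real pi"
  have u: "cmod u < pi / 4" and sg: "if i = 1 then of_int (sgn n) * Re z > 0 else of_int (sgn n) * Im z > 0"
    using z in_D_iff[OF i n] unfolding u_def by blast+
  have "cmod (sin u) = cmod (sin (2 * z\<^sup>2))"
    unfolding u_def sin_diff_int_pi norm_mult norm_powi_minus_one by simp
  then have 1: "cmod u \<le> 2 * cmod (sin (2 * z\<^sup>2))" using norm_sin_ge_near[of u] u by simp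
  have n1: "1 \<le> (of_int \<bar>n\<bar> :: real)" using n by linarith
  have fr: "sqrt (of_int \<bar>n\<bar>) \<le> cmod (free_root i n)"
    unfolding norm_free_root[OF i] using n1 mult_left_mono[of 2 pi "of_int \<bar>n\<bar>"] pi_gt3
    by (intro real_sqrt_le_mono) simp
  have zn: "sqrt (of_int \<bar>n\<bar>) \<le> cmod z"
  proof -
    have "\<bar>of_int (root_index i n)\<bar> * pi - pi / 4 < 2 * (cmod z)\<^sup>2"
      using near_multiple_size(1)[of z "root_index i n"] u unfolding u_def by blast
    moreover have "\<bar>of_int (root_index i n) :: real\<bar> = of_int \<bar>n\<bar>" by (metis abs_root_index of_int_abs)
    ultimately have "of_int \<bar>n\<bar> * pi - pi / 4 < 2 * (cmod z)\<^sup>2" by (simp only:)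
    moreover have "(of_int \<bar>n\<bar> - 1 / 4) * 3 \<le> (of_int \<bar>n\<bar> - 1 / 4) * pi"
      using n1 pi_gt3 by (intro mult_left_mono) auto
    ultimately have "of_int \<bar>n\<bar> \<le> (cmod z)\<^sup>2" using n1 by argo
    then show ?thesis by (intro real_le_lsqrt) auto
  qed
  have "cmod (z - free_root i n) * of_int \<bar>n\<bar> = cmod (z - free_root i n) * (sqrt (of_int \<bar>n\<bar>) * sqrt (of_int \<bar>n\<bar>))"
    by (simp add: real_sqrt_mult_self)
  also have "\<dots> \<le> cmod (z - free_root i n) * (cmod (free_root i n) * cmod z)"
    by (intro mult_left_mono mult_mono fr zn) auto
  also have "\<dots> = (cmod (z - free_root i n) * cmod (free_root i n)) * cmod z" by simp
  also have "\<dots> \<le> cmod (sin (2 * z\<^sup>2)) * cmod z"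
    using norm_diff_free_root_le[OF i sg] 1 unfolding u_def by (intro mult_right_mono) auto
  also have "\<dots> \<le> K" by (rule K)
  finally show ?thesis using n1 by (simp add: le_divide_eq)
qed

lemma periodic_eigenvalue_bound:
  "\<exists>C\<ge>0. \<forall>\<psi> z i n. norm \<psi> \<le> R \<longrightarrow> i \<in> {1, 2} \<longrightarrow> n \<noteq> 0 \<longrightarrow> z \<in> D i n \<longrightarrow> chi_P \<psi> z = 0 \<longrightarrow>
     cmod (z - free_root i n) \<le> C / of_int \<bar>n\<bar>"
proof -
  obtain C where C: "C > 0" "\<And>\<psi> z i j. norm \<psi> \<le> R \<Longrightarrow>
      cmod (lax_solution \<psi> z i j 1 - free_lax z i j) \<le> C * growth z / (1 + cmod z)"
    using lax_solution_asymptotics[of R] by blast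
  have "cmod (z - free_root i n) \<le> 6 * C / of_int \<bar>n\<bar>"
    if \<psi>: "norm \<psi> \<le> R" and i: "i \<in> {1, 2}" and n: "n \<noteq> 0" and z: "z \<in> D i n" and chi: "chi_P \<psi> z = 0" for \<psi> z i n
  proof (rule diff_free_root_bound[OF i n z])
    define b where "b = 3 * C / (1 + cmod z)"
    have pos: "1 + cmod z > 0" by (simp add: add_pos_nonneg)
    have "growth z \<le> 3" using near_multiple_growth z in_D_iff[OF i n] by blast
    then have "C * growth z / (1 + cmod z) \<le> b" unfolding b_def using C(1) pos by (intro divide_right_mono) auto
    then have b: "cmod (lax_solution \<psi> z i j 1 - free_lax z i j) \<le> b" for i j
      using C(2)[OF \<psi>, of z i j] by linarith
    have b0: "0 \<le> b" using order_trans[OF norm_ge_zero b] .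
    define m11 m12 m21 m22 where "m11 = lax_solution \<psi> z 1 1 1" "m12 = lax_solution \<psi> z 1 2 1"
      "m21 = lax_solution \<psi> z 2 1 1" "m22 = lax_solution \<psi> z 2 2 1"
    note m = this
    have "(m11 - m22)\<^sup>2 = (m11 + m22)\<^sup>2 - 4 * (m11 * m22 - m12 * m21) - 4 * (m12 * m21)"
      by (simp add: power2_eq_square algebra_simps)
    also have "m11 * m22 - m12 * m21 = 1" unfolding m by (rule lax_solution_det)
    also have "(m11 + m22)\<^sup>2 - 4 * 1 = 0" using chi by (simp add: chi_P_def discr_eq m)
    finally have "(m11 - m22)\<^sup>2 = - 4 * (m12 * m21)" by simp
    then have "(cmod (m11 - m22))\<^sup>2 = 4 * (cmod m12 * cmod m21)"
      by (metis norm_power norm_mult norm_minus_cancel norm_numeral mult_minus_left)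
    also have "\<dots> \<le> 4 * (b * b)"
      using b[of 1 2] b[of 2 1] b0 by (intro mult_left_mono mult_mono) (auto simp: free_lax_def m)
    finally have "(cmod (m11 - m22))\<^sup>2 \<le> (2 * b)\<^sup>2" by (simp add: power2_eq_square)
    then have d: "cmod (m11 - m22) \<le> 2 * b" by (rule power2_le_imp_le) (use b0 in simp)
    have "free_lax z 1 1 - free_lax z 2 2 = - 2 * \<i> * sin (2 * z\<^sup>2)"
    proof -
      have "- 2 * \<i> * ((A - B) / (2 * \<i>)) = B - A" for A B :: complex by (simp add: field_simps)
      moreover have "exp (- 2 * \<i> * z\<^sup>2) = exp (- (\<i> * (2 * z\<^sup>2)))" "exp (2 * \<i> * z\<^sup>2) = exp (\<i> * (2 * z\<^sup>2))"
        by (simp_all add: mult_ac)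
      ultimately show ?thesis unfolding free_lax_def sin_exp_eq by simp
    qed
    then have "- 2 * \<i> * sin (2 * z\<^sup>2) = (m11 - m22) - (m11 - free_lax z 1 1) + (m22 - free_lax z 2 2)"
      by simp
    then have "2 * cmod (sin (2 * z\<^sup>2)) = cmod ((m11 - m22) - (m11 - free_lax z 1 1) + (m22 - free_lax z 2 2))"
      by (metis norm_minus_cancel norm_mult norm_numeral norm_ii mult_1_right mult_minus_left)
    also have "\<dots> \<le> cmod (m11 - m22) + cmod (m11 - free_lax z 1 1) + cmod (m22 - free_lax z 2 2)"
      by (rule order_trans[OF norm_triangle_ineq add_right_mono[OF norm_triangle_ineq4]])
    \<comment> \<open>\<open>2 * b\<close> stems from the square root of the off-diagonal product,
      one \<open>b\<close> from each diagonal entry. With \<open>b * (1 + cmod z) = 3 * C\<close>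
      this leads to \<open>6 * C\<close>.\<close>
    also have "\<dots> \<le> 2 * b + b + b" using d b[of 1 1] b[of 2 2] unfolding m by (intro add_mono)
    finally have "cmod (sin (2 * z\<^sup>2)) \<le> 2 * b" by simp
    then have "cmod (sin (2 * z\<^sup>2)) * cmod z \<le> 2 * b * (1 + cmod z)"
      using b0 by (intro mult_mono) auto
    also have "\<dots> = 6 * C" using pos by (simp add: b_def)
    finally show "cmod (sin (2 * z\<^sup>2)) * cmod z \<le> 6 * C" .
  qed
  moreover have "6 * C \<ge> 0" using C by simp
  ultimately show ?thesis by blast
qed

lemma critical_point_bound:
  assumes "R > 0"
  shows "\<exists>C\<ge>0. \<forall>\<psi> z i n. norm \<psi> < R \<longrightarrow> i \<in> {1, 2} \<longrightarrow> n \<noteq> 0 \<longrightarrow> z \<in> D i n \<longrightarrow> deriv (discr \<psi>) z = 0 \<longrightarrow>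
     cmod (z - free_root i n) \<le> C / of_int \<bar>n\<bar>"
proof -
  obtain C where C: "C > 0" "\<And>\<psi> z. norm \<psi> < R \<Longrightarrow>
      cmod (deriv (discr \<psi>) z - (- 8 * z * sin (2 * z\<^sup>2))) \<le> C * norm \<psi> * growth z"
    using deriv_discr_asymptotics[OF assms] by blast
  have "cmod (z - free_root i n) \<le> C * R / of_int \<bar>n\<bar>"
    if \<psi>: "norm \<psi> < R" and i: "i \<in> {1, 2}" and n: "n \<noteq> 0" and z: "z \<in> D i n" and 0: "deriv (discr \<psi>) z = 0" for \<psi> z i n
  proof (rule diff_free_root_bound[OF i n z])
    have "growth z \<le> 3" using near_multiple_growth z in_D_iff[OF i n] by blast
    then have "C * norm \<psi> * growth z \<le> C * R * 3"
      using C(1) \<psi> assms growth_ge_1[of z] by (intro mult_mono) auto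
    moreover have "cmod (- 8 * z * sin (2 * z\<^sup>2)) = 8 * (cmod (sin (2 * z\<^sup>2)) * cmod z)"
      by (simp add: norm_mult)
    moreover have "cmod (- 8 * z * sin (2 * z\<^sup>2)) \<le> C * norm \<psi> * growth z"
      using C(2)[OF \<psi>, of z] unfolding 0 by simp
    moreover have "0 \<le> C * R" using C(1) assms by simp
    ultimately show "cmod (sin (2 * z\<^sup>2)) * cmod z \<le> C * R" by argo
  qed
  moreover have "C * R \<ge> 0" using C assms by simp
  ultimately show ?thesis by blast
qed

text \<open>At a zero of \<open>chi_P\<close> the discriminant is \<open>2\<close> or
  \<open>-2\<close>. On the disc the free value \<open>2 * cos (2 * z\<^sup>2)\<close> times
  \<open>(-1) powi n\<close> has real part at least \<open>1\<close>, so the wrong sign would force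
  an error of at least \<open>3\<close>, while \<open>growth z \<le> 3\<close> allows only
  \<open>3 / 100\<close>.\<close>

lemma discr_sign:
  assumes i: "i \<in> {1, 2}" and z: "z \<in> D i n" and chi: "chi_P \<psi> z = 0"
    and d: "cmod (discr \<psi> z - 2 * cos (2 * z\<^sup>2)) \<le> growth z / 100"
  shows "discr \<psi> z = 2 * (-1) powi n"
proof -
  obtain m :: int where m: "cmod (2 * z\<^sup>2 - of_int m * of_real pi) < pi / 4" "\<bar>m\<bar> = \<bar>n\<bar>"
  proof (cases "n = 0")
    case True
    then have "2 * (cmod z)\<^sup>2 < pi / 4" using z by (simp add: in_BB_iff)
    then have "cmod (2 * z\<^sup>2 - of_int 0 * of_real pi) < pi / 4" by (simp add: norm_mult norm_power)
    then show ?thesis using that[of 0] True by simp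
  next
    case False
    then show ?thesis using that[of "root_index i n"] z in_D_iff[OF i False] by simp
  qed
  define s where "s = ((-1) powi n :: complex)"
  \<comment> \<open>The multiple of pi at hand is \<open>n\<close> or \<open>- n\<close>, and only
    its parity counts.\<close>
  have par: "(-1) powi m = s"
    unfolding s_def power_int_minus_left using m(2) by (metis even_abs_add_iff abs_eq_iff even_minus power_int_1_left)
  have ss: "s * s = 1" unfolding s_def by (cases "even n") (simp_all add: power_int_minus_left)
  have ns: "cmod s = 1" unfolding s_def by (rule norm_powi_minus_one)
  define u where "u = 2 * z\<^sup>2 - of_int m * of_real pi"
  have cosu: "cos u = s * cos (2 * z\<^sup>2)" unfolding u_def cos_diff_int_pi par ..
  have "(discr \<psi> z - 2 * s) * (discr \<psi> z + 2 * s) = 0"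
    using chi ss by (simp add: chi_P_def power2_eq_square algebra_simps)
  then have "discr \<psi> z = 2 * s \<or> discr \<psi> z = - 2 * s"
    by (auto simp: add_eq_0_iff)
  moreover have "discr \<psi> z \<noteq> - 2 * s"
  proof
    assume eq: "discr \<psi> z = - 2 * s"
    have "s * (discr \<psi> z - 2 * cos (2 * z\<^sup>2)) = - 2 * (s * s) - 2 * cos u"
      unfolding eq cosu by (simp add: algebra_simps)
    then have "cmod (discr \<psi> z - 2 * cos (2 * z\<^sup>2)) = cmod (2 + 2 * cos u)"
      unfolding ss by (metis norm_mult ns mult_1 norm_minus_cancel minus_add_distrib add_uminus_conv_diff mult_minus_left mult_1_right)
    moreover have "3 \<le> Re (2 + 2 * cos u)" using Re_cos_ge[of u] m(1) unfolding u_def by simp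
    moreover have "growth z \<le> 3" by (rule near_multiple_growth[OF m(1)])
    ultimately show False using d complex_Re_le_cmod[of "2 + 2 * cos u"] by argo
  qed
  ultimately show ?thesis by (simp add: s_def)
qed

section \<open>Analyticity of the critical points\<close>

text \<open>
  By the argument principle the unique zero of \<open>H z\<close> in the disc is the quotient of the integrals of
  \<open>w H'/H\<close> and \<open>H'/H\<close>, whatever its multiplicity.
\<close>

lemma holomorphic_unique_zero:
  assumes "open S" and cont: "continuous_on (S \<times> UNIV) (\<lambda>(z, w). H z w)"
    and hol1: "\<And>w. (\<lambda>z. H z w) holomorphic_on S" and hol2: "\<And>z. z \<in> S \<Longrightarrow> H z holomorphic_on UNIV"
    and r: "r > 0" and nz: "\<And>z w. z \<in> S \<Longrightarrow> cmod (w - w0) = r \<Longrightarrow> H z w \<noteq> 0"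
    and c: "\<And>z. z \<in> S \<Longrightarrow> {w \<in> ball w0 r. H z w = 0} = {c z}"
  shows "c holomorphic_on S"
proof -
  define \<gamma> where "\<gamma> = circlepath w0 r"
  define \<gamma>' where "\<gamma>' = (\<lambda>t. 2 * of_real pi * \<i> * of_real r * exp (2 * of_real pi * \<i> * of_real t))"
  have \<gamma>: "\<gamma> t = w0 + of_real r * exp (2 * of_real pi * \<i> * of_real t)" for t
    by (simp add: \<gamma>_def circlepath)
  have \<gamma>r: "cmod (\<gamma> t - w0) = r" for t using r by (simp add: \<gamma> norm_mult)
  have c\<gamma>: "continuous_on A \<gamma>" "continuous_on A \<gamma>'" for A
    unfolding ext[of \<gamma>, OF \<gamma>] \<gamma>'_def by (intro continuous_intros)+
  define J where "J = (\<lambda>k z. integral (cbox 0 1) (\<lambda>t. deriv (H z) (\<gamma> t) * \<gamma> t ^ k / H z (\<gamma> t) * \<gamma>' t))"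
  have cont': "continuous_on (UNIV \<times> S) (\<lambda>(w, z). H z w)"
  proof -
    have "continuous_on (UNIV \<times> S) (\<lambda>p. (\<lambda>(z, w). H z w) (snd p, fst p))"
      by (rule continuous_on_compose2[OF cont]) (auto intro!: continuous_intros)
    then show ?thesis by (simp add: split_def)
  qed
  have contd: "continuous_on (UNIV \<times> S) (\<lambda>(w, z). deriv (H z) w)"
    using continuous_on_deriv_param[OF open_UNIV cont'] hol2 by simp
  have hJ: "J k holomorphic_on S" for k
    unfolding J_def
  proof (rule holomorphic_on_integral_param[OF \<open>open S\<close>])
    have "continuous_on (S \<times> cbox 0 1) (\<lambda>p. (\<lambda>(w, z). deriv (H z) w) (\<gamma> (snd p), fst p) * \<gamma> (snd p) ^ k /
        (\<lambda>(z, w). H z w) (fst p, \<gamma> (snd p)) * \<gamma>' (snd p))"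
    proof (intro continuous_on_mult continuous_on_divide continuous_on_power)
      have g: "continuous_on A (\<lambda>p. \<gamma> (snd p))" "continuous_on A (\<lambda>p. \<gamma>' (snd p))" for A :: "(complex \<times> real) set"
        by (rule continuous_on_compose2[OF c\<gamma>(1)[of UNIV]] continuous_on_compose2[OF c\<gamma>(2)[of UNIV]];
            intro continuous_intros subset_UNIV)+
      show "continuous_on (S \<times> cbox 0 1) (\<lambda>p. \<gamma> (snd p))" "continuous_on (S \<times> cbox 0 1) (\<lambda>p. \<gamma>' (snd p))"
        by (rule g)+
      show "continuous_on (S \<times> cbox 0 1) (\<lambda>p. (\<lambda>(w, z). deriv (H z) w) (\<gamma> (snd p), fst p))"
        by (rule continuous_on_compose2[OF contd]) (auto intro!: continuous_on_Pair g continuous_on_fst continuous_on_id)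
      show "continuous_on (S \<times> cbox 0 1) (\<lambda>p. (\<lambda>(z, w). H z w) (fst p, \<gamma> (snd p)))"
        by (rule continuous_on_compose2[OF cont]) (auto intro!: continuous_on_Pair g continuous_on_fst continuous_on_id)
      show "\<forall>p\<in>S \<times> cbox 0 1. (\<lambda>(z, w). H z w) (fst p, \<gamma> (snd p)) \<noteq> 0"
        by (auto simp: nz[OF _ \<gamma>r])
    qed
    then show "continuous_on (S \<times> cbox 0 1) (\<lambda>(z, t). deriv (H z) (\<gamma> t) * \<gamma> t ^ k / H z (\<gamma> t) * \<gamma>' t)"
      by (simp add: split_def)
    show "(\<lambda>z. deriv (H z) (\<gamma> t) * \<gamma> t ^ k / H z (\<gamma> t) * \<gamma>' t) holomorphic_on S" for t
      by (intro holomorphic_on_mult holomorphic_on_divide holomorphic_on_const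
            holomorphic_on_deriv_param[OF \<open>open S\<close> open_UNIV cont hol1 hol2] hol1 nz[OF _ \<gamma>r]) simp_all
  qed
  have J: "J k z = 2 * of_real pi * \<i> * (c z ^ k * of_nat (root_mult (H z) (c z)))" and m: "root_mult (H z) (c z) > 0"
    if z: "z \<in> S" for k z
  proof -
    have w0: "H z (w0 + of_real r) \<noteq> 0" using nz[OF z, of "w0 + of_real r"] r by simp
    define A where "A = ball w0 (r + 1)"
    have fin: "finite {w \<in> A. H z w = 0}"
      using finite_zeros_compact[OF hol2[OF z] w0 compact_cball[of w0 "r + 1"]]
      by (rule finite_subset[rotated]) (auto simp: A_def)
    have cz: "c z \<in> ball w0 r" "H z (c z) = 0" using c[OF z] by auto
    show "root_mult (H z) (c z) > 0" using root_mult_pos_iff[OF hol2[OF z] w0] cz by blast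
    have wn: "winding_number \<gamma> w = (if w \<in> ball w0 r then 1 else 0)" if "w \<notin> sphere w0 r" for w
    proof (cases "w \<in> ball w0 r")
      case True
      then show ?thesis by (simp add: \<gamma>_def winding_number_circlepath dist_norm norm_minus_commute)
    next
      case False
      then have "w \<notin> cball w0 r" using that by (auto simp: sphere_def)
      then have "winding_number \<gamma> w = 0"
        unfolding \<gamma>_def by (intro winding_number_zero_outside[of _ "cball w0 r"]) (use r in \<open>auto simp: path_image_circlepath\<close>)
      then show ?thesis using False by simp
    qed
    have ap: "contour_integral \<gamma> (\<lambda>x. deriv (H z) x * x ^ k / H z x) = 2 * pi * \<i> *
          (\<Sum>p\<in>{w \<in> A. H z w = 0 \<or> w \<in> {}}. winding_number \<gamma> p * p ^ k * zorder (H z) p)"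
    proof (rule argument_principle)
      show "H z holomorphic_on A - {}" using hol2[OF z] by (auto intro: holomorphic_on_subset)
      show "path_image \<gamma> \<subseteq> A - {w \<in> A. H z w = 0 \<or> w \<in> {}}"
        using nz[OF z] r by (auto simp: \<gamma>_def path_image_circlepath A_def dist_norm norm_minus_commute)
      show "\<forall>w. w \<notin> A \<longrightarrow> winding_number \<gamma> w = 0" using wn r by (auto simp: A_def)
      show "(\<lambda>x. x ^ k) holomorphic_on A" by (intro holomorphic_on_power holomorphic_on_ident)
      show "finite {w \<in> A. H z w = 0 \<or> w \<in> {}}" using fin by simp
    qed (simp_all add: A_def \<gamma>_def)
    have "(\<Sum>p\<in>{w \<in> A. H z w = 0 \<or> w \<in> {}}. winding_number \<gamma> p * p ^ k * zorder (H z) p) =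
       (\<Sum>p\<in>{w \<in> A. H z w = 0}. if p \<in> ball w0 r then p ^ k * of_nat (root_mult (H z) p) else 0)"
    proof (rule sum.cong)
      fix p assume p: "p \<in> {w \<in> A. H z w = 0}"
      then have "p \<notin> sphere w0 r" using nz[OF z] by (auto simp: dist_norm norm_minus_commute)
      then show "winding_number \<gamma> p * p ^ k * zorder (H z) p = (if p \<in> ball w0 r then p ^ k * of_nat (root_mult (H z) p) else 0)"
        using zorder_eq_root_mult[OF hol2[OF z] w0, of p] p by (simp add: wn)
    qed simp
    also have "\<dots> = (\<Sum>p\<in>{w \<in> A. H z w = 0} \<inter> ball w0 r. p ^ k * of_nat (root_mult (H z) p))"
      by (rule sum.inter_restrict[symmetric, OF fin])
    also have "{w \<in> A. H z w = 0} \<inter> ball w0 r = {w \<in> ball w0 r. H z w = 0}"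
      by (auto simp: A_def)
    also have "\<dots> = {c z}" by (rule c[OF z])
    finally have s: "(\<Sum>p\<in>{w \<in> A. H z w = 0 \<or> w \<in> {}}. winding_number \<gamma> p * p ^ k * zorder (H z) p) =
       c z ^ k * of_nat (root_mult (H z) (c z))" by simp
    have "contour_integral \<gamma> (\<lambda>x. deriv (H z) x * x ^ k / H z x) = J k z"
      unfolding contour_integral_integral J_def \<gamma>_def vector_derivative_circlepath \<gamma>'_def by simp
    then show "J k z = 2 * of_real pi * \<i> * (c z ^ k * of_nat (root_mult (H z) (c z)))"
      using ap unfolding s by simp
  qed
  have "(\<lambda>z. J 1 z / J 0 z) holomorphic_on S"
  proof (intro holomorphic_on_divide hJ)
    fix z assume "z \<in> S"
    then show "J 0 z \<noteq> 0" using m by (simp add: J)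
  qed
  moreover have "J 1 z / J 0 z = c z" if "z \<in> S" for z
    using m[OF that] by (simp add: J[OF that])
  ultimately show ?thesis by (subst holomorphic_cong[OF refl, of _ _ "\<lambda>z. J 1 z / J 0 z"]) auto
qed

lemma continuous_on_deriv_discr_line:
  "continuous_on (S \<times> UNIV) (\<lambda>(z, w). deriv (discr (\<psi> + scaleC_pot z h)) w)"
proof -
  have "continuous_on (UNIV \<times> UNIV) (\<lambda>p. (\<lambda>(z, w). discr (\<psi> + scaleC_pot z h) w) (snd p, fst p))"
    by (rule continuous_on_compose2[OF continuous_on_discr_line[of UNIV]]) (auto intro!: continuous_intros)
  then have "continuous_on (UNIV \<times> UNIV) (\<lambda>(w, z). discr (\<psi> + scaleC_pot z h) w)"
    by (simp add: split_def)
  from continuous_on_deriv_param[OF open_UNIV this]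
  have c: "continuous_on (UNIV \<times> UNIV) (\<lambda>(w, z). deriv (discr (\<psi> + scaleC_pot z h)) w)"
    by (simp add: holomorphic_discr)
  have "continuous_on (S \<times> UNIV) (\<lambda>p. (\<lambda>(w, z). deriv (discr (\<psi> + scaleC_pot z h)) w) (snd p, fst p))"
    by (rule continuous_on_compose2[OF c]) (auto intro!: continuous_intros)
  then show ?thesis by (simp add: split_def)
qed

lemma holomorphic_deriv_discr_line: "(\<lambda>z. deriv (discr (\<psi> + scaleC_pot z h)) w) holomorphic_on A"
proof -
  have "(\<lambda>z. deriv (discr (\<psi> + scaleC_pot z h)) w) holomorphic_on UNIV"
    by (rule holomorphic_on_deriv_param[OF open_UNIV open_UNIV continuous_on_discr_line])
       (auto intro: holomorphic_discr_line holomorphic_discr)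
  then show ?thesis by (rule holomorphic_on_subset) simp
qed

text \<open>Balls of potentials are not compact, so uniformity in \<open>w\<close> does not follow
  from joint continuity. It comes from Schwarz's lemma along the line from \<psi> to \<phi>, with a
  bound common to all \<open>w\<close> in \<open>K\<close>.\<close>

lemma deriv_discr_close:
  assumes "compact K" and "\<epsilon> > 0"
  shows "\<exists>\<delta>>0. \<forall>\<phi>\<in>ball \<psi> \<delta>. \<forall>w\<in>K. cmod (deriv (discr \<phi>) w - deriv (discr \<psi>) w) < \<epsilon>"
proof -
  define R where "R = norm \<psi> + 2"
  have R: "R > 0" by (simp add: R_def add_nonneg_pos)
  obtain C where C: "C > 0" "\<And>\<psi> z. norm \<psi> < R \<Longrightarrow>
      cmod (deriv (discr \<psi>) z - (- 8 * z * sin (2 * z\<^sup>2))) \<le> C * norm \<psi> * growth z"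
    using deriv_discr_asymptotics[OF R] by blast
  have "continuous_on K (\<lambda>z. C * R * growth z + cmod (- 8 * z * sin (2 * z\<^sup>2)))"
    unfolding growth_def by (intro continuous_intros)
  then have "bounded ((\<lambda>z. C * R * growth z + cmod (- 8 * z * sin (2 * z\<^sup>2))) ` K)"
    using \<open>compact K\<close> by (intro compact_imp_bounded compact_continuous_image)
  then obtain B where B: "B > 0" "\<And>z. z \<in> K \<Longrightarrow> \<bar>C * R * growth z + cmod (- 8 * z * sin (2 * z\<^sup>2))\<bar> \<le> B"
    unfolding bounded_pos by auto
  have "cmod (deriv (discr \<phi>) w - deriv (discr \<psi>) w) < \<epsilon>"
    if \<phi>: "\<phi> \<in> ball \<psi> (min 1 (\<epsilon> / (4 * (B + 1))))" and w: "w \<in> K" for \<phi> w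
  proof -
    have n: "norm (\<phi> - \<psi>) < 1" "norm (\<phi> - \<psi>) < \<epsilon> / (4 * (B + 1))"
      using \<phi> by (simp_all add: dist_norm norm_minus_commute)
    have "cmod (deriv (discr (\<psi> + (\<phi> - \<psi>))) w - deriv (discr \<psi>) w) \<le> 2 * (B + 1) * norm (\<phi> - \<psi>) / 1"
    proof (rule gateaux_holomorphic_Lipschitz[OF _ _ _ n(1)])
      show "gateaux_holomorphic (\<lambda>\<psi>. deriv (discr \<psi>) w) (ball \<psi> 1)"
        unfolding gateaux_holomorphic_def by (intro allI holomorphic_deriv_discr_line)
      fix \<eta> assume "\<eta> \<in> ball \<psi> 1"
      then have "norm \<eta> < R"
        using norm_triangle_ineq2[of \<eta> \<psi>] by (simp add: R_def dist_norm norm_minus_commute)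
      then have "cmod (deriv (discr \<eta>) w - (- 8 * w * sin (2 * w\<^sup>2))) \<le> C * norm \<eta> * growth w" "C * norm \<eta> * growth w \<le> C * R * growth w"
        using C growth_ge_1[of w] by (auto intro!: mult_right_mono mult_left_mono)
      then have "cmod (deriv (discr \<eta>) w) \<le> C * R * growth w + cmod (- 8 * w * sin (2 * w\<^sup>2))"
        using norm_triangle_sub[of "deriv (discr \<eta>) w" "- 8 * w * sin (2 * w\<^sup>2)"] by linarith
      then show "cmod (deriv (discr \<eta>) w) < B + 1" using B(2)[OF w] by linarith
    qed simp
    also have "\<dots> < \<epsilon>"
    proof -
      have "2 * (B + 1) * norm (\<phi> - \<psi>) \<le> 2 * (B + 1) * (\<epsilon> / (4 * (B + 1)))"
        using n(2) B(1) by (intro mult_left_mono) auto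
      also have "\<dots> = \<epsilon> / 2"
      proof -
        define b where "b = B + 1"
        have "b > 0" using B(1) by (simp add: b_def)
        then show ?thesis unfolding b_def[symmetric] by simp
      qed
      finally show ?thesis using \<open>\<epsilon> > 0\<close> by simp
    qed
    finally show ?thesis by simp
  qed
  moreover have "min 1 (\<epsilon> / (4 * (B + 1))) > 0" using B(1) \<open>\<epsilon> > 0\<close> by simp
  ultimately show ?thesis by blast
qed

text \<open>By Rouche's theorem on a fixed circle about \<open>c \<psi>\<close> a nearby potential
  still has a zero inside, and uniqueness in \<open>G\<close> identifies it as
  \<open>c \<phi>\<close>. Thus one circle encloses exactly the point \<open>c \<phi>\<close> for
  all \<phi> in a ball, as the argument principle requires.\<close>

lemma critical_point_locally_holomorphic:
  assumes "open W" and "open G" and W: "\<And>\<psi>. \<psi> \<in> W \<Longrightarrow> crit_pts \<psi> \<inter> G = {c \<psi>}" and \<psi>: "\<psi> \<in> W"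
  shows "\<exists>\<delta>>0. ball \<psi> \<delta> \<subseteq> W \<and> gateaux_holomorphic c (ball \<psi> \<delta>)"
proof -
  have c0: "c \<psi> \<in> G" "deriv (discr \<psi>) (c \<psi>) = 0" using W[OF \<psi>] by (auto simp: crit_pts_def)
  obtain r where r: "r > 0" "cball (c \<psi>) r \<subseteq> G" using \<open>open G\<close> c0 by (meson open_contains_cball)
  have nz0: "deriv (discr \<psi>) w \<noteq> 0" if "w \<in> sphere (c \<psi>) r" for w
  proof
    assume "deriv (discr \<psi>) w = 0"
    then have "w \<in> crit_pts \<psi> \<inter> G" using that r by (auto simp: crit_pts_def)
    then have "w = c \<psi>" using W[OF \<psi>] by blast
    then show False using that r by simp
  qed
  have cs: "continuous_on (sphere (c \<psi>) r) (\<lambda>w. cmod (deriv (discr \<psi>) w))"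
    by (intro continuous_on_norm holomorphic_on_imp_continuous_on holomorphic_deriv_discr)
  have ne: "sphere (c \<psi>) r \<noteq> {}" using r by simp
  obtain w1 where w1: "w1 \<in> sphere (c \<psi>) r" "\<And>w. w \<in> sphere (c \<psi>) r \<Longrightarrow> cmod (deriv (discr \<psi>) w1) \<le> cmod (deriv (discr \<psi>) w)"
    using continuous_attains_inf[OF compact_sphere ne cs] by blast
  define \<epsilon> where "\<epsilon> = cmod (deriv (discr \<psi>) w1)"
  have \<epsilon>: "\<epsilon> > 0" using nz0[OF w1(1)] by (simp add: \<epsilon>_def)
  obtain \<delta>1 where \<delta>1: "\<delta>1 > 0" "\<And>\<phi> w. \<phi> \<in> ball \<psi> \<delta>1 \<Longrightarrow> w \<in> sphere (c \<psi>) r \<Longrightarrow> cmod (deriv (discr \<phi>) w - deriv (discr \<psi>) w) < \<epsilon>"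
    using deriv_discr_close[OF compact_sphere[of "c \<psi>" r] \<epsilon>, of \<psi>] by blast
  obtain \<delta>2 where \<delta>2: "\<delta>2 > 0" "ball \<psi> \<delta>2 \<subseteq> W" using \<open>open W\<close> \<psi> by (meson open_contains_ball)
  define \<delta> where "\<delta> = min \<delta>1 \<delta>2"
  have \<delta>: "\<delta> > 0" "ball \<psi> \<delta> \<subseteq> W" using \<delta>1 \<delta>2 by (auto simp: \<delta>_def)
  have less: "cmod (deriv (discr \<phi>) w - deriv (discr \<psi>) w) < cmod (deriv (discr \<psi>) w)"
    if "\<phi> \<in> ball \<psi> \<delta>" "cmod (w - c \<psi>) = r" for \<phi> w
  proof -
    have w: "w \<in> sphere (c \<psi>) r" using that(2) by (simp add: dist_norm norm_minus_commute)
    have "\<phi> \<in> ball \<psi> \<delta>1" using that(1) by (simp add: \<delta>_def)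
    from \<delta>1(2)[OF this w] w1(2)[OF w] show ?thesis by (simp add: \<epsilon>_def)
  qed
  have zeros: "{w \<in> ball (c \<psi>) r. deriv (discr \<phi>) w = 0} = {c \<phi>}" if \<phi>: "\<phi> \<in> ball \<psi> \<delta>" for \<phi>
  proof -
    have sub: "{w \<in> ball (c \<psi>) r. deriv (discr \<eta>) w = 0} \<subseteq> {c \<eta>}" if "\<eta> \<in> ball \<psi> \<delta>" for \<eta>
    proof -
      have "\<eta> \<in> W" using that \<delta> by blast
      then show ?thesis using W[of \<eta>] r(2) ball_subset_cball by (fastforce simp: crit_pts_def)
    qed
    have w: "deriv (discr \<psi>) (c \<psi> + of_real r) \<noteq> 0" using nz0 r by (simp add: dist_norm)
    have "root_count (deriv (discr \<phi>)) (ball (c \<psi>) r) = root_count (deriv (discr \<psi>)) (ball (c \<psi>) r)"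
      by (rule root_count_ball_eq[OF holomorphic_deriv_discr holomorphic_deriv_discr r(1) less[OF \<phi>]])
    moreover have "{w \<in> ball (c \<psi>) r. deriv (discr \<psi>) w = 0} = {c \<psi>}" using sub[of \<psi>] c0 r \<delta> by auto
    then have "root_count (deriv (discr \<psi>)) (ball (c \<psi>) r) > 0"
      unfolding root_count_def using root_mult_pos_iff[OF holomorphic_deriv_discr w] c0 by simp
    ultimately have "root_count (deriv (discr \<phi>)) (ball (c \<psi>) r) \<noteq> 0" by simp
    then have "{w \<in> ball (c \<psi>) r. deriv (discr \<phi>) w = 0} \<noteq> {}" unfolding root_count_def by (metis sum.empty)
    with sub[OF \<phi>] show ?thesis by blast
  qed
  have "gateaux_holomorphic c (ball \<psi> \<delta>)"
    unfolding gateaux_holomorphic_def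
  proof (intro allI)
    fix \<phi> h
    define S where "S = {z. \<phi> + scaleC_pot z h \<in> ball \<psi> \<delta>}"
    have "(\<lambda>z. c (\<phi> + scaleC_pot z h)) holomorphic_on S"
    proof (rule holomorphic_unique_zero[where H = "\<lambda>z. deriv (discr (\<phi> + scaleC_pot z h))"])
      show "open S" unfolding S_def by (rule open_complex_line_preimage[OF open_ball])
      show "continuous_on (S \<times> UNIV) (\<lambda>(z, w). deriv (discr (\<phi> + scaleC_pot z h)) w)"
        by (rule continuous_on_deriv_discr_line)
      show "deriv (discr (\<phi> + scaleC_pot z h)) w \<noteq> 0" if "z \<in> S" "cmod (w - c \<psi>) = r" for z w
        using less[of "\<phi> + scaleC_pot z h" w] that by (auto simp: S_def)
      show "{w \<in> ball (c \<psi>) r. deriv (discr (\<phi> + scaleC_pot z h)) w = 0} = {c (\<phi> + scaleC_pot z h)}" if "z \<in> S" for z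
        using that by (intro zeros) (simp add: S_def)
    qed (auto intro: holomorphic_deriv_discr_line holomorphic_deriv_discr r)
    then show "(\<lambda>z. c (\<phi> + scaleC_pot z h)) holomorphic_on {z. \<phi> + scaleC_pot z h \<in> ball \<psi> \<delta>}" by (simp only: S_def)
  qed
  with \<delta> show ?thesis by blast
qed

lemma gateaux_holomorphic_if_locally:
  assumes "open W" and loc: "\<And>\<psi>. \<psi> \<in> W \<Longrightarrow> \<exists>\<delta>>0. ball \<psi> \<delta> \<subseteq> W \<and> gateaux_holomorphic F (ball \<psi> \<delta>)"
  shows "gateaux_holomorphic F W"
  unfolding gateaux_holomorphic_def
proof (intro allI)
  fix \<psi> h
  show "(\<lambda>z. F (\<psi> + scaleC_pot z h)) holomorphic_on {z. \<psi> + scaleC_pot z h \<in> W}"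
    unfolding holomorphic_on_def
  proof
    fix z assume "z \<in> {z. \<psi> + scaleC_pot z h \<in> W}"
    then obtain \<delta> where \<delta>: "\<delta> > 0" "gateaux_holomorphic F (ball (\<psi> + scaleC_pot z h) \<delta>)" using loc by blast
    have "(\<lambda>z. F (\<psi> + scaleC_pot z h)) field_differentiable at z"
      by (rule holomorphic_on_imp_differentiable_at[OF \<delta>(2)[unfolded gateaux_holomorphic_def, rule_format]
            open_complex_line_preimage[OF open_ball]]) (use \<delta>(1) in simp)
    then show "(\<lambda>z. F (\<psi> + scaleC_pot z h)) field_differentiable (at z within {z. \<psi> + scaleC_pot z h \<in> W})"
      by (rule field_differentiable_at_within)
  qed
qed

section \<open>Labelings\<close>

lemma lists_rootsD:
  assumes "lists_roots zs f S" "x \<in> set zs"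
  shows "x \<in> S" "f x = 0"
proof -
  have "count_list zs x \<noteq> 0" using assms(2) by (simp add: count_list_0_iff)
  then have "(if x \<in> S then root_mult f x else 0) \<noteq> 0" using assms(1) unfolding lists_roots_def by metis
  then show "x \<in> S" "f x = 0" by (auto simp: root_mult_def split: if_splits)
qed

lemma lists_roots_set:
  assumes "lists_roots zs f S" "f holomorphic_on UNIV" "f w \<noteq> 0"
  shows "set zs = {x \<in> S. f x = 0}"
proof (intro set_eqI iffI)
  fix x assume "x \<in> {x \<in> S. f x = 0}"
  then have "root_mult f x > 0" "x \<in> S" using root_mult_pos_iff[OF assms(2,3)] by auto
  then have "count_list zs x \<noteq> 0" using assms(1) unfolding lists_roots_def by simp
  then show "x \<in> set zs" by (simp add: count_list_0_iff)
qed (use lists_rootsD[OF assms(1)] in auto)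

text \<open>A sum over an infinite set is \<open>0\<close> by convention, so an identically
  vanishing function has \<open>root_count\<close> equal to \<open>0\<close> on a disc, against
  \<open>m > 0\<close>.\<close>

lemma localized_imp_not_identically_zero:
  assumes "localized f k m N" "m > 0"
  shows "\<exists>w. f w \<noteq> 0"
proof (rule ccontr)
  assume "\<nexists>w. f w \<noteq> 0"
  then have "{z \<in> BB N. f z = 0} = BB N" by auto
  moreover have "infinite (BB N)"
    unfolding BB_def by (intro uncountable_infinite uncountable_ball) (simp add: add_nonneg_pos)
  ultimately have "root_count f (BB N) = 0" by (simp add: root_count_def)
  with assms show False by (simp add: localized_def)
qed

text \<open>The labeling refers to the minimal \<open>N0\<close> of the individual potential;
  minimality bounds it by any \<open>N\<close> for which localization is known.\<close>

lemma periodic_labelingD: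
  assumes lab: "periodic_labeling \<psi> l p" and loc: "localized (chi_P \<psi>) 2 (4 * (2 * N + 1)) N"
  obtains N0 where "N0 \<le> N"
    "\<And>i n. i \<in> {1, 2} \<Longrightarrow> \<bar>n\<bar> > int N0 \<Longrightarrow> lists_roots [l i n, p i n] (chi_P \<psi>) (D i n)"
    "lists_roots (periodic_list l p N0) (chi_P \<psi>) (BB N0)"
proof -
  from lab obtain N0 where N0: "\<forall>N'<N0. \<not> localized (chi_P \<psi>) 2 (4 * (2 * N' + 1)) N'"
    "\<forall>i\<in>{1, 2}. \<forall>n. \<bar>n\<bar> > int N0 \<longrightarrow> lists_roots [l i n, p i n] (chi_P \<psi>) (D i n) \<and> lex_le (l i n) (p i n)"
    "lists_roots (periodic_list l p N0) (chi_P \<psi>) (BB N0)"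
    unfolding periodic_labeling_def by blast
  have "N0 \<le> N" using N0(1) loc by (meson not_le)
  then show thesis using that N0(2,3) by blast
qed

lemma critical_labelingD:
  assumes lab: "critical_labeling \<psi> c" and loc: "localized (deriv (discr \<psi>)) 1 (4 * N + 3) N"
  obtains N0 mid z where "N0 \<le> N" "set mid = {c 1 0, c 2 0, z}"
    "\<And>i n. i \<in> {1, 2} \<Longrightarrow> \<bar>n\<bar> > int N0 \<Longrightarrow> lists_roots [c i n] (deriv (discr \<psi>)) (D i n)"
    "lists_roots (map (\<lambda>(i, n). c i n) (left_labels N0) @ mid @ map (\<lambda>(i, n). c i n) (right_labels N0))
       (deriv (discr \<psi>)) (BB N0)"
proof -
  from lab obtain N0 mid z where N0: "\<forall>N'<N0. \<not> localized (deriv (discr \<psi>)) 1 (4 * N' + 3) N'"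
    "\<forall>i\<in>{1, 2}. \<forall>n. \<bar>n\<bar> > int N0 \<longrightarrow> lists_roots [c i n] (deriv (discr \<psi>)) (D i n)"
    "mset mid = {#c 1 0, c 2 0, z#}"
    "lists_roots (map (\<lambda>(i, n). c i n) (left_labels N0) @ mid @ map (\<lambda>(i, n). c i n) (right_labels N0))
       (deriv (discr \<psi>)) (BB N0)"
    unfolding critical_labeling_def Let_def by blast
  have "N0 \<le> N" using N0(1) loc by (meson not_le)
  moreover have "set mid = {c 1 0, c 2 0, z}" using arg_cong[OF N0(3), of set_mset] by simp
  ultimately show thesis using that N0(2,4) by blast
qed

lemma BB_mono: "N \<le> M \<Longrightarrow> BB N \<subseteq> BB M"
proof
  fix z assume "N \<le> M" "z \<in> BB N"
  moreover from this have "(real N + 1 / 4) * pi \<le> (real M + 1 / 4) * pi" by (intro mult_right_mono) auto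
  ultimately show "z \<in> BB M" unfolding in_BB_iff by linarith
qed

lemma labels_cover:
  assumes "i \<in> {1, 2}" "\<bar>n\<bar> \<le> int N" "n \<noteq> 0"
  shows "(i, n) \<in> set (left_labels N) \<union> set (right_labels N)"
  using assms by (cases "n < 0") (auto simp: left_labels_def right_labels_def image_iff)

text \<open>Passage from \<open>N0\<close>, which depends on \<psi>, to a uniform \<open>N\<close>:
  a label with index between the two lies in its disc \<open>D i n\<close>, which is contained in
  \<open>BB N\<close>.\<close>

lemma periodic_label_location:
  assumes lab: "periodic_labeling \<psi> l p" and loc: "localized (chi_P \<psi>) 2 (4 * (2 * N + 1)) N"
    and i: "i \<in> {1, 2}" and x: "x \<in> {l i n, p i n}"
  shows "chi_P \<psi> x = 0" and "\<bar>n\<bar> > int N \<Longrightarrow> x \<in> D i n" and "\<bar>n\<bar> \<le> int N \<Longrightarrow> x \<in> BB N"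
proof -
  obtain N0 where N0: "N0 \<le> N"
    "\<And>i n. i \<in> {1, 2} \<Longrightarrow> \<bar>n\<bar> > int N0 \<Longrightarrow> lists_roots [l i n, p i n] (chi_P \<psi>) (D i n)"
    "lists_roots (periodic_list l p N0) (chi_P \<psi>) (BB N0)"
    by (rule periodic_labelingD[OF lab loc]) blast
  have "chi_P \<psi> x = 0 \<and> (\<bar>n\<bar> > int N0 \<longrightarrow> x \<in> D i n) \<and> (\<bar>n\<bar> \<le> int N0 \<longrightarrow> x \<in> BB N0)"
  proof (cases "\<bar>n\<bar> > int N0")
    case True
    then show ?thesis using lists_rootsD[OF N0(2)[OF i True], of x] x by auto
  next
    case False
    have "(i, n) \<in> set (left_labels N0 @ [(1, 0), (2, 0)] @ right_labels N0)"
      using labels_cover[OF i, of n N0] False i by (cases "n = 0") auto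
    then have "x \<in> set (periodic_list l p N0)" unfolding periodic_list_def using x by force
    then show ?thesis using lists_rootsD[OF N0(3), of x] False by auto
  qed
  moreover have "BB N0 \<subseteq> BB N" by (rule BB_mono[OF N0(1)])
  moreover have "x \<in> BB N" if "x \<in> D i n" "\<bar>n\<bar> > int N0" "\<bar>n\<bar> \<le> int N"
    using D_subset_BB[OF i _ that(3,1)] that(2) by force
  ultimately show "chi_P \<psi> x = 0" "\<bar>n\<bar> > int N \<Longrightarrow> x \<in> D i n" "\<bar>n\<bar> \<le> int N \<Longrightarrow> x \<in> BB N"
    using N0(1) by (auto simp: not_less)
qed

lemma critical_label_location:
  assumes lab: "critical_labeling \<psi> c" and loc: "localized (deriv (discr \<psi>)) 1 (4 * N + 3) N"
    and i: "i \<in> {1, 2}"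
  shows "deriv (discr \<psi>) (c i n) = 0" and "\<bar>n\<bar> > int N \<Longrightarrow> c i n \<in> D i n" and "\<bar>n\<bar> \<le> int N \<Longrightarrow> c i n \<in> BB N"
proof -
  obtain N0 mid z where N0: "N0 \<le> N" "set mid = {c 1 0, c 2 0, z}"
    "\<And>i n. i \<in> {1, 2} \<Longrightarrow> \<bar>n\<bar> > int N0 \<Longrightarrow> lists_roots [c i n] (deriv (discr \<psi>)) (D i n)"
    "lists_roots (map (\<lambda>(i, n). c i n) (left_labels N0) @ mid @ map (\<lambda>(i, n). c i n) (right_labels N0))
       (deriv (discr \<psi>)) (BB N0)"
    by (rule critical_labelingD[OF lab loc]) blast
  have "deriv (discr \<psi>) (c i n) = 0 \<and> (\<bar>n\<bar> > int N0 \<longrightarrow> c i n \<in> D i n) \<and> (\<bar>n\<bar> \<le> int N0 \<longrightarrow> c i n \<in> BB N0)"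
  proof (cases "\<bar>n\<bar> > int N0")
    case True
    then show ?thesis using lists_rootsD[OF N0(3)[OF i True], of "c i n"] by auto
  next
    case False
    have "c i n \<in> set (map (\<lambda>(i, n). c i n) (left_labels N0) @ mid @ map (\<lambda>(i, n). c i n) (right_labels N0))"
    proof (cases "n = 0")
      case True
      then show ?thesis using N0(2) i by auto
    next
      case n: False
      then show ?thesis using labels_cover[OF i, of n N0] False by force
    qed
    then show ?thesis using lists_rootsD[OF N0(4)] False by auto
  qed
  moreover have "BB N0 \<subseteq> BB N" by (rule BB_mono[OF N0(1)])
  moreover have "c i n \<in> BB N" if "c i n \<in> D i n" "\<bar>n\<bar> > int N0" "\<bar>n\<bar> \<le> int N"
    using D_subset_BB[OF i _ that(3,1)] that(2) by force
  ultimately show "deriv (discr \<psi>) (c i n) = 0" "\<bar>n\<bar> > int N \<Longrightarrow> c i n \<in> D i n" "\<bar>n\<bar> \<le> int N \<Longrightarrow> c i n \<in> BB N"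
    using N0(1) by (auto simp: not_less)
qed

text \<open>Localization holds with \<open>N = 0\<close> here, so every label with nonzero index
  lies in its own disc and the others in \<open>BB 0\<close>; each of these regions contains a
  single point of the free zero set.\<close>

lemma labels_at_zero_potential:
  assumes lab: "periodic_labeling 0 l p" "critical_labeling 0 c" and i: "i \<in> {1, 2}"
  shows "l i n = free_root i n" "p i n = free_root i n" "c i n = free_root i n"
proof -
  have loc: "localized (chi_P 0) 2 (4 * (2 * 0 + 1)) 0" "localized (deriv (discr 0)) 1 (4 * 0 + 3) 0"
    using localized_near_zero by auto
  have d0: "discr 0 = (\<lambda>z. 2 * cos (2 * z\<^sup>2))" by (simp add: fun_eq_iff discr_zero)
  have root: "x = free_root i n"
    if f: "free_zeros f k a" "f x = 0" and x: "\<bar>n\<bar> > int 0 \<Longrightarrow> x \<in> D i n" "\<bar>n\<bar> \<le> int 0 \<Longrightarrow> x \<in> BB 0" for x f k a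
  proof -
    obtain m :: int where m: "2 * x\<^sup>2 = of_int m * of_real pi" using f by (auto simp: free_zeros_def)
    show ?thesis
    proof (cases "n = 0")
      case True
      then have s: "2 * (cmod x)\<^sup>2 < pi / 4" using x(2) by (simp add: in_BB_iff)
      have "cmod (2 * x\<^sup>2) = \<bar>of_int m\<bar> * pi" unfolding m by (simp add: norm_mult)
      then have "\<bar>of_int m\<bar> * pi < 1 * pi" using s pi_gt_zero by (simp add: norm_mult norm_power)
      then have "\<bar>of_int m :: real\<bar> < 1" by (simp only: mult_less_cancel_right_pos[OF pi_gt_zero])
      then have "m = 0" by linarith
      then show ?thesis using m True by simp
    next
      case False
      then show ?thesis using zero_in_D_eq_free_root[OF i False _ m] x(1) by simp
    qed
  qed
  have chi: "chi_P 0 x = (2 * cos (2 * x\<^sup>2))\<^sup>2 - 4" for x by (simp add: chi_P_def discr_zero)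
  have lp: "x = free_root i n" if "x \<in> {l i n, p i n}" for x
    using periodic_label_location[OF lab(1) loc(1) i that] by (intro root[OF free_zeros_periodic]) (auto simp: chi)
  then show "l i n = free_root i n" "p i n = free_root i n" by auto
  show "c i n = free_root i n"
    using critical_label_location[OF lab(2) loc(2) i, of n]
    by (intro root[OF free_zeros_critical]) (auto simp: d0 deriv_free_discr)
qed

lemma periodic_in_discs_if_localized:
  assumes lab: "periodic_labeling \<psi> l p" and loc: "localized (chi_P \<psi>) 2 4 0"
  shows "periodic_in_discs \<psi> l p"
proof -
  obtain w where w: "chi_P \<psi> w \<noteq> 0" using localized_imp_not_identically_zero[OF loc] by auto
  have loc': "localized (chi_P \<psi>) 2 (4 * (2 * 0 + 1)) 0" using loc by simp
  obtain N0 :: nat where N0: "N0 \<le> 0"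
    "\<And>i n. i \<in> {1, 2} \<Longrightarrow> \<bar>n\<bar> > int N0 \<Longrightarrow> lists_roots [l i n, p i n] (chi_P \<psi>) (D i n)"
    "lists_roots (periodic_list l p N0) (chi_P \<psi>) (BB N0)"
    by (rule periodic_labelingD[OF lab loc']) blast
  have N0_eq: "N0 = 0" using N0(1) by simp
  note N0 = N0[unfolded N0_eq]
  have sig: "sigma_P \<psi> \<inter> S = {x \<in> S. chi_P \<psi> x = 0}" for S
    unfolding sigma_P_def by blast
  have off: "sigma_P \<psi> \<inter> D i n = {l i n, p i n}" if "i \<in> {1, 2}" "n \<noteq> 0" for i n
    unfolding sig
    by (subst lists_roots_set[OF N0(2)[OF that(1), of n] holomorphic_chi_P w, symmetric]) (use that(2) in simp_all)
  have at0: "sigma_P \<psi> \<inter> D i 0 = {l 1 0, p 1 0, l 2 0, p 2 0}" for i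
  proof -
    have "sigma_P \<psi> \<inter> D i 0 = set (periodic_list l p N0)"
      unfolding sig D_0 lists_roots_set[OF N0(3) holomorphic_chi_P w] N0_eq by simp
    also have "\<dots> = {l 1 0, p 1 0, l 2 0, p 2 0}"
      by (simp add: N0_eq periodic_list_def left_labels_def right_labels_def)
    finally show ?thesis .
  qed
  show ?thesis unfolding periodic_in_discs_def
    by (intro conjI ballI allI impI; (rule off, assumption+ | rule at0))
qed

lemma critical_in_discs_if_localized:
  assumes lab: "critical_labeling \<psi> c" and loc: "localized (deriv (discr \<psi>)) 1 3 0"
  shows "critical_in_discs \<psi> c"
proof -
  obtain w where w: "deriv (discr \<psi>) w \<noteq> 0" using localized_imp_not_identically_zero[OF loc] by auto
  have loc': "localized (deriv (discr \<psi>)) 1 (4 * 0 + 3) 0" using loc by simp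
  obtain N0 :: nat and mid z where N0: "N0 \<le> 0" "set mid = {c 1 0, c 2 0, z}"
    "\<And>i n. i \<in> {1, 2} \<Longrightarrow> \<bar>n\<bar> > int N0 \<Longrightarrow> lists_roots [c i n] (deriv (discr \<psi>)) (D i n)"
    "lists_roots (map (\<lambda>(i, n). c i n) (left_labels N0) @ mid @ map (\<lambda>(i, n). c i n) (right_labels N0))
       (deriv (discr \<psi>)) (BB N0)"
    by (rule critical_labelingD[OF lab loc']) blast
  have N0_eq: "N0 = 0" using N0(1) by simp
  note N0 = N0[unfolded N0_eq]
  have crit: "crit_pts \<psi> \<inter> S = {x \<in> S. deriv (discr \<psi>) x = 0}" for S
    unfolding crit_pts_def by blast
  have off: "crit_pts \<psi> \<inter> D i n = {c i n}" if "i \<in> {1, 2}" "n \<noteq> 0" for i n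
    unfolding crit
    by (subst lists_roots_set[OF N0(3)[OF that(1), of n] holomorphic_deriv_discr w, symmetric]) (use that(2) in simp_all)
  have at0: "crit_pts \<psi> \<inter> D i 0 = {c 1 0, c 2 0, z}" for i
  proof -
    have "crit_pts \<psi> \<inter> D i 0 = set (map (\<lambda>(i, n). c i n) (left_labels N0) @ mid @ map (\<lambda>(i, n). c i n) (right_labels N0))"
      unfolding crit D_0 lists_roots_set[OF N0(4) holomorphic_deriv_discr w] N0_eq by simp
    also have "\<dots> = set mid" by (simp add: N0_eq left_labels_def right_labels_def)
    finally show ?thesis unfolding N0(2) .
  qed
  show ?thesis unfolding critical_in_discs_def
    by (intro conjI ballI allI impI; (rule off, assumption+ | rule exI, rule at0))
qed

lemma sqrt_weight_le: "n \<noteq> 0 \<Longrightarrow> sqrt (1 + (of_int n)\<^sup>2) \<le> 2 * of_int \<bar>n\<bar>"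
proof -
  assume "n \<noteq> 0"
  then have "1 \<le> (of_int \<bar>n\<bar> :: real)" by linarith
  then have "1\<^sup>2 \<le> (of_int \<bar>n\<bar> :: real)\<^sup>2" by (intro power_mono) auto
  then have "1 + (of_int n)\<^sup>2 \<le> (2 * of_int \<bar>n\<bar> :: real)\<^sup>2" by (simp add: power_mult_distrib)
  then show ?thesis by (intro real_le_lsqrt) auto
qed

text \<open>For indices up to \<open>N\<close> the weight is bounded and both points lie in a fixed
  disc, so this finite part only enlarges the constant. Beyond \<open>N\<close> the weight is at
  most \<open>2 * \<bar>n\<bar>\<close> and cancels the decay.\<close>

lemma weighted_deviation_bound:
  assumes "C \<ge> 0"
  obtains K where "\<And>i n x. i \<in> {1, 2} \<Longrightarrow> (\<bar>n\<bar> > int N \<Longrightarrow> cmod (x - free_root i n) \<le> C / of_int \<bar>n\<bar>) \<Longrightarrow>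
     (\<bar>n\<bar> \<le> int N \<Longrightarrow> x \<in> BB N) \<Longrightarrow> sqrt (1 + (of_int n)\<^sup>2) * cmod (x - free_root i n) \<le> K"
proof
  define \<rho> where "\<rho> = sqrt ((real N + 1 / 4) * pi / 2)"
  fix i :: nat and n :: int and x
  assume i: "i \<in> {1, 2}" and far: "\<bar>n\<bar> > int N \<Longrightarrow> cmod (x - free_root i n) \<le> C / of_int \<bar>n\<bar>"
    and near: "\<bar>n\<bar> \<le> int N \<Longrightarrow> x \<in> BB N"
  have \<rho>0: "\<rho> \<ge> 0" by (simp add: \<rho>_def)
  show "sqrt (1 + (of_int n)\<^sup>2) * cmod (x - free_root i n) \<le> max (2 * C) (sqrt (1 + (real N)\<^sup>2) * (\<rho> + sqrt (real N * pi / 2)))"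
  proof (cases "\<bar>n\<bar> > int N")
    case True
    then have n: "n \<noteq> 0" by auto
    have "sqrt (1 + (of_int n)\<^sup>2) * cmod (x - free_root i n) \<le> (2 * of_int \<bar>n\<bar>) * (C / of_int \<bar>n\<bar>)"
      using sqrt_weight_le[OF n] far[OF True] by (intro mult_mono) auto
    also have "\<dots> = 2 * C" using n by simp
    finally show ?thesis by simp
  next
    case False
    then have nN: "\<bar>of_int n :: real\<bar> \<le> real N" by linarith
    have "cmod x \<le> \<rho>" using near False by (simp add: BB_def \<rho>_def)
    moreover have "cmod (free_root i n) \<le> sqrt (real N * pi / 2)"
      unfolding norm_free_root[OF i] using nN by (intro real_sqrt_le_mono) (simp add: mult_right_mono)
    ultimately have "cmod (x - free_root i n) \<le> \<rho> + sqrt (real N * pi / 2)"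
      using norm_triangle_ineq4[of x "free_root i n"] by linarith
    moreover have "sqrt (1 + (of_int n)\<^sup>2) \<le> sqrt (1 + (real N)\<^sup>2)"
      using power_mono[OF nN, of 2] by (intro real_sqrt_le_mono) simp
    ultimately have "sqrt (1 + (of_int n)\<^sup>2) * cmod (x - free_root i n) \<le> sqrt (1 + (real N)\<^sup>2) * (\<rho> + sqrt (real N * pi / 2))"
      by (intro mult_mono) auto
    then show ?thesis by simp
  qed
qed

lemma linf1_le:
  assumes "\<And>n. n \<in> S \<Longrightarrow> sqrt (1 + (of_int n)\<^sup>2) * cmod (a n) \<le> K"
  shows "linf1 S a \<le> ereal K"
  unfolding linf1_def by (rule SUP_least) (use assms in simp)

theorem theorem3p17:
  fixes B :: "pot set"
    and lm lp c :: "pot \<Rightarrow> nat \<Rightarrow> int \<Rightarrow> complex"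
  assumes "bounded B" and "0 \<in> interior B"
    and "\<And>\<psi>. periodic_labeling \<psi> (lm \<psi>) (lp \<psi>)"
    and "\<And>\<psi>. critical_labeling \<psi> (c \<psi>)"
  shows
    "(\<forall>i\<in>{1, 2}.
        (SUP \<psi>\<in>B. linf1 UNIV (\<lambda>n. lm \<psi> i n - lm 0 i n)) < \<infinity> \<and>
        (SUP \<psi>\<in>B. linf1 UNIV (\<lambda>n. lp \<psi> i n - lp 0 i n)) < \<infinity> \<and>
        (SUP \<psi>\<in>B. linf1 UNIV (\<lambda>n. c \<psi> i n - c 0 i n)) < \<infinity> \<and>
        (\<forall>n. lm 0 i n = free_root i n \<and> lp 0 i n = free_root i n \<and> c 0 i n = free_root i n)) \<and>
     (\<exists>W\<subseteq>B. 0 \<in> interior W \<and>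
        (\<forall>\<psi>\<in>W.
           periodic_in_discs \<psi> (lm \<psi>) (lp \<psi>) \<and>
           (\<forall>i\<in>{1, 2}. \<forall>n. discr \<psi> (lm \<psi> i n) = 2 * (-1) powi n \<and>
                            discr \<psi> (lp \<psi> i n) = 2 * (-1) powi n) \<and>
           critical_in_discs \<psi> (c \<psi>))) \<and>
     (\<forall>W\<subseteq>B. open W \<and> 0 \<in> W \<and> (\<forall>\<psi>\<in>W. critical_in_discs \<psi> (c \<psi>)) \<longrightarrow>
        (\<forall>i\<in>{1, 2}.
           (\<forall>n. n \<noteq> 0 \<longrightarrow> analytic_on_pot (\<lambda>\<psi>. c \<psi> i n) W) \<and>
           (\<forall>\<psi>\<in>W. \<forall>\<psi>s. (\<forall>k. \<psi>s k \<in> W) \<and> \<psi>s \<longlonglongrightarrow> \<psi> \<longrightarrow>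
              (\<lambda>k. linf1 (UNIV - {0}) (\<lambda>n. c (\<psi>s k) i n - c \<psi> i n)) \<longlonglongrightarrow> 0)))"
proof (intro conjI)
  obtain R where R: "R > 0" "\<And>\<psi>. \<psi> \<in> B \<Longrightarrow> norm \<psi> < R"
    using \<open>bounded B\<close> unfolding bounded_pos by (metis add_pos_pos less_add_one order_le_less_trans zero_less_one)
  obtain N where N: "\<And>\<psi>. norm \<psi> < R \<Longrightarrow> localized (chi_P \<psi>) 2 (4 * (2 * N + 1)) N"
    "\<And>\<psi>. norm \<psi> < R \<Longrightarrow> localized (deriv (discr \<psi>)) 1 (4 * N + 3) N"
    using localized_uniformly[OF R(1)] by blast
  obtain C1 where C1: "C1 \<ge> 0" "\<And>\<psi> z i n. norm \<psi> \<le> R \<Longrightarrow> i \<in> {1, 2} \<Longrightarrow> n \<noteq> 0 \<Longrightarrow> z \<in> D i n \<Longrightarrow> chi_P \<psi> z = 0 \<Longrightarrow>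
     cmod (z - free_root i n) \<le> C1 / of_int \<bar>n\<bar>"
    using periodic_eigenvalue_bound[of R] by blast
  obtain C2 where C2: "C2 \<ge> 0" "\<And>\<psi> z i n. norm \<psi> < R \<Longrightarrow> i \<in> {1, 2} \<Longrightarrow> n \<noteq> 0 \<Longrightarrow> z \<in> D i n \<Longrightarrow> deriv (discr \<psi>) z = 0 \<Longrightarrow>
     cmod (z - free_root i n) \<le> C2 / of_int \<bar>n\<bar>"
    using critical_point_bound[OF R(1)] by blast
  note zero = labels_at_zero_potential[OF assms(3)[of 0] assms(4)[of 0]]
  show "\<forall>i\<in>{1, 2}.
        (SUP \<psi>\<in>B. linf1 UNIV (\<lambda>n. lm \<psi> i n - lm 0 i n)) < \<infinity> \<and>
        (SUP \<psi>\<in>B. linf1 UNIV (\<lambda>n. lp \<psi> i n - lp 0 i n)) < \<infinity> \<and>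
        (SUP \<psi>\<in>B. linf1 UNIV (\<lambda>n. c \<psi> i n - c 0 i n)) < \<infinity> \<and>
        (\<forall>n. lm 0 i n = free_root i n \<and> lp 0 i n = free_root i n \<and> c 0 i n = free_root i n)"
  proof
    fix i :: nat assume i: "i \<in> {1, 2}"
    obtain K1 where K1: "\<And>i n x. i \<in> {1, 2} \<Longrightarrow> (\<bar>n\<bar> > int N \<Longrightarrow> cmod (x - free_root i n) \<le> C1 / of_int \<bar>n\<bar>) \<Longrightarrow>
       (\<bar>n\<bar> \<le> int N \<Longrightarrow> x \<in> BB N) \<Longrightarrow> sqrt (1 + (of_int n)\<^sup>2) * cmod (x - free_root i n) \<le> K1"
      using weighted_deviation_bound[OF C1(1), of N] by blast
    obtain K2 where K2: "\<And>i n x. i \<in> {1, 2} \<Longrightarrow> (\<bar>n\<bar> > int N \<Longrightarrow> cmod (x - free_root i n) \<le> C2 / of_int \<bar>n\<bar>) \<Longrightarrow>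
       (\<bar>n\<bar> \<le> int N \<Longrightarrow> x \<in> BB N) \<Longrightarrow> sqrt (1 + (of_int n)\<^sup>2) * cmod (x - free_root i n) \<le> K2"
      using weighted_deviation_bound[OF C2(1), of N] by blast
    have p: "sqrt (1 + (of_int n)\<^sup>2) * cmod (x - free_root i n) \<le> K1"
      if \<psi>: "\<psi> \<in> B" and x: "x \<in> {lm \<psi> i n, lp \<psi> i n}" for \<psi> n x
    proof (rule K1[OF i])
      note loc = periodic_label_location[OF assms(3) N(1)[OF R(2)[OF \<psi>]] i x]
      show "x \<in> BB N" if "\<bar>n\<bar> \<le> int N" by (rule loc(3)[OF that])
      show "cmod (x - free_root i n) \<le> C1 / of_int \<bar>n\<bar>" if "\<bar>n\<bar> > int N"
        by (rule C1(2)[OF less_imp_le[OF R(2)[OF \<psi>]] i _ loc(2)[OF that] loc(1)]) (use that in auto)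
    qed
    have cr: "sqrt (1 + (of_int n)\<^sup>2) * cmod (c \<psi> i n - free_root i n) \<le> K2" if \<psi>: "\<psi> \<in> B" for \<psi> n
    proof (rule K2[OF i])
      note loc = critical_label_location[OF assms(4) N(2)[OF R(2)[OF \<psi>]] i, of n]
      show "c \<psi> i n \<in> BB N" if "\<bar>n\<bar> \<le> int N" by (rule loc(3)[OF that])
      show "cmod (c \<psi> i n - free_root i n) \<le> C2 / of_int \<bar>n\<bar>" if "\<bar>n\<bar> > int N"
        by (rule C2(2)[OF R(2)[OF \<psi>] i _ loc(2)[OF that] loc(1)]) (use that in auto)
    qed
    have "(SUP \<psi>\<in>B. linf1 UNIV (\<lambda>n. lm \<psi> i n - lm 0 i n)) \<le> ereal K1"
      "(SUP \<psi>\<in>B. linf1 UNIV (\<lambda>n. lp \<psi> i n - lp 0 i n)) \<le> ereal K1"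
      "(SUP \<psi>\<in>B. linf1 UNIV (\<lambda>n. c \<psi> i n - c 0 i n)) \<le> ereal K2"
      using p cr by (auto intro!: SUP_least linf1_le simp: zero[OF i])
    then show "(SUP \<psi>\<in>B. linf1 UNIV (\<lambda>n. lm \<psi> i n - lm 0 i n)) < \<infinity> \<and>
        (SUP \<psi>\<in>B. linf1 UNIV (\<lambda>n. lp \<psi> i n - lp 0 i n)) < \<infinity> \<and>
        (SUP \<psi>\<in>B. linf1 UNIV (\<lambda>n. c \<psi> i n - c 0 i n)) < \<infinity> \<and>
        (\<forall>n. lm 0 i n = free_root i n \<and> lp 0 i n = free_root i n \<and> c 0 i n = free_root i n)"
      using zero[OF i] by (auto intro: le_less_trans)
  qed
  show "\<exists>W\<subseteq>B. 0 \<in> interior W \<and>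
        (\<forall>\<psi>\<in>W.
           periodic_in_discs \<psi> (lm \<psi>) (lp \<psi>) \<and>
           (\<forall>i\<in>{1, 2}. \<forall>n. discr \<psi> (lm \<psi> i n) = 2 * (-1) powi n \<and>
                            discr \<psi> (lp \<psi> i n) = 2 * (-1) powi n) \<and>
           critical_in_discs \<psi> (c \<psi>))"
  proof -
    obtain \<delta> where \<delta>: "\<delta> > 0" "\<And>\<psi>. norm \<psi> < \<delta> \<Longrightarrow> localized (chi_P \<psi>) 2 4 0"
      "\<And>\<psi>. norm \<psi> < \<delta> \<Longrightarrow> localized (deriv (discr \<psi>)) 1 3 0"
      "\<And>\<psi> z. norm \<psi> < \<delta> \<Longrightarrow> cmod (discr \<psi> z - 2 * cos (2 * z\<^sup>2)) \<le> growth z / 100"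
      using localized_near_zero by blast
    obtain e where e: "e > 0" "ball 0 e \<subseteq> B" using \<open>0 \<in> interior B\<close> by (auto simp: mem_interior)
    have "periodic_in_discs \<psi> (lm \<psi>) (lp \<psi>) \<and>
           (\<forall>i\<in>{1, 2}. \<forall>n. discr \<psi> (lm \<psi> i n) = 2 * (-1) powi n \<and>
                            discr \<psi> (lp \<psi> i n) = 2 * (-1) powi n) \<and>
           critical_in_discs \<psi> (c \<psi>)" if "\<psi> \<in> ball 0 (min e \<delta>)" for \<psi>
    proof -
      have \<psi>: "norm \<psi> < \<delta>" using that by simp
      have "discr \<psi> x = 2 * (-1) powi n" if i: "i \<in> {1, 2}" and x: "x \<in> {lm \<psi> i n, lp \<psi> i n}" for i n x
      proof -
        have loc: "localized (chi_P \<psi>) 2 (4 * (2 * 0 + 1)) 0" using \<delta>(2)[OF \<psi>] by simp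
        note pl = periodic_label_location[OF assms(3) loc i x]
        \<comment> \<open>With \<open>N = 0\<close> the two location statements merge, as
          \<open>D i 0\<close> is \<open>BB 0\<close>.\<close>
        have "x \<in> D i n" using pl(2,3) by (cases "n = 0") auto
        then show ?thesis using pl(1) \<delta>(4)[OF \<psi>] by (intro discr_sign[OF i]) auto
      qed
      then show ?thesis
        using periodic_in_discs_if_localized[OF assms(3) \<delta>(2)[OF \<psi>]]
          critical_in_discs_if_localized[OF assms(4) \<delta>(3)[OF \<psi>]] by blast
    qed
    moreover have "ball 0 (min e \<delta>) \<subseteq> B" using e by auto
    moreover have "0 \<in> interior (ball 0 (min e \<delta>) :: pot set)" using e \<delta>(1) by (simp add: interior_open)
    ultimately show ?thesis by blast
  qed
  show "\<forall>W\<subseteq>B. open W \<and> 0 \<in> W \<and> (\<forall>\<psi>\<in>W. critical_in_discs \<psi> (c \<psi>)) \<longrightarrow>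
        (\<forall>i\<in>{1, 2}.
           (\<forall>n. n \<noteq> 0 \<longrightarrow> analytic_on_pot (\<lambda>\<psi>. c \<psi> i n) W) \<and>
           (\<forall>\<psi>\<in>W. \<forall>\<psi>s. (\<forall>k. \<psi>s k \<in> W) \<and> \<psi>s \<longlonglongrightarrow> \<psi> \<longrightarrow>
              (\<lambda>k. linf1 (UNIV - {0}) (\<lambda>n. c (\<psi>s k) i n - c \<psi> i n)) \<longlonglongrightarrow> 0))"
  proof (intro allI impI ballI)
    fix W and i :: nat
    assume WB: "W \<subseteq> B" and "open W \<and> 0 \<in> W \<and> (\<forall>\<psi>\<in>W. critical_in_discs \<psi> (c \<psi>))" and i: "i \<in> {1, 2}"
    then have W: "open W" and disc: "\<And>\<psi> n. \<psi> \<in> W \<Longrightarrow> n \<noteq> 0 \<Longrightarrow> crit_pts \<psi> \<inter> D i n = {c \<psi> i n}"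
      unfolding critical_in_discs_def by blast+
    \<comment> \<open>The disc property alone places the critical point in \<open>D i n\<close>, so
      this holds for all nonzero \<open>n\<close> on all of \<open>W\<close>, without a threshold
      \<open>N\<close>.\<close>
    have dev: "cmod (c \<psi> i n - free_root i n) \<le> C2 / of_int \<bar>n\<bar>" if "\<psi> \<in> W" "n \<noteq> 0" for \<psi> n
    proof (rule C2(2)[OF _ i that(2)])
      show "norm \<psi> < R" using R(2) WB that by blast
      show "c \<psi> i n \<in> D i n" "deriv (discr \<psi>) (c \<psi> i n) = 0" using disc[OF that] by (auto simp: crit_pts_def)
    qed
    have loc: "\<exists>\<delta>>0. ball \<psi> \<delta> \<subseteq> W \<and> gateaux_holomorphic (\<lambda>\<psi>. c \<psi> i n) (ball \<psi> \<delta>)" if "\<psi> \<in> W" "n \<noteq> 0" for \<psi> n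
      by (rule critical_point_locally_holomorphic[OF W open_D[OF i]]) (use disc that in auto)
    have gh: "gateaux_holomorphic (\<lambda>\<psi>. c \<psi> i n) W" if "n \<noteq> 0" for n
      by (rule gateaux_holomorphic_if_locally[OF W loc[OF _ that]])
    have "analytic_on_pot (\<lambda>\<psi>. c \<psi> i n) W" if n: "n \<noteq> 0" for n
    proof (rule analytic_on_pot_if_gateaux_holomorphic[OF W])
      fix \<psi> assume \<psi>: "\<psi> \<in> W"
      obtain r where r: "r > 0" "ball \<psi> r \<subseteq> W" using W \<psi> by (meson open_contains_ball)
      have "cmod (c \<phi> i n) < cmod (free_root i n) + C2 / of_int \<bar>n\<bar> + 1" if "\<phi> \<in> ball \<psi> r" for \<phi>
        using dev[of \<phi> n] that r n norm_triangle_sub[of "c \<phi> i n" "free_root i n"] by fastforce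
      then show "\<exists>r>0. \<exists>K. gateaux_holomorphic (\<lambda>\<psi>. c \<psi> i n) (ball \<psi> r) \<and> (\<forall>\<phi>\<in>ball \<psi> r. cmod (c \<phi> i n) < K)"
        using r gateaux_holomorphic_subset[OF gh[OF n] r(2)] by blast
    qed
    moreover have "(\<lambda>k. linf1 (UNIV - {0}) (\<lambda>n. c (\<psi>s k) i n - c \<psi> i n)) \<longlonglongrightarrow> 0"
      if \<psi>: "\<psi> \<in> W" and \<psi>s: "\<And>k. \<psi>s k \<in> W" "\<psi>s \<longlonglongrightarrow> \<psi>" for \<psi> \<psi>s
    proof -
      obtain r where r: "r > 0" "ball \<psi> r \<subseteq> W" using W \<psi> by (meson open_contains_ball)
      \<comment> \<open>One factor \<open>2\<close> comes from the Lipschitz bound and one from the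
        weight, which is at most \<open>2 * \<bar>n\<bar>\<close>. \<open>C2 + 1\<close> in place of
        \<open>C2\<close> makes the bound strict.\<close>
      define L where "L = 4 * (C2 + 1) / r"
      have Lip: "linf1 (UNIV - {0}) (\<lambda>n. c \<phi> i n - c \<psi> i n) \<le> ereal (L * norm (\<phi> - \<psi>))"
        if \<phi>: "norm (\<phi> - \<psi>) < r" for \<phi>
      proof (rule linf1_le)
        fix n :: int assume "n \<in> UNIV - {0}"
        then have n: "n \<noteq> 0" by simp
        have n1: "(of_int \<bar>n\<bar> :: real) > 0" using n by simp
        \<comment> \<open>Subtracting the free root, a constant in \<psi>, leaves a function of size
          \<open>1 / \<bar>n\<bar>\<close> on a ball whose radius is the same for all
          \<open>n\<close>. Its Lipschitz constant therefore decays at the rate that the weight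
          requires.\<close>
        have "cmod ((c (\<psi> + (\<phi> - \<psi>)) i n - free_root i n) - (c \<psi> i n - free_root i n))
            \<le> 2 * ((C2 + 1) / of_int \<bar>n\<bar>) * norm (\<phi> - \<psi>) / r"
        proof (rule gateaux_holomorphic_Lipschitz[OF _ r(1) _ \<phi>])
          show "gateaux_holomorphic (\<lambda>\<psi>. c \<psi> i n - free_root i n) (ball \<psi> r)"
            using gateaux_holomorphic_subset[OF gh[OF n] r(2)]
            unfolding gateaux_holomorphic_def by (intro allI holomorphic_intros) blast
          fix \<eta> assume "\<eta> \<in> ball \<psi> r"
          then have "cmod (c \<eta> i n - free_root i n) \<le> C2 / of_int \<bar>n\<bar>" using dev[OF _ n] r(2) by blast
          also have "\<dots> < (C2 + 1) / of_int \<bar>n\<bar>" using n1 by (intro divide_strict_right_mono) auto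
          finally show "cmod (c \<eta> i n - free_root i n) < (C2 + 1) / of_int \<bar>n\<bar>" .
        qed
        then have "cmod (c \<phi> i n - c \<psi> i n) \<le> 2 * ((C2 + 1) / of_int \<bar>n\<bar>) * norm (\<phi> - \<psi>) / r" by simp
        then have "sqrt (1 + (of_int n)\<^sup>2) * cmod (c \<phi> i n - c \<psi> i n) \<le>
            (2 * of_int \<bar>n\<bar>) * (2 * ((C2 + 1) / of_int \<bar>n\<bar>) * norm (\<phi> - \<psi>) / r)"
          using sqrt_weight_le[OF n] by (intro mult_mono) auto
        also have "\<dots> = L * norm (\<phi> - \<psi>)" using n1 by (simp add: L_def)
        finally show "sqrt (1 + (of_int n)\<^sup>2) * cmod (c \<phi> i n - c \<psi> i n) \<le> L * norm (\<phi> - \<psi>)" .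
      qed
      have d: "(\<lambda>k. norm (\<psi>s k - \<psi>)) \<longlonglongrightarrow> 0" using \<psi>s(2) by (simp add: LIM_zero_iff tendsto_norm_zero)
      show ?thesis
      proof (rule tendsto_sandwich[of "\<lambda>_. 0"])
        \<comment> \<open>The index \<open>1\<close> is a witness that the supremum is not taken
          over the empty set, where it would be minus infinity.\<close>
        have "0 \<le> linf1 (UNIV - {0}) a" for a
          unfolding linf1_def by (rule SUP_upper2[of 1]) auto
        then show "\<forall>\<^sub>F k in sequentially. 0 \<le> linf1 (UNIV - {0}) (\<lambda>n. c (\<psi>s k) i n - c \<psi> i n)" by simp
        have "\<forall>\<^sub>F k in sequentially. norm (\<psi>s k - \<psi>) < r" using d r(1) by (rule order_tendstoD)
        then show "\<forall>\<^sub>F k in sequentially. linf1 (UNIV - {0}) (\<lambda>n. c (\<psi>s k) i n - c \<psi> i n) \<le> ereal (L * norm (\<psi>s k - \<psi>))"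
          by eventually_elim (rule Lip)
        have "(\<lambda>k. L * norm (\<psi>s k - \<psi>)) \<longlonglongrightarrow> L * 0" by (intro tendsto_mult tendsto_const d)
        then show "(\<lambda>k. ereal (L * norm (\<psi>s k - \<psi>))) \<longlonglongrightarrow> 0" by (simp add: zero_ereal_def)
      qed simp
    qed
    ultimately show "(\<forall>n. n \<noteq> 0 \<longrightarrow> analytic_on_pot (\<lambda>\<psi>. c \<psi> i n) W) \<and>
           (\<forall>\<psi>\<in>W. \<forall>\<psi>s. (\<forall>k. \<psi>s k \<in> W) \<and> \<psi>s \<longlonglongrightarrow> \<psi> \<longrightarrow>
              (\<lambda>k. linf1 (UNIV - {0}) (\<lambda>n. c (\<psi>s k) i n - c \<psi> i n)) \<longlonglongrightarrow> 0)" by blast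
  qed
qed

end
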